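(* Let $V:\mathbb{R}\to\mathbb{R}$ be integrable with compact support contained in $[-1,1]$. Assume that $\lambda=0$ is an eigenvalue of the operator $\mathcal{N}$ with an eigenfunction $u$, and set $\theta:=u(1)/u(-1)$. Then the operators $S_\varepsilon$ converge to $S(\theta)$ as $\varepsilon\to 0$ in the norm resolvent sense.
   Context: For $\varepsilon>0$, $S_\varepsilon=-\frac{d^2}{dx^2}+\frac{1}{\varepsilon^2}V\left(\frac{x}{\varepsilon}\right)$ is the Schr\"odinger operator on the real line, acting in $L_2(\mathbb{R})$, with domain $\operatorname{dom}S_\varepsilon=W_2^2(\mathbb{R})$. $\mathcal{N}$ is the Sturm--Liouville operator given by $\mathcal{N}y=-y''+Vy$ on the interval $[-1,1]$ subject to the Neumann boundary conditions $y'(-1)=y'(1)=0$. For an open set $\Omega\subset\mathbb{R}$, $W_2^2(\Omega)$ is the Sobolev space of functions on $\Omega$ that belong to $L_2(\Omega)$ together with their derivatives up to order $2$. $S(\theta)$ is the free Schr\"odinger operator on the line acting by $S(\theta)y=-y''$ (on $\mathbb{R}\setminus\{0\}$) on the domain $$\operatorname{dom}S(\theta)=\{y\in W_2^2(\mathbb{R}\setminus\{0\}) : y(0+)=\theta y(0-),\ \theta y'(0+)=y'(0-)\};$$ it is self-adjoint in $L_2(\mathbb{R})$. Norm resolvent convergence of $S_\varepsilon$ to $S$ means $\|(S_\varepsilon-z)^{-1}-(S-z)^{-1}\|\to0$ in the operator norm on $L_2(\mathbb{R})$ for $z\in\mathbb{C}\setminus\mathbb{R}$.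
   Formalization: The domain W_2^2(R) of S_ε is replaced by all y with y, y' in L_2(R), y'' locally integrable and -y''+ε^{-2}V(x/ε)y in L_2(R): for V integrable but not in L_2, S_ε does not map W_2^2(R) into L_2(R); for V in L_2 the two domains coincide. *)

theory Defs
  imports "HOL-Analysis.Analysis"
begin

section \<open>Square integrable functions and the Hilbert space \<open>L\<^sub>2(\<real>)\<close>\<close>

definition sq_integrable_on :: "(real \<Rightarrow> complex) \<Rightarrow> real set \<Rightarrow> bool" where
  "sq_integrable_on f \<Omega> \<longleftrightarrow>
     set_borel_measurable lebesgue \<Omega> f \<and> set_integrable lebesgue \<Omega> (\<lambda>x. (cmod (f x))\<^sup>2)"

lemma sq_integrable_on_UNIV:
  "sq_integrable_on f UNIV \<longleftrightarrow>
     f \<in> borel_measurable lebesgue \<and> integrable lebesgue (\<lambda>x. (cmod (f x))\<^sup>2)"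
  by (simp add: sq_integrable_on_def set_borel_measurable_def set_integrable_def)

lemma sq_integrable_inner:
  assumes "sq_integrable_on f UNIV" "sq_integrable_on g UNIV"
  shows "integrable lebesgue (\<lambda>x. f x \<bullet> g x)"
proof (rule Bochner_Integration.integrable_bound)
  show "integrable lebesgue (\<lambda>x. (cmod (f x))\<^sup>2 + (cmod (g x))\<^sup>2)"
    using assms by (simp add: sq_integrable_on_UNIV)
  show "(\<lambda>x. f x \<bullet> g x) \<in> borel_measurable lebesgue"
    using assms by (auto simp: sq_integrable_on_UNIV)
  have "\<bar>f x \<bullet> g x\<bar> \<le> (cmod (f x))\<^sup>2 + (cmod (g x))\<^sup>2" for x
  proof -
    have "\<bar>f x \<bullet> g x\<bar> \<le> cmod (f x) * cmod (g x)"
      by (rule Cauchy_Schwarz_ineq2)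
    also have "\<dots> \<le> (cmod (f x))\<^sup>2 + (cmod (g x))\<^sup>2"
      using sum_squares_bound[of "cmod (f x)" "cmod (g x)"]
        mult_nonneg_nonneg[OF norm_ge_zero[of "f x"] norm_ge_zero[of "g x"]]
      by linarith
    finally show ?thesis .
  qed
  then show "AE x in lebesgue. norm (f x \<bullet> g x) \<le> norm ((cmod (f x))\<^sup>2 + (cmod (g x))\<^sup>2)"
    by simp
qed

lemma sq_integrable_add:
  assumes "sq_integrable_on f UNIV" "sq_integrable_on g UNIV"
  shows "sq_integrable_on (\<lambda>x. f x + g x) UNIV"
proof -
  have "(cmod (f x + g x))\<^sup>2 = (cmod (f x))\<^sup>2 + (cmod (g x))\<^sup>2 + 2 * (f x \<bullet> g x)" for x
    by (simp add: power2_norm_eq_inner inner_add_left inner_add_right inner_commute)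
  then show ?thesis
    using assms sq_integrable_inner[OF assms]
    by (simp add: sq_integrable_on_UNIV borel_measurable_add)
qed

lemma sq_integrable_cmult:
  "sq_integrable_on f UNIV \<Longrightarrow> sq_integrable_on (\<lambda>x. c * f x) UNIV"
  by (simp add: sq_integrable_on_UNIV norm_mult power_mult_distrib borel_measurable_times)

lemma sq_integrable_scaleR:
  "sq_integrable_on f UNIV \<Longrightarrow> sq_integrable_on (\<lambda>x. r *\<^sub>R f x) UNIV"
  by (simp add: sq_integrable_on_UNIV power_mult_distrib borel_measurable_scaleR)

lemma sq_integrable_uminus:
  "sq_integrable_on f UNIV \<Longrightarrow> sq_integrable_on (\<lambda>x. - f x) UNIV"
  by (simp add: sq_integrable_on_UNIV)

lemma sq_integrable_zero: "sq_integrable_on (\<lambda>x. 0) UNIV"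
  by (simp add: sq_integrable_on_UNIV)

definition l2_rel :: "(real \<Rightarrow> complex) \<Rightarrow> (real \<Rightarrow> complex) \<Rightarrow> bool" where
  "l2_rel f g \<longleftrightarrow> sq_integrable_on f UNIV \<and> sq_integrable_on g UNIV \<and> (AE x in lebesgue. f x = g x)"

quotient_type l2 = "real \<Rightarrow> complex" / partial: l2_rel
proof (rule part_equivpI)
  show "\<exists>f. l2_rel f f"
    using sq_integrable_zero by (auto simp: l2_rel_def)
  show "symp l2_rel"
    by (auto intro!: sympI simp: l2_rel_def elim: eventually_mono)
  show "transp l2_rel"
    by (rule transpI, unfold l2_rel_def) (auto elim: eventually_elim2)
qed

text \<open>\<^const>\<open>abs_l2\<close> \<open>f\<close> is the class of \<open>f\<close>; it is meaningful only for square integrable \<open>f\<close>.\<close>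

lift_definition scaleC_l2 :: "complex \<Rightarrow> l2 \<Rightarrow> l2" is "\<lambda>c f x. c * f x"
  by (auto simp: l2_rel_def sq_integrable_cmult elim: eventually_mono)

text \<open>
  The library has no class of complex inner product spaces. As a real inner product space,
  \<open>L\<^sub>2(\<real>)\<close> carries the real part of the complex inner product, which induces the same norm;
  multiplication by complex scalars is \<^const>\<open>scaleC_l2\<close>.
\<close>

instantiation l2 :: real_inner
begin

lift_definition zero_l2 :: l2 is "\<lambda>x. 0"
  by (auto simp: l2_rel_def sq_integrable_zero)

lift_definition plus_l2 :: "l2 \<Rightarrow> l2 \<Rightarrow> l2" is "\<lambda>f g x. f x + g x"
  by (auto simp: l2_rel_def sq_integrable_add elim: eventually_elim2)

lift_definition uminus_l2 :: "l2 \<Rightarrow> l2" is "\<lambda>f x. - f x"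
  by (auto simp: l2_rel_def sq_integrable_uminus elim: eventually_mono)

lift_definition scaleR_l2 :: "real \<Rightarrow> l2 \<Rightarrow> l2" is "\<lambda>r f x. r *\<^sub>R f x"
  by (auto simp: l2_rel_def sq_integrable_scaleR elim: eventually_mono)

lift_definition inner_l2 :: "l2 \<Rightarrow> l2 \<Rightarrow> real" is "\<lambda>f g. LINT x|lebesgue. f x \<bullet> g x"
proof (rule integral_cong_AE)
  fix f g h k assume fg: "l2_rel f g" and hk: "l2_rel h k"
  show "(\<lambda>x. f x \<bullet> h x) \<in> borel_measurable lebesgue" "(\<lambda>x. g x \<bullet> k x) \<in> borel_measurable lebesgue"
    using fg hk by (auto simp: l2_rel_def sq_integrable_on_UNIV)
  show "AE x in lebesgue. f x \<bullet> h x = g x \<bullet> k x"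
    using fg hk unfolding l2_rel_def by (auto elim: eventually_elim2)
qed

definition minus_l2 :: "l2 \<Rightarrow> l2 \<Rightarrow> l2" where
  "minus_l2 f g = f + - g"

definition norm_l2 :: "l2 \<Rightarrow> real" where
  "norm_l2 f = sqrt (f \<bullet> f)"

definition dist_l2 :: "l2 \<Rightarrow> l2 \<Rightarrow> real" where
  "dist_l2 f g = norm (f - g)"

definition sgn_l2 :: "l2 \<Rightarrow> l2" where
  "sgn_l2 f = scaleR (inverse (norm f)) f"

definition uniformity_l2 :: "(l2 \<times> l2) filter" where
  "uniformity_l2 = (INF e\<in>{0<..}. principal {(f, g). dist f g < e})"

definition open_l2 :: "l2 set \<Rightarrow> bool" where
  "open_l2 U \<longleftrightarrow> (\<forall>f\<in>U. eventually (\<lambda>(f', g). f' = f \<longrightarrow> g \<in> U) uniformity)"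

instance
proof
  fix f g h :: l2 and r s :: real
  show "f + g + h = f + (g + h)"
    by transfer (auto simp: l2_rel_def sq_integrable_add add.assoc)
  show "f + g = g + f"
    by transfer (auto simp: l2_rel_def sq_integrable_add add.commute)
  show "0 + f = f"
    by transfer (auto simp: l2_rel_def)
  show "- f + f = 0"
    by transfer (auto simp: l2_rel_def sq_integrable_zero)
  show "f - g = f + - g"
    by (rule minus_l2_def)
  show "r *\<^sub>R (f + g) = r *\<^sub>R f + r *\<^sub>R g"
    by transfer (auto simp: l2_rel_def scaleR_add_right intro!: sq_integrable_add sq_integrable_scaleR)
  show "(r + s) *\<^sub>R f = r *\<^sub>R f + s *\<^sub>R f"
    by transfer (auto simp: l2_rel_def scaleR_add_left intro!: sq_integrable_add sq_integrable_scaleR)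
  show "r *\<^sub>R s *\<^sub>R f = (r * s) *\<^sub>R f"
    by transfer (auto simp: l2_rel_def intro!: sq_integrable_scaleR)
  show "1 *\<^sub>R f = f"
    by transfer (auto simp: l2_rel_def)
  show "dist f g = norm (f - g)"
    by (rule dist_l2_def)
  show "sgn f = scaleR (inverse (norm f)) f"
    by (rule sgn_l2_def)
  show "uniformity = (INF e\<in>{0<..}. principal {(f :: l2, g). dist f g < e})"
    by (rule uniformity_l2_def)
  show "open U = (\<forall>f\<in>U. eventually (\<lambda>(f', g). f' = f \<longrightarrow> g \<in> U) uniformity)" for U :: "l2 set"
    by (rule open_l2_def)
  show "f \<bullet> g = g \<bullet> f"
    by transfer (simp add: inner_commute)
  show "(f + g) \<bullet> h = f \<bullet> h + g \<bullet> h"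
    by transfer (simp add: l2_rel_def inner_add_left sq_integrable_inner)
  show "(r *\<^sub>R f) \<bullet> g = r * (f \<bullet> g)"
    by transfer simp
  show "0 \<le> f \<bullet> f"
    by transfer (simp add: integral_nonneg_AE)
  show "f \<bullet> f = 0 \<longleftrightarrow> f = 0"
  proof transfer
    fix f assume "l2_rel f f"
    then have f: "sq_integrable_on f UNIV" by (simp add: l2_rel_def)
    have "(LINT x|lebesgue. f x \<bullet> f x) = 0 \<longleftrightarrow> (AE x in lebesgue. f x \<bullet> f x = 0)"
      using sq_integrable_inner[OF f f] by (intro integral_nonneg_eq_0_iff_AE) auto
    then show "(LINT x|lebesgue. f x \<bullet> f x) = 0 \<longleftrightarrow> l2_rel f (\<lambda>x. 0)"
      using f by (simp add: l2_rel_def sq_integrable_zero)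
  qed
  show "norm f = sqrt (f \<bullet> f)"
    by (rule norm_l2_def)
qed

end

lemma norm_abs_l2:
  assumes "sq_integrable_on f UNIV"
  shows "norm (abs_l2 f) = sqrt (LINT x|lebesgue. (cmod (f x))\<^sup>2)"
proof -
  have "l2_rel f f" using assms by (simp add: l2_rel_def)
  then show ?thesis
    by (simp add: norm_l2_def inner_l2.abs_eq power2_norm_eq_inner)
qed


section \<open>Weak derivatives and Sobolev spaces on open subsets of the line\<close>

definition test_function_on :: "real set \<Rightarrow> (real \<Rightarrow> real) \<Rightarrow> bool" where
  "test_function_on \<Omega> \<phi> \<longleftrightarrow>
     (\<forall>n. (deriv ^^ n) \<phi> differentiable_on UNIV) \<and>
     compact (closure {x. \<phi> x \<noteq> 0}) \<and> closure {x. \<phi> x \<noteq> 0} \<subseteq> \<Omega>"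

definition locally_integrable_on :: "(real \<Rightarrow> complex) \<Rightarrow> real set \<Rightarrow> bool" where
  "locally_integrable_on f \<Omega> \<longleftrightarrow> (\<forall>K. compact K \<and> K \<subseteq> \<Omega> \<longrightarrow> f absolutely_integrable_on K)"

definition weak_deriv_on :: "real set \<Rightarrow> (real \<Rightarrow> complex) \<Rightarrow> (real \<Rightarrow> complex) \<Rightarrow> bool" where
  "weak_deriv_on \<Omega> f f' \<longleftrightarrow>
     locally_integrable_on f \<Omega> \<and> locally_integrable_on f' \<Omega> \<and>
     (\<forall>\<phi>. test_function_on \<Omega> \<phi> \<longrightarrow>
        (LINT x:\<Omega>|lebesgue. deriv \<phi> x *\<^sub>R f x) = - (LINT x:\<Omega>|lebesgue. \<phi> x *\<^sub>R f' x))"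

text \<open>\<open>sobolev_W22 \<Omega> y y' y''\<close>: \<open>y\<close> belongs to \<open>W\<^sub>2\<^sup>2(\<Omega>)\<close> and \<open>y'\<close>, \<open>y''\<close> are its derivatives.\<close>

definition sobolev_W22 ::
  "real set \<Rightarrow> (real \<Rightarrow> complex) \<Rightarrow> (real \<Rightarrow> complex) \<Rightarrow> (real \<Rightarrow> complex) \<Rightarrow> bool" where
  "sobolev_W22 \<Omega> y y' y'' \<longleftrightarrow>
     weak_deriv_on \<Omega> y y' \<and> weak_deriv_on \<Omega> y' y'' \<and>
     sq_integrable_on y \<Omega> \<and> sq_integrable_on y' \<Omega> \<and> sq_integrable_on y'' \<Omega>"


section \<open>The operators\<close>

text \<open>
  Unbounded operators in \<open>L\<^sub>2(\<real>)\<close> are represented by their graphs.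

  The operator \<open>-d\<^sup>2/dx\<^sup>2 + q\<close> with \<open>q\<close> merely integrable: the product \<open>q y\<close> need not be square
  integrable for \<open>y\<close> in \<open>W\<^sub>2\<^sup>2(\<real>)\<close>, so it is the combination \<open>-y'' + q y\<close>, and not \<open>y''\<close> alone,
  that has to belong to \<open>L\<^sub>2(\<real>)\<close>. If, for instance, \<open>q\<close> is bounded, then the domain
  is \<open>W\<^sub>2\<^sup>2(\<real>)\<close>; see \<open>Domain_schroedinger_op_bounded\<close> below.
\<close>

definition schroedinger_op :: "(real \<Rightarrow> real) \<Rightarrow> (l2 \<times> l2) set" where
  "schroedinger_op q =
     {(abs_l2 y, abs_l2 (\<lambda>x. - y'' x + complex_of_real (q x) * y x)) | y y' y''.
        weak_deriv_on UNIV y y' \<and> weak_deriv_on UNIV y' y'' \<and>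
        sq_integrable_on y UNIV \<and> sq_integrable_on y' UNIV \<and>
        sq_integrable_on (\<lambda>x. - y'' x + complex_of_real (q x) * y x) UNIV}"

lemma Domain_schroedinger_op_bounded:
  assumes q: "q \<in> borel_measurable lebesgue" and bound: "\<And>x. \<bar>q x\<bar> \<le> C"
  shows "Domain (schroedinger_op q) = {abs_l2 y | y y' y''. sobolev_W22 UNIV y y' y''}"
proof -
  have *: "sq_integrable_on (\<lambda>x. complex_of_real (q x) * y x) UNIV"
    if y: "sq_integrable_on y UNIV" for y
    unfolding sq_integrable_on_UNIV
  proof
    show meas: "(\<lambda>x. complex_of_real (q x) * y x) \<in> borel_measurable lebesgue"
      using q y by (auto simp: sq_integrable_on_UNIV)
    show "integrable lebesgue (\<lambda>x. (cmod (complex_of_real (q x) * y x))\<^sup>2)"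
    proof (rule Bochner_Integration.integrable_bound)
      show "integrable lebesgue (\<lambda>x. C\<^sup>2 * (cmod (y x))\<^sup>2)"
        using y by (simp add: sq_integrable_on_UNIV)
      show "(\<lambda>x. (cmod (complex_of_real (q x) * y x))\<^sup>2) \<in> borel_measurable lebesgue"
        using meas by auto
      have "(cmod (complex_of_real (q x) * y x))\<^sup>2 \<le> C\<^sup>2 * (cmod (y x))\<^sup>2" for x
        using power_mono[OF bound[of x], of 2]
        by (simp add: norm_mult power_mult_distrib mult_right_mono)
      then show "AE x in lebesgue. norm ((cmod (complex_of_real (q x) * y x))\<^sup>2)
                   \<le> norm (C\<^sup>2 * (cmod (y x))\<^sup>2)"
        by (simp add: abs_mult)
    qed
  qed
  have "sq_integrable_on (\<lambda>x. - y'' x + complex_of_real (q x) * y x) UNIV \<longleftrightarrow>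
        sq_integrable_on y'' UNIV" if y: "sq_integrable_on y UNIV" for y y''
  proof
    assume "sq_integrable_on y'' UNIV"
    then show "sq_integrable_on (\<lambda>x. - y'' x + complex_of_real (q x) * y x) UNIV"
      by (intro sq_integrable_add sq_integrable_uminus * y)
  next
    assume "sq_integrable_on (\<lambda>x. - y'' x + complex_of_real (q x) * y x) UNIV"
    from sq_integrable_uminus[OF sq_integrable_add[OF this sq_integrable_uminus[OF *[OF y]]]]
    show "sq_integrable_on y'' UNIV" by simp
  qed
  then show ?thesis
    unfolding schroedinger_op_def sobolev_W22_def Domain_unfold by blast
qed

definition S_eps :: "(real \<Rightarrow> real) \<Rightarrow> real \<Rightarrow> (l2 \<times> l2) set" where
  "S_eps V \<epsilon> = schroedinger_op (\<lambda>x. (1 / \<epsilon>\<^sup>2) * V (x / \<epsilon>))"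

text \<open>
  One-sided values at \<open>0\<close> are those of the continuous representatives of \<open>y\<close> and \<open>y'\<close>
  on \<open>\<real> \<setminus> {0}\<close>. Below, \<open>a = y(0-)\<close> and \<open>b = y'(0+)\<close>.
\<close>

definition S_theta :: "complex \<Rightarrow> (l2 \<times> l2) set" where
  "S_theta \<theta> =
     {(abs_l2 y, abs_l2 (\<lambda>x. - y'' x)) | y y' y''.
        sobolev_W22 (- {0}) y y' y'' \<and>
        continuous_on (- {0}) y \<and> continuous_on (- {0}) y' \<and>
        (\<exists>a b. (y \<longlongrightarrow> a) (at_left 0) \<and> (y \<longlongrightarrow> \<theta> * a) (at_right 0) \<and>
               (y' \<longlongrightarrow> b) (at_right 0) \<and> (y' \<longlongrightarrow> \<theta> * b) (at_left 0))}"

text \<open>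
  The graph of the Neumann operator consists of pairs of functions rather than of classes, since
  the values of \<open>y\<close> at the end points \<open>\<plusminus>1\<close> are needed; \<open>y\<close> and \<open>y'\<close> are continuous on \<open>[-1,1]\<close>,
  and values outside of this interval play no role.
\<close>

definition neumann_op :: "(real \<Rightarrow> real) \<Rightarrow> ((real \<Rightarrow> complex) \<times> (real \<Rightarrow> complex)) set" where
  "neumann_op V =
     {(y, g). \<exists>y' y''.
        continuous_on {-1..1} y \<and> continuous_on {-1..1} y' \<and>
        weak_deriv_on {-1<..<1} y y' \<and> weak_deriv_on {-1<..<1} y' y'' \<and>
        y' (-1) = 0 \<and> y' 1 = 0 \<and>
        sq_integrable_on g {-1<..<1} \<and>
        (AE x\<in>{-1<..<1} in lebesgue. g x = - y'' x + complex_of_real (V x) * y x)}"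

definition neumann_eigenfunction :: "(real \<Rightarrow> real) \<Rightarrow> complex \<Rightarrow> (real \<Rightarrow> complex) \<Rightarrow> bool" where
  "neumann_eigenfunction V lam u \<longleftrightarrow>
     (u, \<lambda>x. lam * u x) \<in> neumann_op V \<and> (\<exists>x\<in>{-1..1}. u x \<noteq> 0)"


section \<open>Resolvents and norm resolvent convergence\<close>

text \<open>
  \<open>has_resolvent A z R\<close>: the operator \<open>A - z\<close> is a bijection of the domain of \<open>A\<close> onto \<open>L\<^sub>2(\<real>)\<close> and
  its inverse is the bounded operator \<open>R\<close>.
\<close>

definition has_resolvent :: "(l2 \<times> l2) set \<Rightarrow> complex \<Rightarrow> (l2 \<Rightarrow>\<^sub>L l2) \<Rightarrow> bool" where
  "has_resolvent A z R \<longleftrightarrow>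
     (\<forall>f y. blinfun_apply R f = y \<longleftrightarrow> (\<exists>g. (y, g) \<in> A \<and> g - scaleC_l2 z y = f))"

definition resolvent_set :: "(l2 \<times> l2) set \<Rightarrow> complex set" where
  "resolvent_set A = {z. \<exists>R. has_resolvent A z R}"

definition resolvent :: "(l2 \<times> l2) set \<Rightarrow> complex \<Rightarrow> (l2 \<Rightarrow>\<^sub>L l2)" where
  "resolvent A z = (THE R. has_resolvent A z R)"

lemma resolvent_eqI: "has_resolvent A z R \<Longrightarrow> resolvent A z = R"
  unfolding resolvent_def has_resolvent_def
  by (rule the_equality) (blast, metis blinfun_eqI)

definition norm_resolvent_convergent ::
  "(real \<Rightarrow> (l2 \<times> l2) set) \<Rightarrow> (l2 \<times> l2) set \<Rightarrow> bool" where
  "norm_resolvent_convergent S S0 \<longleftrightarrow>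
     (\<forall>z. z \<notin> \<real> \<longrightarrow>
        z \<in> resolvent_set S0 \<and> (\<forall>\<epsilon>>0. z \<in> resolvent_set (S \<epsilon>)) \<and>
        ((\<lambda>\<epsilon>. norm (resolvent (S \<epsilon>) z - resolvent S0 z)) \<longlongrightarrow> 0) (at_right 0))"

end

theory Submission
  imports Defs
begin

text \<open>
  The eigenfunction \<open>u\<close> forces the interface conditions. Let \<open>y\<close> solve
  \<open>-y'' + \<epsilon>\<^sup>-\<^sup>2 V(x/\<epsilon>) y - z y = f\<close> and put \<open>U(x) = u(x/\<epsilon>)\<close>, so that \<open>U\<close> solves the homogeneous
  equation for \<open>z = 0\<close> and \<open>U'(\<plusminus>\<epsilon>) = 0\<close>. Lagrange's identity for \<open>U\<close> and \<open>y\<close> on \<open>[-\<epsilon>,\<epsilon>]\<close> has the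
  right-hand side \<open>\<integral> U (z y + f)\<close>, which is \<open>O(\<surd>\<epsilon>)\<close> by the Cauchy-Schwarz inequality, and its boundary
  terms give \<open>\<theta> y'(\<epsilon>) - y'(-\<epsilon>) = O(\<surd>\<epsilon>)\<close>. The same identity for a second solution \<open>u2\<close>, with
  \<open>u2(-1) = 0\<close> and \<open>u2'(-1) = 1\<close>, gives \<open>y(\<epsilon>) - \<theta> y(-\<epsilon>) = O(\<surd>\<epsilon>)\<close>, because the constancy of the
  Wronskian means \<open>\<theta> u2'(1) = 1\<close>; both identities together bound \<open>y\<close> on \<open>[-\<epsilon>,\<epsilon>]\<close>
  (\<open>transfer_estimates\<close>).

  The solution \<open>y0\<close> of the limit problem satisfies the same two conditions up to \<open>O(\<surd>\<epsilon>)\<close>. Hence so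
  does \<open>d = y - y0\<close>. Outside of \<open>[-\<epsilon>,\<epsilon>]\<close> it solves \<open>d'' = - z d\<close> and is square integrable, so it is
  a decaying exponential there and \<open>d'(\<plusminus>\<epsilon>) = \<plusminus>\<i> k d(\<plusminus>\<epsilon>)\<close> with \<open>k\<^sup>2 = z\<close>, \<open>Im k > 0\<close>. The conditions turn into
  a linear system for \<open>d(\<plusminus>\<epsilon>)\<close> with determinant \<open>1 + \<theta>\<^sup>2 \<ge> 1\<close>, as \<open>\<theta>\<close> is real. Therefore
  \<open>d(\<plusminus>\<epsilon>) = O(\<surd>\<epsilon>)\<close>, and the resolvents differ by \<open>O(\<surd>\<epsilon>)\<close> in norm (\<open>resolvent_difference_estimate\<close>).

  All estimates start from an a priori bound, \<open>|Im z| \<parallel>y\<parallel> \<le> \<parallel>f\<parallel>\<close>, valid for both problems: the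
  derivative of the flux \<open>Im (y' cnj y)\<close> does not involve the potential (\<open>flux_bound\<close>). The bound also
  yields uniqueness. Solvability is obtained by adding to the solution of the free equation a correction
  that is exponential off the support of the potential.

  The operators are defined by weak derivatives, whereas the argument integrates by parts with
  functions whose second derivatives are merely integrable. The notion \<open>primitive_on\<close> mediates: a
  function has a weak derivative exactly if it agrees almost everywhere with a primitive
  of it. The lemma of du Bois-Reymond behind this needs a smooth step function.
\<close>

section \<open>Absolutely continuous functions\<close>

text \<open>
  Absolute continuity is expressed by integrals over compact subintervals only. On a set with several
  components, such as the punctured line, the values on different components are thus independent.
\<close>

definition primitive_on :: "real set \<Rightarrow> (real \<Rightarrow> 'a::euclidean_space) \<Rightarrow> (real \<Rightarrow> 'a) \<Rightarrow> bool" where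
  "primitive_on I F f \<longleftrightarrow>
     (\<forall>s t. s \<le> t \<longrightarrow> {s..t} \<subseteq> I \<longrightarrow>
        f absolutely_integrable_on {s..t} \<and> (f has_integral (F t - F s)) {s..t})"

lemma primitive_onD:
  assumes "primitive_on I F f" "s \<le> t" "{s..t} \<subseteq> I"
  shows "f absolutely_integrable_on {s..t}" "(f has_integral (F t - F s)) {s..t}"
  using assms unfolding primitive_on_def by blast+

lemma primitive_on_integral:
  assumes "primitive_on I F f" "s \<le> t" "{s..t} \<subseteq> I"
  shows "integral {s..t} f = F t - F s"
  using primitive_onD(2)[OF assms] by (rule integral_unique)

lemma primitive_on_subset: "primitive_on I F f \<Longrightarrow> J \<subseteq> I \<Longrightarrow> primitive_on J F f"
  unfolding primitive_on_def by blast

lemma primitive_on_add: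
  assumes "primitive_on I F f" "primitive_on I G g"
  shows "primitive_on I (\<lambda>x. F x + G x) (\<lambda>x. f x + g x)"
  unfolding primitive_on_def
proof (intro allI impI conjI)
  fix s t :: real assume "s \<le> t" "{s..t} \<subseteq> I"
  note F = primitive_onD[OF assms(1) this] and G = primitive_onD[OF assms(2) this]
  show "(\<lambda>x. f x + g x) absolutely_integrable_on {s..t}" using F G by simp
  show "((\<lambda>x. f x + g x) has_integral (F t + G t - (F s + G s))) {s..t}"
    using has_integral_add[OF F(2) G(2)] by (simp add: algebra_simps)
qed

lemma primitive_on_linear:
  assumes "primitive_on I F f" "bounded_linear L"
  shows "primitive_on I (\<lambda>x. L (F x)) (\<lambda>x. L (f x))"
  unfolding primitive_on_def
proof (intro allI impI conjI)
  fix s t :: real assume "s \<le> t" "{s..t} \<subseteq> I"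
  note F = primitive_onD[OF assms(1) this]
  show "(\<lambda>x. L (f x)) absolutely_integrable_on {s..t}"
    using absolutely_integrable_linear[OF F(1) assms(2)] by (simp add: o_def)
  show "((\<lambda>x. L (f x)) has_integral (L (F t) - L (F s))) {s..t}"
    using has_integral_linear[OF F(2) assms(2)]
    by (simp add: o_def linear_diff[OF bounded_linear.linear[OF assms(2)]])
qed

lemma primitive_on_cmult:
  fixes f :: "real \<Rightarrow> complex"
  shows "primitive_on I F f \<Longrightarrow> primitive_on I (\<lambda>x. c * F x) (\<lambda>x. c * f x)"
  using primitive_on_linear[OF _ bounded_linear_mult_right] .

lemma primitive_on_diff:
  assumes "primitive_on I F f" "primitive_on I G g"
  shows "primitive_on I (\<lambda>x. F x - G x) (\<lambda>x. f x - g x)"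
  using primitive_on_add[OF assms(1) primitive_on_linear[OF assms(2) bounded_linear_minus[OF bounded_linear_ident]]]
  by simp

lemma primitive_on_continuous_Icc:
  assumes "primitive_on I F f" "{a..b} \<subseteq> I"
  shows "continuous_on {a..b} F"
proof -
  have "continuous_on {a..b} (\<lambda>x. F a + integral {a..x} f)" if "a \<le> b"
    using primitive_onD(1)[OF assms(1) that assms(2)]
    by (intro continuous_intros indefinite_integral_continuous_1)
       (simp add: absolutely_integrable_on_def)
  moreover have "F a + integral {a..x} f = F x" if "x \<in> {a..b}" for x
    using primitive_on_integral[OF assms(1), of a x] that assms(2) by fastforce
  ultimately show ?thesis
    by (cases "a \<le> b") (simp_all cong: continuous_on_cong_simp)
qed

lemma primitive_on_continuous_open:
  assumes "primitive_on I F f" "open I"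
  shows "continuous_on I F"
proof (rule continuous_at_imp_continuous_on, rule ballI)
  fix x assume "x \<in> I"
  then obtain e where "e > 0" "cball x e \<subseteq> I"
    using assms(2) open_contains_cball by blast
  moreover have "cball x e = {x-e..x+e}" by (auto simp: dist_real_def)
  ultimately have "continuous_on {x-e..x+e} F"
    using primitive_on_continuous_Icc[OF assms(1)] by simp
  then show "isCont F x"
    using \<open>e > 0\<close> by (intro continuous_on_interior[of "{x-e..x+e}"]) auto
qed

lemma primitive_on_combine:
  assumes "primitive_on (I \<inter> {..c}) F f" "primitive_on (I \<inter> {c..}) F f"
  shows "primitive_on I F f"
  unfolding primitive_on_def
proof (intro allI impI)
  fix s t :: real assume st: "s \<le> t" "{s..t} \<subseteq> I"
  consider "t \<le> c" | "c \<le> s" | "s \<le> c" "c \<le> t" by linarith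
  then show "f absolutely_integrable_on {s..t} \<and> (f has_integral F t - F s) {s..t}"
  proof cases
    case 1
    then have "{s..t} \<subseteq> I \<inter> {..c}" using st by auto
    then show ?thesis using primitive_onD[OF assms(1) st(1)] by blast
  next
    case 2
    then have "{s..t} \<subseteq> I \<inter> {c..}" using st by auto
    then show ?thesis using primitive_onD[OF assms(2) st(1)] by blast
  next
    case 3
    then have "{s..c} \<subseteq> I \<inter> {..c}" "{c..t} \<subseteq> I \<inter> {c..}" using st by auto
    note A = primitive_onD[OF assms(1) 3(1) this(1)] and B = primitive_onD[OF assms(2) 3(2) this(2)]
    show ?thesis
      using absolutely_integrable_on_combine[OF A(1) B(1) 3]
        has_integral_combine[OF 3 A(2) B(2)] by simp
  qed
qed

text \<open>
  One value fixes the constant of integration, which is possible on an interval only: in general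
  every component has a constant of its own.
\<close>

lemma primitive_on_exists:
  fixes f :: "real \<Rightarrow> 'a::euclidean_space"
  assumes I: "is_interval I" "c \<in> I"
    and f: "\<And>s t. s \<le> t \<Longrightarrow> {s..t} \<subseteq> I \<Longrightarrow> f absolutely_integrable_on {s..t}"
  obtains F where "primitive_on I F f" "F c = \<alpha>"
proof -
  define F where "F x = \<alpha> + (if c \<le> x then integral {c..x} f else - integral {x..c} f)" for x
  have Fc: "F c = \<alpha>" by (simp add: F_def)
  have ivl: "{s..t} \<subseteq> I" if "s \<in> I" "t \<in> I" for s t
    using mem_is_interval_1_I[OF I(1) that] by auto
  have R: "primitive_on (I \<inter> {c..}) F f"
    unfolding primitive_on_def
  proof (intro allI impI conjI)
    fix s t assume st: "s \<le> t" "{s..t} \<subseteq> I \<inter> {c..}"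
    then have m: "s \<in> I" "t \<in> I" "c \<le> s" by auto
    show ai: "f absolutely_integrable_on {s..t}" using f st by auto
    have "f integrable_on {c..t}"
      using f[of c t] ivl I(2) m st by (auto simp: absolutely_integrable_on_def)
    then have "integral {c..s} f + integral {s..t} f = integral {c..t} f"
      using Henstock_Kurzweil_Integration.integral_combine m st by blast
    then have "F t - F s = integral {s..t} f"
      using m st by (simp add: F_def algebra_simps)
    then show "(f has_integral F t - F s) {s..t}"
      using ai by (simp add: absolutely_integrable_on_def integrable_integral)
  qed
  have L: "primitive_on (I \<inter> {..c}) F f"
    unfolding primitive_on_def
  proof (intro allI impI conjI)
    fix s t assume st: "s \<le> t" "{s..t} \<subseteq> I \<inter> {..c}"
    then have m: "s \<in> I" "t \<in> I" "t \<le> c" by auto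
    show ai: "f absolutely_integrable_on {s..t}" using f st by auto
    have "f integrable_on {s..c}"
      using f[of s c] ivl I(2) m st by (auto simp: absolutely_integrable_on_def)
    then have "integral {s..t} f + integral {t..c} f = integral {s..c} f"
      using Henstock_Kurzweil_Integration.integral_combine m st by blast
    then have "F t - F s = integral {s..t} f"
      using m st by (cases "t = c"; cases "s = c") (simp_all add: F_def algebra_simps)
    then show "(f has_integral F t - F s) {s..t}"
      using ai by (simp add: absolutely_integrable_on_def integrable_integral)
  qed
  show ?thesis using that primitive_on_combine[OF L R] Fc by blast
qed

lemma primitive_on_C1:
  assumes "\<And>x. x \<in> I \<Longrightarrow> (F has_vector_derivative f x) (at x)" "continuous_on I f"
  shows "primitive_on I F f"
  unfolding primitive_on_def
proof (intro allI impI conjI)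
  fix s t :: real assume st: "s \<le> t" "{s..t} \<subseteq> I"
  show "f absolutely_integrable_on {s..t}"
    using assms(2) st by (intro absolutely_integrable_continuous_real) (rule continuous_on_subset)
  show "(f has_integral F t - F s) {s..t}"
    using st by (intro fundamental_theorem_of_calculus has_vector_derivative_at_within[OF assms(1)]) auto
qed

lemma primitive_on_cong:
  assumes "primitive_on I F f" "\<And>x. x \<in> I \<Longrightarrow> G x = F x"
    and ae: "AE x in lebesgue. x \<in> I \<longrightarrow> g x = f x"
  shows "primitive_on I G g"
proof -
  obtain N where N: "negligible N" "\<And>x. x \<in> I \<Longrightarrow> x \<notin> N \<Longrightarrow> g x = f x"
    using ae unfolding eventually_ae_filter negligible_iff_null_sets by auto
  show ?thesis
    unfolding primitive_on_def
  proof (intro allI impI conjI)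
    fix s t :: real assume st: "s \<le> t" "{s..t} \<subseteq> I"
    note F = primitive_onD[OF assms(1) st]
    show "g absolutely_integrable_on {s..t}"
      using absolutely_integrable_spike[OF F(1) N(1)] N(2) st(2) by blast
    have "(g has_integral F t - F s) {s..t}"
      using has_integral_spike[OF N(1) _ F(2)] N(2) st(2) by blast
    moreover have "G t = F t" "G s = F s" using assms(2) st by auto
    ultimately show "(g has_integral G t - G s) {s..t}" by simp
  qed
qed

lemma absolutely_integrable_mult_continuous:
  fixes f G :: "real \<Rightarrow> complex"
  assumes "f absolutely_integrable_on {a..b}" "continuous_on {a..b} G"
  shows "(\<lambda>x. f x * G x) absolutely_integrable_on {a..b}"
    and "(\<lambda>x. G x * f x) absolutely_integrable_on {a..b}"
proof -
  have b: "bounded (G ` {a..b})"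
    by (rule compact_imp_bounded[OF compact_continuous_image[OF assms(2) compact_Icc]])
  have m: "G \<in> borel_measurable (lebesgue_on {a..b})"
    by (rule continuous_imp_measurable_on_sets_lebesgue[OF assms(2)]) simp
  show "(\<lambda>x. G x * f x) absolutely_integrable_on {a..b}"
    by (rule absolutely_integrable_bounded_measurable_product[OF bilinear_times m _ b assms(1)]) simp
  then show "(\<lambda>x. f x * G x) absolutely_integrable_on {a..b}" by (simp add: mult.commute)
qed

text \<open>
  The product rule, without pointwise derivatives. The defect of the formula on \<open>[s,t]\<close> is
  \<open>\<integral> f (G t - G) + \<integral> g (F s - F)\<close>, hence it is small compared with \<open>\<integral> |f| + |g|\<close> on
  intervals on which \<open>F\<close> and \<open>G\<close> oscillate little. This estimate is additive, so bisection
  carries it to every interval.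
\<close>

lemma primitive_on_mult:
  fixes F G :: "real \<Rightarrow> complex"
  assumes F: "primitive_on I F f" and G: "primitive_on I G g"
  shows "primitive_on I (\<lambda>x. F x * G x) (\<lambda>x. f x * G x + F x * g x)"
  unfolding primitive_on_def
proof (intro allI impI)
  fix a b :: real assume ab: "a \<le> b" "{a..b} \<subseteq> I"
  let ?h = "\<lambda>x. f x * G x + F x * g x" and ?n = "\<lambda>x. norm (f x) + norm (g x)"
  have F': "primitive_on {a..b} F f" and G': "primitive_on {a..b} G g"
    using primitive_on_subset[OF F ab(2)] primitive_on_subset[OF G ab(2)] .
  note f = primitive_onD(1)[OF F' ab(1) order_refl] and g = primitive_onD(1)[OF G' ab(1) order_refl]
  note cF = primitive_on_continuous_Icc[OF F' order_refl] and cG = primitive_on_continuous_Icc[OF G' order_refl]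
  have h: "?h absolutely_integrable_on {a..b}"
    using absolutely_integrable_mult_continuous(1)[OF f cG] absolutely_integrable_mult_continuous(2)[OF g cF]
    by simp
  have n: "?n integrable_on {a..b}"
    using f g by (intro integrable_add) (auto simp: absolutely_integrable_on_def)
  have hI: "?h integrable_on {a..b}"
    using h by (simp add: absolutely_integrable_on_def)
  have small: "norm (F b * G b - F a * G a - integral {a..b} ?h) \<le> \<eta> * integral {a..b} ?n" if "\<eta> > 0" for \<eta>
  proof -
    define P where "P s t \<longleftrightarrow> (a \<le> s \<longrightarrow> s \<le> t \<longrightarrow> t \<le> b \<longrightarrow>
      norm (F t * G t - F s * G s - integral {s..t} ?h) \<le> \<eta> * integral {s..t} ?n)" for s t
    have "P a b" using ab(1)
    proof (induction rule: Bolzano)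
      case (trans s t u)
      show ?case unfolding P_def
      proof (intro impI)
        assume *: "a \<le> s" "s \<le> u" "u \<le> b"
        have i: "?h integrable_on {s..u}" "?n integrable_on {s..u}"
          using * by (auto intro: integrable_on_subinterval[OF hI] integrable_on_subinterval[OF n])
        have "integral {s..u} ?h = integral {s..t} ?h + integral {t..u} ?h"
             "integral {s..u} ?n = integral {s..t} ?n + integral {t..u} ?n"
          using trans(3,4) i by (simp_all add: Henstock_Kurzweil_Integration.integral_combine)
        moreover have "norm (F t * G t - F s * G s - integral {s..t} ?h) \<le> \<eta> * integral {s..t} ?n"
            "norm (F u * G u - F t * G t - integral {t..u} ?h) \<le> \<eta> * integral {t..u} ?n"
          using trans * unfolding P_def by auto
        ultimately show "norm (F u * G u - F s * G s - integral {s..u} ?h) \<le> \<eta> * integral {s..u} ?n"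
          using norm_triangle_ineq[of "F t * G t - F s * G s - integral {s..t} ?h" "F u * G u - F t * G t - integral {t..u} ?h"]
          by (simp add: algebra_simps)
      qed
    next
      case (local x)
      have "uniformly_continuous_on {a..b} F" "uniformly_continuous_on {a..b} G"
        using cF cG by (auto intro: compact_uniformly_continuous)
      then obtain d1 d2 where d: "d1 > 0" "d2 > 0"
        "\<And>x y. x \<in> {a..b} \<Longrightarrow> y \<in> {a..b} \<Longrightarrow> dist y x < d1 \<Longrightarrow> dist (F y) (F x) < \<eta>"
        "\<And>x y. x \<in> {a..b} \<Longrightarrow> y \<in> {a..b} \<Longrightarrow> dist y x < d2 \<Longrightarrow> dist (G y) (G x) < \<eta>"
        unfolding uniformly_continuous_on_def using \<open>\<eta> > 0\<close> by metis
      have "P s t" if st: "s \<le> x" "x \<le> t" "t - s < min d1 d2" for s t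
        unfolding P_def
      proof (intro impI)
        assume *: "a \<le> s" "s \<le> t" "t \<le> b"
        then have sub: "{s..t} \<subseteq> {a..b}" by auto
        note fs = primitive_onD[OF F' *(2) sub] and gs = primitive_onD[OF G' *(2) sub]
        have hs: "?h integrable_on {s..t}" and ns: "?n integrable_on {s..t}"
          by (rule integrable_on_subinterval[OF hI sub], rule integrable_on_subinterval[OF n sub])
        have k: "((\<lambda>x. f x * G t + F s * g x) has_integral (F t - F s) * G t + F s * (G t - G s)) {s..t}"
          by (intro has_integral_add has_integral_mult_left has_integral_mult_right fs gs)
        have "((\<lambda>x. (f x * G t + F s * g x) - ?h x) has_integral
            ((F t - F s) * G t + F s * (G t - G s)) - integral {s..t} ?h) {s..t}"
          by (intro has_integral_diff k integrable_integral hs)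
        then have eq: "integral {s..t} (\<lambda>x. (f x * G t + F s * g x) - ?h x) = F t * G t - F s * G s - integral {s..t} ?h"
          and int: "(\<lambda>x. (f x * G t + F s * g x) - ?h x) integrable_on {s..t}"
          by (auto simp: algebra_simps dest: integral_unique)
        have "norm (integral {s..t} (\<lambda>x. (f x * G t + F s * g x) - ?h x)) \<le> integral {s..t} (\<lambda>x. \<eta> * ?n x)"
        proof (rule integral_norm_bound_integral[OF int])
          show "(\<lambda>x. \<eta> * ?n x) integrable_on {s..t}"
            using ns integrable_on_cmult_left[of ?n "{s..t}" \<eta>] by simp
          fix y assume y: "y \<in> {s..t}"
          then have "dist (G t) (G y) < \<eta>" "dist (F s) (F y) < \<eta>"
            using d * st by (auto intro!: d simp: dist_real_def)
          then have "norm (f y) * norm (G t - G y) \<le> norm (f y) * \<eta>" "norm (F s - F y) * norm (g y) \<le> \<eta> * norm (g y)"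
            by (auto intro!: mult_left_mono mult_right_mono simp: dist_norm)
          moreover have "(f y * G t + F s * g y) - ?h y = f y * (G t - G y) + (F s - F y) * g y"
            by (simp add: algebra_simps)
          then have "norm ((f y * G t + F s * g y) - ?h y) \<le> norm (f y) * norm (G t - G y) + norm (F s - F y) * norm (g y)"
            by (metis norm_mult norm_triangle_ineq)
          moreover have "\<eta> * ?n y = norm (f y) * \<eta> + \<eta> * norm (g y)"
            by (simp add: algebra_simps)
          ultimately show "norm ((f y * G t + F s * g y) - ?h y) \<le> \<eta> * ?n y"
            by linarith
        qed
        then show "norm (F t * G t - F s * G s - integral {s..t} ?h) \<le> \<eta> * integral {s..t} ?n"
          by (simp only: eq integral_mult_right)
      qed
      then show ?case using d(1,2) by (intro exI[of _ "min d1 d2"]) auto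
    qed
    then show ?thesis using ab(1) by (simp add: P_def)
  qed
  have "norm (F b * G b - F a * G a - integral {a..b} ?h) \<le> 0 * (integral {a..b} ?n)"
  proof (rule tendsto_lowerbound)
    show "((\<lambda>\<eta>. \<eta> * integral {a..b} ?n) \<longlongrightarrow> 0 * integral {a..b} ?n) (at_right 0)"
      by (intro tendsto_intros)
    show "\<forall>\<^sub>F \<eta> in at_right 0. norm (F b * G b - F a * G a - integral {a..b} ?h) \<le> \<eta> * integral {a..b} ?n"
      by (rule eventually_mono[OF eventually_at_right_less small])
  qed auto
  then have "integral {a..b} ?h = F b * G b - F a * G a" by simp
  then have "(?h has_integral F b * G b - F a * G a) {a..b}"
    using integrable_integral[OF hI] by metis
  then show "?h absolutely_integrable_on {a..b} \<and> (?h has_integral F b * G b - F a * G a) {a..b}"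
    using h by blast
qed

lemma primitive_on_scale:
  fixes F :: "real \<Rightarrow> complex"
  assumes F: "primitive_on {a..b} F f" and "\<epsilon> > 0"
  shows "primitive_on {\<epsilon>*a..\<epsilon>*b} (\<lambda>x. F (x / \<epsilon>)) (\<lambda>x. f (x / \<epsilon>) / complex_of_real \<epsilon>)"
  unfolding primitive_on_def
proof (intro allI impI)
  fix s t :: real assume st: "s \<le> t" "{s..t} \<subseteq> {\<epsilon>*a..\<epsilon>*b}"
  have "s \<in> {s..t}" "t \<in> {s..t}" using st(1) by simp_all
  then have "s \<in> {\<epsilon>*a..\<epsilon>*b}" "t \<in> {\<epsilon>*a..\<epsilon>*b}" using st(2) by blast+
  then have "a \<le> s / \<epsilon>" "t / \<epsilon> \<le> b"
    using \<open>\<epsilon> > 0\<close> by (simp_all add: pos_le_divide_eq pos_divide_le_eq mult.commute)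
  then have "s / \<epsilon> \<le> t / \<epsilon>" "{s/\<epsilon>..t/\<epsilon>} \<subseteq> {a..b}"
    using \<open>\<epsilon> > 0\<close> st(1) by (simp_all add: divide_right_mono)
  note f = primitive_onD[OF F this]
  have "(\<lambda>x. x / (1/\<epsilon>)) = (*) \<epsilon>" by (simp add: fun_eq_iff)
  moreover have "(*) \<epsilon> ` {s/\<epsilon>..t/\<epsilon>} = {s..t}"
    using \<open>\<epsilon> > 0\<close> image_mult_atLeastAtMost[of \<epsilon> "s/\<epsilon>" "t/\<epsilon>"] by simp
  ultimately have im: "(\<lambda>x. x / (1/\<epsilon>)) ` {s/\<epsilon>..t/\<epsilon>} = {s..t}"
    by metis
  have m: "1/\<epsilon> \<noteq> 0" using \<open>\<epsilon> > 0\<close> by simp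
  have 1: "((\<lambda>x. f ((1/\<epsilon>) * x)) has_integral (1 / \<bar>1/\<epsilon>\<bar>) *\<^sub>R (F (t/\<epsilon>) - F (s/\<epsilon>))) {s..t}"
    using has_integral_stretch_real[OF f(2) m] unfolding im .
  have "((\<lambda>x. norm (f x)) has_integral (integral {s/\<epsilon>..t/\<epsilon>} (\<lambda>x. norm (f x)))) {s/\<epsilon>..t/\<epsilon>}"
    using f(1) by (auto simp: absolutely_integrable_on_def)
  then have 2: "(\<lambda>x. norm (f ((1/\<epsilon>) * x))) integrable_on {s..t}"
    using has_integral_stretch_real[OF _ m, of "\<lambda>x. norm (f x)" _ "s/\<epsilon>" "t/\<epsilon>"] unfolding im integrable_on_def by blast
  have 3: "(\<lambda>x. f (x/\<epsilon>)) absolutely_integrable_on {s..t}"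
    using 1 2 by (auto simp: absolutely_integrable_on_def)
  have "((\<lambda>x. complex_of_real (1/\<epsilon>) * f (x/\<epsilon>)) has_integral complex_of_real (1/\<epsilon>) * ((1 / \<bar>1/\<epsilon>\<bar>) *\<^sub>R (F (t/\<epsilon>) - F (s/\<epsilon>)))) {s..t}"
    using 1 by (intro has_integral_mult_right) simp
  moreover have "complex_of_real (1/\<epsilon>) * ((1 / \<bar>1/\<epsilon>\<bar>) *\<^sub>R (F (t/\<epsilon>) - F (s/\<epsilon>))) = F (t/\<epsilon>) - F (s/\<epsilon>)"
    using \<open>\<epsilon> > 0\<close> by (simp add: scaleR_conv_of_real)
  moreover have "(\<lambda>x. complex_of_real (1/\<epsilon>) * f (x/\<epsilon>)) absolutely_integrable_on {s..t}"
    using absolutely_integrable_linear[OF 3 bounded_linear_mult_right[of "complex_of_real (1/\<epsilon>)"]]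
    unfolding o_def .
  moreover have "(\<lambda>x. f (x / \<epsilon>) / complex_of_real \<epsilon>) = (\<lambda>x. complex_of_real (1/\<epsilon>) * f (x/\<epsilon>))"
    by (simp add: fun_eq_iff)
  ultimately show "(\<lambda>x. f (x / \<epsilon>) / complex_of_real \<epsilon>) absolutely_integrable_on {s..t} \<and>
     ((\<lambda>x. f (x / \<epsilon>) / complex_of_real \<epsilon>) has_integral F (t / \<epsilon>) - F (s / \<epsilon>)) {s..t}"
    by metis
qed

lemma primitive_on_reflect:
  fixes F :: "real \<Rightarrow> 'a::euclidean_space"
  assumes F: "primitive_on I F f"
  shows "primitive_on (uminus ` I) (\<lambda>x. F (- x)) (\<lambda>x. - f (- x))"
  unfolding primitive_on_def
proof (intro allI impI)
  fix s t :: real assume st: "s \<le> t" "{s..t} \<subseteq> uminus ` I"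
  have "-t \<le> -s" using st(1) by simp
  moreover have "{-t..-s} \<subseteq> I"
  proof
    fix x assume "x \<in> {-t..-s}"
    then have "-x \<in> uminus ` I" using st(2) by auto
    then show "x \<in> I" by auto
  qed
  ultimately
  have f: "f absolutely_integrable_on {-t..-s}" "(f has_integral F (-s) - F (-t)) {-t..-s}"
    by (fact primitive_onD[OF F])+
  have "(\<lambda>x. f (-x)) absolutely_integrable_on {s..t}"
    using f(1) absolutely_integrable_reflect_real[where f=f and a="-t" and b="-s"] by simp
  moreover have "((\<lambda>x. f (-x)) has_integral F (-s) - F (-t)) {s..t}"
    using f(2) has_integral_reflect_real[where f=f and a="-t" and b="-s"] st by simp
  then have "((\<lambda>x. - f (-x)) has_integral - (F (-s) - F (-t))) {s..t}" by (rule has_integral_neg)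
  ultimately show "(\<lambda>x. - f (- x)) absolutely_integrable_on {s..t} \<and>
     ((\<lambda>x. - f (- x)) has_integral F (- t) - F (- s)) {s..t}"
    using absolutely_integrable_linear[OF _ bounded_linear_minus[OF bounded_linear_ident], where f="\<lambda>x. f (-x)" and s="{s..t}"]
    by (simp add: o_def)
qed

lemma primitive_on_IccI:
  fixes f :: "real \<Rightarrow> 'a::euclidean_space"
  assumes f: "f absolutely_integrable_on {a..b}" and "a \<le> b"
    and F: "\<And>x. x \<in> {a..b} \<Longrightarrow> F x = c + integral {a..x} f"
  shows "primitive_on {a..b} F f"
proof -
  obtain G where G: "primitive_on {a..b} G f" "G a = c"
  proof (rule primitive_on_exists[where I = "{a..b}" and c = a and f = f and \<alpha> = c])
    show "f absolutely_integrable_on {s..t}" if "{s..t} \<subseteq> {a..b}" for s t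
      by (rule absolutely_integrable_on_subinterval[OF f that])
  qed (use \<open>a \<le> b\<close> in \<open>auto simp: is_interval_cc\<close>)
  have "F x = G x" if "x \<in> {a..b}" for x
  proof -
    have "integral {a..x} f = G x - c"
      using primitive_on_integral[OF G(1), of a x] that G(2) by simp
    then show ?thesis by (simp add: F[OF that])
  qed
  then show ?thesis by (intro primitive_on_cong[OF G(1)]) auto
qed

section \<open>Linear second order equations with integrable coefficients\<close>

text \<open>
  The initial value problem is a fixed point equation for the pair \<open>(w, w')\<close>. The Lipschitz constant
  of the Picard map is at most the length of the interval plus the integral of \<open>|Q|\<close>, hence
  at most \<open>1/2\<close>.
\<close>

lemma ivp_short_interval:
  fixes Q r :: "real \<Rightarrow> complex"
  assumes st: "s \<le> t" and Q: "Q absolutely_integrable_on {s..t}" and r: "r absolutely_integrable_on {s..t}"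
    and short: "t - s \<le> 1/4" "integral {s..t} (\<lambda>x. norm (Q x)) \<le> 1/4"
  shows "\<exists>w p. primitive_on {s..t} w p \<and> primitive_on {s..t} p (\<lambda>x. Q x * w x + r x) \<and> w s = \<alpha> \<and> p s = \<beta>"
proof -
  \<comment> \<open>Clamping the argument extends functions on \<open>[s,t]\<close> to bounded continuous functions on the line.\<close>
  define cl where "cl x = max s (min t x)" for x
  define rhs where "rhs Y x = Q x * fst (apply_bcontfun Y x) + r x" for Y :: "real \<Rightarrow>\<^sub>C (complex \<times> complex)" and x
  define G where "G Y x = (\<alpha> + integral {s..x} (\<lambda>y. snd (apply_bcontfun Y y)), \<beta> + integral {s..x} (rhs Y))"
    for Y :: "real \<Rightarrow>\<^sub>C (complex \<times> complex)" and x
  have cl: "continuous_on UNIV cl" "cl x \<in> {s..t}" "x \<in> {s..t} \<Longrightarrow> cl x = x" for x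
    unfolding cl_def using st by (auto intro!: continuous_intros)
  have cY: "continuous_on A (apply_bcontfun Y)" for A and Y :: "real \<Rightarrow>\<^sub>C (complex \<times> complex)"
    by (rule continuous_on_subset[of UNIV]) (auto intro: continuous_on_apply_bcontfun)
  have snd_int: "(\<lambda>y. snd (apply_bcontfun Y y)) absolutely_integrable_on {s..t}" for Y :: "real \<Rightarrow>\<^sub>C (complex \<times> complex)"
    by (rule absolutely_integrable_continuous_real) (rule continuous_on_snd[OF cY])
  have rhs_int: "rhs Y absolutely_integrable_on {s..t}" for Y
    unfolding rhs_def
    by (rule set_integral_add(1)[OF absolutely_integrable_mult_continuous(1)[OF Q continuous_on_fst[OF cY]] r])
  have G_cont: "continuous_on {s..t} (G Y)" for Y
    unfolding G_def
    by (rule continuous_on_Pair; rule continuous_on_add[OF continuous_on_const];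
        rule indefinite_integral_continuous_1; rule set_lebesgue_integral_eq_integral(1))
       (rule snd_int rhs_int)+
  have Gb: "(\<lambda>x. G Y (cl x)) \<in> bcontfun" for Y
    unfolding bcontfun_def
  proof (intro CollectI conjI)
    show "continuous_on UNIV (\<lambda>x. G Y (cl x))"
      by (rule continuous_on_compose2[OF G_cont cl(1)]) (use cl(2) in auto)
    have "bounded (G Y ` {s..t})"
      by (rule compact_imp_bounded[OF compact_continuous_image[OF G_cont compact_Icc]])
    then show "bounded (range (\<lambda>x. G Y (cl x)))"
      by (rule bounded_subset) (use cl(2) in blast)
  qed
  define T where "T Y = Bcontfun (\<lambda>x. G Y (cl x))" for Y
  have T: "apply_bcontfun (T Y) x = G Y (cl x)" for Y x
    unfolding T_def by (simp add: Bcontfun_inverse[OF Gb])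
  have "\<exists>!Y. T Y = Y"
  proof (rule banach_fix_type[of "1/2"])
    show "\<forall>Y Z. dist (T Y) (T Z) \<le> 1/2 * dist Y Z"
    proof (intro allI dist_bound)
      fix Y Z :: "real \<Rightarrow>\<^sub>C (complex \<times> complex)" and x'
      define x where "x = cl x'"
      have x: "s \<le> x" "x \<le> t" using cl(2)[of x'] by (auto simp: x_def)
      then have sub: "{s..x} \<subseteq> {s..t}" by auto
      let ?D = "dist Y Z"
      have D: "norm (apply_bcontfun Y y - apply_bcontfun Z y) \<le> ?D" for y
        using dist_bounded[of Y y Z] by (simp add: dist_norm)
      have sle: "norm (snd q) \<le> norm q" "norm (fst q) \<le> norm q" for q :: "complex \<times> complex"
        by (metis prod.collapse norm_snd_le norm_fst_le)+
      have nQ: "(\<lambda>x. norm (Q x)) integrable_on {s..t}" using Q by (simp add: absolutely_integrable_on_def)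
      have nQx: "(\<lambda>x. norm (Q x)) integrable_on {s..x}" by (rule integrable_on_subinterval[OF nQ sub])
      have si: "(\<lambda>y. snd (apply_bcontfun Y y)) integrable_on {s..x}" for Y :: "real \<Rightarrow>\<^sub>C (complex \<times> complex)"
        using absolutely_integrable_on_subinterval[OF snd_int sub] by (simp add: absolutely_integrable_on_def)
      have ri: "rhs Y integrable_on {s..x}" for Y
        using absolutely_integrable_on_subinterval[OF rhs_int sub] by (simp add: absolutely_integrable_on_def)
      have "norm (integral {s..x} (\<lambda>y. snd (apply_bcontfun Y y)) - integral {s..x} (\<lambda>y. snd (apply_bcontfun Z y)))
        = norm (integral {s..x} (\<lambda>y. snd (apply_bcontfun Y y) - snd (apply_bcontfun Z y)))"
        by (simp add: Henstock_Kurzweil_Integration.integral_diff[OF si si])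
      also have "\<dots> \<le> integral {s..x} (\<lambda>y. ?D)"
      proof (rule integral_norm_bound_integral)
        show "norm (snd (apply_bcontfun Y y) - snd (apply_bcontfun Z y)) \<le> ?D" for y
          using order_trans[OF sle(1) D[of y]] by simp
      qed (auto intro: integrable_diff si)
      also have "\<dots> \<le> 1/4 * ?D"
        using x short(1) mult_right_mono[of "x - s" "1/4" ?D] by simp
      finally have 1: "norm (integral {s..x} (\<lambda>y. snd (apply_bcontfun Y y)) - integral {s..x} (\<lambda>y. snd (apply_bcontfun Z y))) \<le> 1/4 * ?D" .
      have "norm (integral {s..x} (rhs Y) - integral {s..x} (rhs Z)) = norm (integral {s..x} (\<lambda>y. rhs Y y - rhs Z y))"
        by (simp add: Henstock_Kurzweil_Integration.integral_diff[OF ri ri])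
      also have "\<dots> \<le> integral {s..x} (\<lambda>y. norm (Q y) * ?D)"
      proof (rule integral_norm_bound_integral)
        fix y
        have "rhs Y y - rhs Z y = Q y * (fst (apply_bcontfun Y y) - fst (apply_bcontfun Z y))"
          by (simp add: rhs_def algebra_simps)
        moreover have "norm (fst (apply_bcontfun Y y) - fst (apply_bcontfun Z y)) \<le> ?D"
          using order_trans[OF sle(2) D[of y]] by simp
        ultimately show "norm (rhs Y y - rhs Z y) \<le> norm (Q y) * ?D"
          by (simp add: norm_mult mult_left_mono)
      qed (auto intro: integrable_diff ri nQx integrable_on_mult_left)
      also have "\<dots> = integral {s..x} (\<lambda>x. norm (Q x)) * ?D" by simp
      also have "\<dots> \<le> 1/4 * ?D"
      proof (rule mult_right_mono)
        have "integral {s..x} (\<lambda>x. norm (Q x)) \<le> integral {s..t} (\<lambda>x. norm (Q x))"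
          by (rule integral_subset_le[OF sub nQx nQ]) simp
        then show "integral {s..x} (\<lambda>x. norm (Q x)) \<le> 1/4" using short(2) by simp
      qed simp
      finally have 2: "norm (integral {s..x} (rhs Y) - integral {s..x} (rhs Z)) \<le> 1/4 * ?D" .
      have "dist (apply_bcontfun (T Y) x') (apply_bcontfun (T Z) x') = norm (G Y x - G Z x)"
        by (simp add: T x_def dist_norm)
      also have "\<dots> \<le> 1/4 * ?D + 1/4 * ?D"
        unfolding G_def by (rule order_trans[OF _ add_mono[OF 1 2]]) (simp add: norm_Pair_le)
      finally show "dist (apply_bcontfun (T Y) x') (apply_bcontfun (T Z) x') \<le> 1/2 * dist Y Z" by simp
    qed
  qed simp_all
  then obtain Y where "T Y = Y" by blast
  then have Y: "apply_bcontfun Y x = G Y x" if "x \<in> {s..t}" for x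
    using T[of Y x] cl(3)[OF that] by simp
  define w p where "w x = fst (apply_bcontfun Y x)" and "p x = snd (apply_bcontfun Y x)" for x
  have w: "w x = \<alpha> + integral {s..x} p" if "x \<in> {s..t}" for x
    using Y[OF that] by (simp add: w_def p_def[abs_def] G_def)
  have p: "p x = \<beta> + integral {s..x} (\<lambda>x. Q x * w x + r x)" if "x \<in> {s..t}" for x
    using Y[OF that] by (simp add: p_def w_def[abs_def] G_def rhs_def[abs_def])
  have "primitive_on {s..t} w p"
    by (rule primitive_on_IccI[OF _ st w]) (use snd_int in \<open>simp_all add: p_def[abs_def]\<close>)
  moreover have "primitive_on {s..t} p (\<lambda>x. Q x * w x + r x)"
    by (rule primitive_on_IccI[OF _ st p]) (use rhs_int[of Y] in \<open>simp_all add: rhs_def[abs_def] w_def\<close>)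
  moreover have "w s = \<alpha>" "p s = \<beta>" using w[of s] p[of s] st by simp_all
  ultimately show ?thesis by blast
qed

text \<open>
  Solutions on adjacent intervals can be joined, so that bisection reduces the problem to short
  intervals.
\<close>

lemma ivp_exists:
  fixes Q r :: "real \<Rightarrow> complex"
  assumes ab: "a \<le> b" and Q: "Q absolutely_integrable_on {a..b}" and r: "r absolutely_integrable_on {a..b}"
  obtains w p where "primitive_on {a..b} w p" "primitive_on {a..b} p (\<lambda>x. Q x * w x + r x)" "w a = \<alpha>" "p a = \<beta>"
proof -
  \<comment> \<open>All initial values are admitted, because the second of two adjacent pieces starts with the final values of the first.\<close>
  define P where "P s t \<longleftrightarrow> (a \<le> s \<longrightarrow> s \<le> t \<longrightarrow> t \<le> b \<longrightarrow>
      (\<forall>\<alpha> \<beta>. \<exists>w p. primitive_on {s..t} w p \<and> primitive_on {s..t} p (\<lambda>x. Q x * w x + r x) \<and> w s = \<alpha> \<and> p s = \<beta>))" for s t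
  have "P a b" using ab
  proof (induction rule: Bolzano)
    case (trans s t u)
    show ?case unfolding P_def
    proof (intro impI allI)
      fix \<alpha> \<beta> assume *: "a \<le> s" "s \<le> u" "u \<le> b"
      then obtain w1 p1 where 1: "primitive_on {s..t} w1 p1" "primitive_on {s..t} p1 (\<lambda>x. Q x * w1 x + r x)" "w1 s = \<alpha>" "p1 s = \<beta>"
        using trans(1,3,4) unfolding P_def by fastforce
      obtain w2 p2 where 2: "primitive_on {t..u} w2 p2" "primitive_on {t..u} p2 (\<lambda>x. Q x * w2 x + r x)" "w2 t = w1 t" "p2 t = p1 t"
        using trans(2,3,4) * unfolding P_def by fastforce
      define w p where "w x = (if x \<le> t then w1 x else w2 x)" and "p x = (if x \<le> t then p1 x else p2 x)" for x
      have L: "{s..u} \<inter> {..t} = {s..t}" and R: "{s..u} \<inter> {t..} = {t..u}" using trans(3,4) by auto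
      have w1: "w x = w1 x" "p x = p1 x" if "x \<in> {s..t}" for x using that by (simp_all add: w_def p_def)
      have w2: "w x = w2 x" "p x = p2 x" if "x \<in> {t..u}" for x using that 2(3,4) by (cases "x = t"; simp add: w_def p_def)+
      have "primitive_on {s..u} w p"
        by (rule primitive_on_combine[where c = t]; unfold L R)
           (rule primitive_on_cong[OF 1(1)] primitive_on_cong[OF 2(1)]; simp add: w1 w2)+
      moreover have "primitive_on {s..u} p (\<lambda>x. Q x * w x + r x)"
        by (rule primitive_on_combine[where c = t]; unfold L R)
           (rule primitive_on_cong[OF 1(2)] primitive_on_cong[OF 2(2)]; simp add: w1 w2)+
      moreover have "w s = \<alpha>" "p s = \<beta>" using 1 trans(3) by (simp_all add: w_def p_def)
      ultimately show "\<exists>w p. primitive_on {s..u} w p \<and> primitive_on {s..u} p (\<lambda>x. Q x * w x + r x) \<and> w s = \<alpha> \<and> p s = \<beta>"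
        by blast
    qed
  next
    case (local x)
    have nQ: "(\<lambda>x. norm (Q x)) integrable_on {a..b}" using Q by (simp add: absolutely_integrable_on_def)
    have "uniformly_continuous_on {a..b} (\<lambda>x. integral {a..x} (\<lambda>x. norm (Q x)))"
      by (rule compact_uniformly_continuous[OF indefinite_integral_continuous_1[OF nQ] compact_Icc])
    then obtain d where d: "d > 0"
      "\<And>s t. s \<in> {a..b} \<Longrightarrow> t \<in> {a..b} \<Longrightarrow> dist t s < d \<Longrightarrow>
         dist (integral {a..t} (\<lambda>x. norm (Q x))) (integral {a..s} (\<lambda>x. norm (Q x))) < 1/4"
      unfolding uniformly_continuous_on_def by (metis zero_less_divide_1_iff zero_less_numeral)
    have "P s t" if st: "s \<le> x" "x \<le> t" "t - s < min d (1/4)" for s t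
      unfolding P_def
    proof (intro impI allI)
      fix \<alpha> \<beta> assume *: "a \<le> s" "s \<le> t" "t \<le> b"
      then have sub: "{s..t} \<subseteq> {a..b}" by auto
      have "integral {a..s} (\<lambda>x. norm (Q x)) + integral {s..t} (\<lambda>x. norm (Q x)) = integral {a..t} (\<lambda>x. norm (Q x))"
        using * by (intro Henstock_Kurzweil_Integration.integral_combine integrable_on_subinterval[OF nQ]) auto
      moreover have "dist (integral {a..t} (\<lambda>x. norm (Q x))) (integral {a..s} (\<lambda>x. norm (Q x))) < 1/4"
        using * st(3) by (intro d(2)) (auto simp: dist_real_def)
      ultimately have "integral {s..t} (\<lambda>x. norm (Q x)) \<le> 1/4" unfolding dist_real_def by linarith
      then show "\<exists>w p. primitive_on {s..t} w p \<and> primitive_on {s..t} p (\<lambda>x. Q x * w x + r x) \<and> w s = \<alpha> \<and> p s = \<beta>"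
        using st(3) * by (intro ivp_short_interval absolutely_integrable_on_subinterval[OF Q sub]
            absolutely_integrable_on_subinterval[OF r sub]) auto
    qed
    then show ?case using d(1) by (intro exI[of _ "min d (1/4)"]) auto
  qed
  then show ?thesis using that ab unfolding P_def by blast
qed

text \<open>
  The products \<open>Q u y\<close> cancel in the derivative of the Wronskian, and only the inhomogeneity is left.
\<close>

lemma lagrange_identity:
  fixes u u' y y' :: "real \<Rightarrow> complex"
  assumes "primitive_on I u u'" "primitive_on I u' (\<lambda>x. Q x * u x)"
    and "primitive_on I y y'" "primitive_on I y' (\<lambda>x. Q x * y x + r x)"
  shows "primitive_on I (\<lambda>x. u x * y' x - u' x * y x) (\<lambda>x. u x * r x)"
  by (rule primitive_on_cong[OF primitive_on_diff[OF primitive_on_mult[OF assms(1,4)] primitive_on_mult[OF assms(2,3)]]])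
     (simp_all add: algebra_simps)

lemma wronskian_const:
  fixes u u' y y' :: "real \<Rightarrow> complex"
  assumes "primitive_on {a..b} u u'" "primitive_on {a..b} u' (\<lambda>x. Q x * u x)"
    and "primitive_on {a..b} y y'" "primitive_on {a..b} y' (\<lambda>x. Q x * y x)"
    and "s \<in> {a..b}" "t \<in> {a..b}"
  shows "u s * y' s - u' s * y s = u t * y' t - u' t * y t"
proof -
  have "primitive_on {a..b} (\<lambda>x. u x * y' x - u' x * y x) (\<lambda>x. 0)"
    using lagrange_identity[OF assms(1-3), of "\<lambda>x. 0"] assms(4) by simp
  from primitive_on_integral[OF this, of s t] primitive_on_integral[OF this, of t s] show ?thesis
    using assms(5,6) by (cases "s \<le> t") auto
qed

text \<open>
  The Wronskians of \<open>y\<close> with two solutions \<open>w\<close> and \<open>v\<close> that are normalized at \<open>a\<close> are constant and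
  vanish at \<open>c\<close>. As the Wronskian of \<open>w\<close> and \<open>v\<close> is one, Cramer's rule expresses \<open>y\<close> by them.
\<close>

lemma solution_zero_data:
  fixes Q y y' :: "real \<Rightarrow> complex"
  assumes Q: "Q absolutely_integrable_on {a..b}"
    and y: "primitive_on {a..b} y y'" "primitive_on {a..b} y' (\<lambda>x. Q x * y x)"
    and zero: "c \<in> {a..b}" "y c = 0" "y' c = 0" and x: "x \<in> {a..b}"
  shows "y x = 0"
proof -
  have ab: "a \<le> b" using x by simp
  obtain w p where w: "primitive_on {a..b} w p" "primitive_on {a..b} p (\<lambda>x. Q x * w x)" "w a = 1" "p a = 0"
    using ivp_exists[OF ab Q absolutely_integrable_zero, of 1 0] by auto
  obtain v q where v: "primitive_on {a..b} v q" "primitive_on {a..b} q (\<lambda>x. Q x * v x)" "v a = 0" "q a = 1"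
    using ivp_exists[OF ab Q absolutely_integrable_zero, of 0 1] by auto
  have 1: "w x * q x - p x * v x = 1"
    using wronskian_const[OF w(1,2) v(1,2), of x a] x ab w(3,4) v(3,4) by simp
  have 2: "w x * y' x - p x * y x = 0"
    using wronskian_const[OF w(1,2) y, of x c] x zero by simp
  have 3: "v x * y' x - q x * y x = 0"
    using wronskian_const[OF v(1,2) y, of x c] x zero by simp
  have "y x = v x * (w x * y' x - p x * y x) - w x * (v x * y' x - q x * y x) - y x * (w x * q x - p x * v x - 1)"
    by (simp add: algebra_simps)
  then show ?thesis using 1 2 3 by simp
qed

section \<open>A smooth step function\<close>

text \<open>
  With \<open>w = 1 / (x (1 - x))\<close>, the functions \<open>p(x) w\<^sup>m exp (- w)\<close> on \<open>(0,1)\<close>, extended by zero, are a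
  family closed under differentiation that contains the standard bump function.
\<close>

definition bump_fun :: "real poly \<Rightarrow> nat \<Rightarrow> real \<Rightarrow> real" where
  "bump_fun p m x =
     (if 0 < x \<and> x < 1 then poly p x * inverse (x * (1 - x)) ^ m * exp (- inverse (x * (1 - x))) else 0)"

definition bump_deriv_poly :: "real poly \<Rightarrow> nat \<Rightarrow> real poly" where
  "bump_deriv_poly p m =
     pderiv p * [:0, 1, -1:]\<^sup>2 - smult (real m) (p * [:1, -2:] * [:0, 1, -1:]) + p * [:1, -2:]"

lemma bump_fun_outside: "\<not> (0 < x \<and> x < 1) \<Longrightarrow> bump_fun p m x = 0"
  unfolding bump_fun_def by (rule if_not_P)

lemma has_derivative_zero_quadratic:
  fixes f :: "real \<Rightarrow> real"
  assumes "\<And>y. \<bar>f y - f x\<bar> \<le> C * (y - x)\<^sup>2"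
  shows "(f has_real_derivative 0) (at x)"
  unfolding has_field_derivative_iff
proof (rule Lim_null_comparison)
  show "\<forall>\<^sub>F y in at x. norm ((f y - f x) / (y - x)) \<le> \<bar>C\<bar> * \<bar>y - x\<bar>"
  proof (rule always_eventually, rule allI)
    fix y
    have "\<bar>f y - f x\<bar> \<le> \<bar>C\<bar> * \<bar>y - x\<bar> * \<bar>y - x\<bar>"
      using assms[of y] mult_right_mono[OF abs_ge_self[of C], of "(y - x)\<^sup>2"]
      by (simp add: power2_eq_square mult.assoc abs_mult_self_eq)
    then show "norm ((f y - f x) / (y - x)) \<le> \<bar>C\<bar> * \<bar>y - x\<bar>"
      by (cases "y = x") (simp_all add: divide_le_eq abs_divide)
  qed
  have "((\<lambda>y. \<bar>C\<bar> * \<bar>y - x\<bar>) \<longlongrightarrow> \<bar>C\<bar> * \<bar>x - x\<bar>) (at x)"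
    by (intro tendsto_intros)
  then show "((\<lambda>y. \<bar>C\<bar> * \<bar>y - x\<bar>) \<longlongrightarrow> 0) (at x)" by simp
qed

text \<open>
  The exponential beats every power of \<open>1 / (y (1 - y))\<close>. This gives differentiability at the points
  outside of \<open>(0,1)\<close>, in particular at \<open>0\<close> and \<open>1\<close>.
\<close>

lemma bump_fun_quadratic:
  obtains C where "\<And>x y. \<not> (0 < x \<and> x < 1) \<Longrightarrow> \<bar>bump_fun p m y\<bar> \<le> C * (y - x)\<^sup>2"
proof -
  have "bounded (poly p ` {0..1})"
    by (intro compact_imp_bounded compact_continuous_image continuous_intros compact_Icc)
  then obtain B where B: "B > 0" "\<And>y. y \<in> {0..1} \<Longrightarrow> \<bar>poly p y\<bar> \<le> B"
    unfolding bounded_pos by auto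
  \<comment> \<open>Two more powers than \<open>m\<close> leave the factor \<open>(y (1 - y))\<^sup>2\<close>, which the squared distance dominates.\<close>
  define n where "n = m + 2"
  have n: "n > 0" by (simp add: n_def)
  define C where "C = B * real n ^ n"
  have C: "C \<ge> 0" using B(1) by (simp add: C_def)
  have "\<bar>bump_fun p m y\<bar> \<le> C * (y - x)\<^sup>2" if x: "\<not> (0 < x \<and> x < 1)" for x y
  proof (cases "0 < y \<and> y < 1")
    case False then show ?thesis using C by (simp add: bump_fun_outside)
  next
    case True
    define d where "d = y * (1 - y)"
    have d: "d > 0" "d \<le> y" "d \<le> 1 - y" using True by (auto simp: d_def mult_le_cancel_left1 mult_le_cancel_right1)
    have "(1 + inverse d / real n) ^ n \<le> exp (inverse d)"
      using d(1) n by (intro exp_ge_one_plus_x_over_n_power_n) (auto intro: order_trans[of _ 0])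
    moreover have "(inverse d / real n) ^ n \<le> (1 + inverse d / real n) ^ n"
      using d(1) by (intro power_mono) auto
    ultimately have "(inverse d / real n) ^ n \<le> exp (inverse d)" by (rule order_trans[rotated])
    then have "inverse d ^ n \<le> real n ^ n * exp (inverse d)"
      using n by (simp add: power_divide divide_le_eq mult.commute)
    from mult_right_mono[OF this exp_ge_zero[of "- inverse d"]]
    have e: "inverse d ^ n * exp (- inverse d) \<le> real n ^ n"
      by (simp only: mult.assoc mult_exp_exp) simp
    have "d ^ 2 * inverse d ^ n = inverse d ^ m"
      using d(1) by (simp add: n_def power_add power2_eq_square field_simps)
    then have "inverse d ^ m * exp (- inverse d) = d ^ 2 * (inverse d ^ n * exp (- inverse d))" by simp
    also have "\<dots> \<le> d ^ 2 * real n ^ n" using e by (intro mult_left_mono) auto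
    finally have 1: "inverse d ^ m * exp (- inverse d) \<le> d ^ 2 * real n ^ n" .
    have "\<bar>bump_fun p m y\<bar> = \<bar>poly p y\<bar> * (inverse d ^ m * exp (- inverse d))"
      using True d(1) by (simp add: bump_fun_def d_def[symmetric] abs_mult)
    also have "\<dots> \<le> B * (d ^ 2 * real n ^ n)"
      by (rule mult_mono[OF _ 1]) (use B True d(1) in auto)
    also have "\<dots> = C * d ^ 2" by (simp add: C_def)
    also have "\<dots> \<le> C * (y - x)\<^sup>2"
    proof (rule mult_left_mono[OF _ C])
      have "d \<le> \<bar>y - x\<bar>" using x True d by linarith
      then have "d ^ 2 \<le> \<bar>y - x\<bar> ^ 2" using d(1) by (intro power_mono) auto
      then show "d ^ 2 \<le> (y - x) ^ 2" by simp
    qed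
    finally show ?thesis .
  qed
  then show ?thesis using that by blast
qed

text \<open>
  Inside of \<open>(0,1)\<close> this is the quotient rule; at all other points the quadratic bound makes the
  derivative vanish.
\<close>

lemma bump_fun_DERIV:
  "(bump_fun p m has_real_derivative bump_fun (bump_deriv_poly p m) (m + 2) x) (at x)"
proof (cases "0 < x \<and> x < 1")
  case False
  obtain C where C: "\<And>x y. \<not> (0 < x \<and> x < 1) \<Longrightarrow> \<bar>bump_fun p m y\<bar> \<le> C * (y - x)\<^sup>2"
    using bump_fun_quadratic by metis
  have "(bump_fun p m has_real_derivative 0) (at x)"
    by (rule has_derivative_zero_quadratic[of _ _ C]) (use C[OF False] bump_fun_outside[OF False] in simp)
  moreover have "bump_fun (bump_deriv_poly p m) (m + 2) x = 0"
    by (rule bump_fun_outside[OF False])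
  ultimately show ?thesis by simp
next
  case True
  define i where "i = inverse (x * (1 - x))"
  have x0: "x * (1 - x) \<noteq> 0" using True by simp
  have di: "x * (1 - x) * i = 1" unfolding i_def by (rule right_inverse[OF x0])
  have I: "((\<lambda>y. inverse (y * (1 - y))) has_real_derivative - (1 - 2 * x) * i\<^sup>2) (at x)"
  proof -
    have "((\<lambda>y. y * (1 - y)) has_real_derivative 1 - 2 * x) (at x)"
      by (auto intro!: derivative_eq_intros)
    from DERIV_inverse_fun[OF this x0] show ?thesis
      by (simp only: i_def power_inverse numeral_2_eq_2 mult_minus_left)
  qed
  have "((\<lambda>y. poly p y * inverse (y * (1 - y)) ^ m * exp (- inverse (y * (1 - y)))) has_real_derivative
      (poly (pderiv p) x * i ^ m + (of_nat m * (- (1 - 2 * x) * i\<^sup>2 * i ^ (m - Suc 0))) * poly p x) * exp (- i)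
        + (exp (- i) * - (- (1 - 2 * x) * i\<^sup>2)) * (poly p x * i ^ m)) (at x)"
    unfolding i_def
    by (rule DERIV_mult[OF DERIV_mult[OF poly_DERIV DERIV_power[OF I[unfolded i_def], of m]]
          DERIV_fun_exp[OF DERIV_minus[OF I[unfolded i_def]]]])
  moreover have "(poly (pderiv p) x * i ^ m + (of_nat m * (- (1 - 2 * x) * i\<^sup>2 * i ^ (m - Suc 0))) * poly p x) * exp (- i)
        + (exp (- i) * - (- (1 - 2 * x) * i\<^sup>2)) * (poly p x * i ^ m) = bump_fun (bump_deriv_poly p m) (m + 2) x"
  proof -
    define d where "d = x * (1 - x)"
    have k: "of_nat m * (i\<^sup>2 * i ^ (m - Suc 0)) = of_nat m * i ^ (m + 1)"
      by (cases m) (simp_all add: power2_eq_square algebra_simps)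
    have di': "d * i = 1" using di by (simp only: d_def)
    have "d\<^sup>2 * i ^ (m + 2) = (d * i)\<^sup>2 * i ^ m" by (simp add: power_add power_mult_distrib power2_eq_square)
    moreover have "d * i ^ (m + 2) = (d * i) * i ^ (m + 1)" by simp
    ultimately have dd: "i ^ m = d\<^sup>2 * i ^ (m + 2)" "i ^ (m + 1) = d * i ^ (m + 2)"
      by (simp_all only: di' power_one mult_1_left)
    have "poly (bump_deriv_poly p m) x = poly (pderiv p) x * d\<^sup>2 - real m * (poly p x * (1 - 2 * x) * d) + poly p x * (1 - 2 * x)"
      by (simp add: bump_deriv_poly_def d_def algebra_simps power2_eq_square)
    then have "bump_fun (bump_deriv_poly p m) (m + 2) x =
       (poly (pderiv p) x * d\<^sup>2 - real m * (poly p x * (1 - 2 * x) * d) + poly p x * (1 - 2 * x)) * i ^ (m + 2) * exp (- i)"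
      using True by (simp add: bump_fun_def i_def)
    also have "\<dots> = (poly (pderiv p) x * (d\<^sup>2 * i ^ (m + 2)) - (poly p x * (1 - 2 * x)) * (real m * (d * i ^ (m + 2)))
        + poly p x * (1 - 2 * x) * i\<^sup>2 * i ^ m) * exp (- i)"
      by (simp add: algebra_simps power_add power2_eq_square)
    also have "\<dots> = (poly (pderiv p) x * i ^ m - (poly p x * (1 - 2 * x)) * (of_nat m * (i\<^sup>2 * i ^ (m - Suc 0)))
        + poly p x * (1 - 2 * x) * i\<^sup>2 * i ^ m) * exp (- i)"
      by (simp only: dd[symmetric] k)
    finally show ?thesis by (simp add: algebra_simps)
  qed
  ultimately have "((\<lambda>y. poly p y * inverse (y * (1 - y)) ^ m * exp (- inverse (y * (1 - y)))) has_real_derivative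
      bump_fun (bump_deriv_poly p m) (m + 2) x) (at x)" by simp
  then show ?thesis
    by (rule has_field_derivative_transform_within_open[of _ _ _ "{0<..<1}"])
       (use True in \<open>auto simp: bump_fun_def\<close>)
qed

lemma primitive_on_deriv:
  fixes F :: "real \<Rightarrow> real"
  assumes "primitive_on UNIV F f" "continuous_on UNIV f"
  shows "(F has_real_derivative f x) (at x)"
proof -
  have "((\<lambda>u. integral {x-1..u} f) has_vector_derivative f x) (at x within {x-1..x+1})"
    by (rule integral_has_vector_derivative) (auto intro: continuous_on_subset[OF assms(2)])
  then have "((\<lambda>u. F (x-1) + integral {x-1..u} f) has_vector_derivative f x) (at x within {x-1..x+1})"
    by (simp add: has_vector_derivative_def) (auto intro!: derivative_eq_intros)
  then have "(F has_vector_derivative f x) (at x within {x-1..x+1})"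
    by (rule has_vector_derivative_transform[rotated 2])
       (use primitive_on_integral[OF assms(1), of "x-1"] in auto)
  moreover have "at x within {x-1..x+1} = at x" by (rule at_within_interior) simp
  ultimately show ?thesis by (simp add: has_real_derivative_iff_has_vector_derivative)
qed

text \<open>
  \<open>\<sigma> 1\<close> is the normalized integral of a bump function and \<open>\<sigma> 0\<close> a primitive of \<open>\<sigma> 1\<close>. The family lists the
  successive derivatives, so that smoothness is inherited by rescaled copies and their sums.
\<close>

lemma smooth_step_exists:
  obtains \<sigma> :: "nat \<Rightarrow> real \<Rightarrow> real" where
    "\<And>n x. (\<sigma> n has_real_derivative \<sigma> (Suc n) x) (at x)"
    "\<And>x. x \<le> 0 \<Longrightarrow> \<sigma> 0 x = 0" "\<And>x. x \<ge> 1 \<Longrightarrow> \<sigma> 0 x = x - 1 + \<sigma> 0 1"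
    "\<And>x. x \<le> 0 \<Longrightarrow> \<sigma> 1 x = 0" "\<And>x. x \<ge> 1 \<Longrightarrow> \<sigma> 1 x = 1"
    "\<And>x. \<bar>\<sigma> 1 x\<bar> \<le> 1"
proof -
  define st where "st = ((\<lambda>(p, m). (bump_deriv_poly p m, m + 2 :: nat)) :: real poly \<times> nat \<Rightarrow> _)"
  define b where "b n = case_prod bump_fun ((st ^^ n) (1, 0))" for n
  have b_deriv: "(b n has_real_derivative b (Suc n) x) (at x)" for n x
    using bump_fun_DERIV by (cases "(st ^^ n) (1, 0)") (simp add: b_def st_def)
  have b0: "b 0 x = (if 0 < x \<and> x < 1 then exp (- inverse (x * (1 - x))) else 0)" for x
    by (simp add: b_def bump_fun_def)
  have cont: "continuous_on A (b n)" for A n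
    by (rule continuous_at_imp_continuous_on) (auto intro: DERIV_isCont b_deriv)
  obtain S where S: "primitive_on UNIV S (b 0)" "S 0 = 0"
    by (rule primitive_on_exists[of UNIV 0 "b 0" 0]) (auto intro: absolutely_integrable_continuous_real cont)
  have S_deriv: "(S has_real_derivative b 0 x) (at x)" for x
    by (rule primitive_on_deriv[OF S(1) cont])
  have S_mono: "S x \<le> S y" if "x \<le> y" for x y
    by (rule DERIV_nonneg_imp_nondecreasing[OF that]) (use S_deriv b0 in force)
  have S0: "S x = 0" if "x \<le> 0" for x
    using DERIV_isconst2[of x 0 S]  S(2)
    by (metis DERIV_isconst_end DERIV_isCont S_deriv b0 continuous_at_imp_continuous_on le_less not_less order_less_imp_le that)
  have S1: "S x = S 1" if "x \<ge> 1" for x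
    by (metis DERIV_isconst_end DERIV_isCont S_deriv b0 continuous_at_imp_continuous_on le_less not_less order_less_imp_le that)
  have pos: "S 1 > 0"
  proof -
    obtain \<xi> where "0 < \<xi>" "\<xi> < 1" "S 1 - S 0 = (1 - 0) * b 0 \<xi>"
      using MVT2[of 0 1 S "b 0"] S_deriv by auto
    then show ?thesis using S(2) b0 by simp
  qed
  have cS: "continuous_on A (\<lambda>x. S x / S 1)" for A
    by (rule continuous_at_imp_continuous_on) (auto intro: DERIV_isCont[OF DERIV_cdivide[OF S_deriv]])
  obtain T where T: "primitive_on UNIV T (\<lambda>x. S x / S 1)" "T 0 = 0"
    by (rule primitive_on_exists[of UNIV 0 "\<lambda>x. S x / S 1" 0]) (auto intro: absolutely_integrable_continuous_real cS)
  define \<sigma> where "\<sigma> n = (case n of 0 \<Rightarrow> T | Suc 0 \<Rightarrow> (\<lambda>x. S x / S 1) | Suc (Suc k) \<Rightarrow> (\<lambda>x. b k x / S 1))" for n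
  show ?thesis
  proof (rule that[of \<sigma>])
    show "(\<sigma> n has_real_derivative \<sigma> (Suc n) x) (at x)" for n x
    proof -
      consider "n = 0" | "n = 1" | k where "n = Suc (Suc k)" by (metis One_nat_def not0_implies_Suc)
      then show ?thesis
      proof cases
        case 1 then show ?thesis using primitive_on_deriv[OF T(1) cS] by (simp add: \<sigma>_def)
      next
        case 2 then show ?thesis using DERIV_cdivide[OF S_deriv] by (simp add: \<sigma>_def)
      next
        case 3 then show ?thesis using DERIV_cdivide[OF b_deriv] by (simp add: \<sigma>_def)
      qed
    qed
    show "\<sigma> 1 x = 0" if "x \<le> 0" for x using S0[OF that] by (simp add: \<sigma>_def)
    show "\<sigma> 1 x = 1" if "x \<ge> 1" for x using S1[OF that] pos by (simp add: \<sigma>_def)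
    show "\<bar>\<sigma> 1 x\<bar> \<le> 1" for x
      using S_mono[of x 1] S1[of x] S_mono[of 0 x] S0[of x] S(2) pos by (cases "x \<le> 0"; cases "x \<ge> 1") (auto simp: \<sigma>_def)
    show "\<sigma> 0 x = 0" if "x \<le> 0" for x
    proof -
      have "integral {x..0} (\<lambda>x. S x / S 1) = integral {x..0} (\<lambda>x. 0)"
        by (rule integral_cong) (simp add: S0)
      then have "T 0 - T x = 0" using primitive_on_integral[OF T(1) that] by (metis integral_0 subset_UNIV)
      then show ?thesis using T(2) by (simp add: \<sigma>_def)
    qed
    show "\<sigma> 0 x = x - 1 + \<sigma> 0 1" if "x \<ge> 1" for x
    proof -
      have "T x - T 1 = integral {1..x} (\<lambda>x. S x / S 1)"
        using primitive_on_integral[OF T(1) that] by (metis subset_UNIV)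
      also have "\<dots> = integral {1..x} (\<lambda>x. 1)"
      proof (rule integral_cong)
        show "S y / S 1 = 1" if "y \<in> {1..x}" for y
          using that pos S1[of y] by simp
      qed
      also have "\<dots> = x - 1" using that by simp
      finally have "T x - T 1 = x - 1" .
      then show ?thesis by (simp add: \<sigma>_def)
    qed
  qed
qed

section \<open>Weak derivatives and primitives\<close>

lemma iterated_deriv:
  assumes "\<And>n x. (D n has_real_derivative D (Suc n) x) (at x)"
  shows "(deriv ^^ n) (D 0) = D n"
proof (induction n)
  case (Suc n)
  then show ?case using assms[THEN DERIV_imp_deriv] by auto
qed simp

lemma test_function_onI:
  assumes D: "\<And>n x. (D n has_real_derivative D (Suc n) x) (at x)"
    and supp: "\<And>x. x \<notin> {a..b} \<Longrightarrow> D 0 x = 0" and "{a..b} \<subseteq> \<Omega>"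
  shows "test_function_on \<Omega> (D 0)"
  unfolding test_function_on_def
proof (intro conjI allI)
  show "(deriv ^^ n) (D 0) differentiable_on UNIV" for n
    using D[of n] unfolding iterated_deriv[of D, OF D] differentiable_on_def
    by (auto intro: differentiable_at_withinI simp: real_differentiable_def)
  have sub: "closure {x. D 0 x \<noteq> 0} \<subseteq> {a..b}"
  proof (rule closure_minimal)
    show "{x. D 0 x \<noteq> 0} \<subseteq> {a..b}" using supp by blast
  qed simp
  then show "closure {x. D 0 x \<noteq> 0} \<subseteq> \<Omega>" using assms(3) by blast
  show "compact (closure {x. D 0 x \<noteq> 0})"
    using sub compact_Icc closed_closure by (metis bounded_subset compact_eq_bounded_closed)
qed

lemma test_function_onD:
  assumes "test_function_on \<Omega> \<phi>"
  shows "(\<phi> has_real_derivative deriv \<phi> x) (at x)" "continuous_on UNIV \<phi>" "continuous_on UNIV (deriv \<phi>)"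
    and "x \<notin> closure {x. \<phi> x \<noteq> 0} \<Longrightarrow> \<phi> x = 0" "x \<notin> closure {x. \<phi> x \<noteq> 0} \<Longrightarrow> deriv \<phi> x = 0"
proof -
  have 0: "(deriv ^^ n) \<phi> differentiable_on UNIV" for n
    using assms unfolding test_function_on_def by blast
  have d: "(\<phi> has_real_derivative deriv \<phi> x) (at x)" for x
    using 0[of 0] by (auto simp: differentiable_on_def DERIV_deriv_iff_real_differentiable)
  then show "(\<phi> has_real_derivative deriv \<phi> x) (at x)" .
  show "continuous_on UNIV \<phi>" "continuous_on UNIV (deriv \<phi>)"
    using 0[of 0] 0[of 1] by (auto intro: differentiable_imp_continuous_on)
  assume x: "x \<notin> closure {x. \<phi> x \<noteq> 0}"
  have sub: "{x. \<phi> x \<noteq> 0} \<subseteq> closure {x. \<phi> x \<noteq> 0}" by (rule closure_subset)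
  show "\<phi> x = 0" using x sub by blast
  have "((\<lambda>y. 0) has_real_derivative deriv \<phi> x) (at x)"
    by (rule has_field_derivative_transform_within_open[OF d, of "- closure {x. \<phi> x \<noteq> 0}"])
       (use x sub in \<open>blast | simp\<close>)+
  then show "deriv \<phi> x = 0" using DERIV_unique DERIV_const by blast
qed

text \<open>
  The integrand vanishes outside of \<open>K\<close>. Hence integrals over all of \<open>\<Omega>\<close> reduce to integrals over a
  compact set, where \<open>h\<close> is integrable.
\<close>

lemma test_integral:
  fixes h :: "real \<Rightarrow> complex"
  assumes h: "locally_integrable_on h \<Omega>" and K: "compact K" "K \<subseteq> \<Omega>"
    and \<psi>: "continuous_on UNIV \<psi>" "\<And>x. x \<notin> K \<Longrightarrow> \<psi> x = 0"
  shows "(\<lambda>x. \<psi> x *\<^sub>R h x) absolutely_integrable_on K"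
    and "set_integrable lebesgue \<Omega> (\<lambda>x. \<psi> x *\<^sub>R h x)"
    and "(LINT x:\<Omega>|lebesgue. \<psi> x *\<^sub>R h x) = integral K (\<lambda>x. \<psi> x *\<^sub>R h x)"
proof -
  have hK: "h absolutely_integrable_on K" using h K unfolding locally_integrable_on_def by blast
  have Kl: "K \<in> sets lebesgue" using K(1) lmeasurable_compact by blast
  have cK: "continuous_on K \<psi>" using \<psi>(1) continuous_on_subset by blast
  have "bilinear (scaleR :: real \<Rightarrow> complex \<Rightarrow> complex)"
    by (simp add: bilinear_conv_bounded_bilinear bounded_bilinear_scaleR)
  from absolutely_integrable_bounded_measurable_product[OF this _ Kl _ hK, of \<psi>]
  show 1: "(\<lambda>x. \<psi> x *\<^sub>R h x) absolutely_integrable_on K"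
    using continuous_imp_measurable_on_sets_lebesgue[OF cK Kl]
      compact_imp_bounded[OF compact_continuous_image[OF cK K(1)]] by blast
  have eq: "(\<lambda>x. indicator \<Omega> x *\<^sub>R (\<psi> x *\<^sub>R h x)) = (\<lambda>x. indicator K x *\<^sub>R (\<psi> x *\<^sub>R h x))"
  proof
    fix x show "indicator \<Omega> x *\<^sub>R (\<psi> x *\<^sub>R h x) = indicator K x *\<^sub>R (\<psi> x *\<^sub>R h x)"
      using K(2) \<psi>(2)[of x] by (cases "x \<in> K") (auto simp: subset_iff)
  qed
  show "set_integrable lebesgue \<Omega> (\<lambda>x. \<psi> x *\<^sub>R h x)"
    using 1 unfolding set_integrable_def eq .
  show "(LINT x:\<Omega>|lebesgue. \<psi> x *\<^sub>R h x) = integral K (\<lambda>x. \<psi> x *\<^sub>R h x)"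
    using set_lebesgue_integral_eq_integral(2)[OF 1] unfolding set_lebesgue_integral_def eq .
qed

text \<open>
  The open sets that matter below, intervals and the punctured line, share the property that
  each compact subset is covered by two compact intervals inside of the set.
\<close>

definition two_interval_exhaustible :: "real set \<Rightarrow> bool" where
  "two_interval_exhaustible \<Omega> \<longleftrightarrow>
     (\<forall>K. compact K \<longrightarrow> K \<subseteq> \<Omega> \<longrightarrow>
        (\<exists>s1 t1 s2 t2. s1 \<le> t1 \<and> t1 \<le> s2 \<and> s2 \<le> t2 \<and>
           {s1..t1} \<subseteq> \<Omega> \<and> {s2..t2} \<subseteq> \<Omega> \<and> K \<subseteq> {s1<..<t1} \<union> {s2<..<t2}))"

lemma two_interval_exhaustible_interval:
  assumes "is_interval I" "open I" "I \<noteq> {}"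
  shows "two_interval_exhaustible I"
  unfolding two_interval_exhaustible_def
proof (intro allI impI)
  fix K assume K: "compact K" "K \<subseteq> I"
  obtain c where c: "c \<in> I" using assms(3) by blast
  let ?K = "insert c K"
  have cK: "compact ?K" using K(1) by (rule compact_insert)
  obtain s t where st: "s \<in> ?K" "t \<in> ?K" "\<forall>x\<in>?K. s \<le> x" "\<forall>x\<in>?K. x \<le> t"
    using compact_attains_inf[OF cK] compact_attains_sup[OF cK] by blast
  have sI: "s \<in> I" "t \<in> I" using st c K by auto
  obtain e1 where e1: "e1 > 0" "ball s e1 \<subseteq> I" using assms(2) sI(1) open_contains_ball by metis
  obtain e2 where e2: "e2 > 0" "ball t e2 \<subseteq> I" using assms(2) sI(2) open_contains_ball by metis
  have m: "s - e1/2 \<in> I" "t + e2/2 \<in> I"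
    using e1 e2 by (auto simp: subset_iff dist_real_def)
  have sub: "{s - e1/2..t + e2/2} \<subseteq> I"
    using mem_is_interval_1_I[OF assms(1) m] by auto
  have "s \<le> t" using st by auto
  have "s - e1/2 \<le> t + e2/2" "t + e2/2 \<le> t + e2/2" "{t + e2/2..t + e2/2} \<subseteq> I"
    using \<open>s \<le> t\<close> e1(1) e2(1) m by auto
  moreover have "K \<subseteq> {s - e1/2<..<t + e2/2} \<union> {t + e2/2<..<t + e2/2}"
  proof
    fix x assume "x \<in> K"
    then have "s \<le> x" "x \<le> t" using st by auto
    then show "x \<in> {s - e1/2<..<t + e2/2} \<union> {t + e2/2<..<t + e2/2}" using e1(1) e2(1) by auto
  qed
  ultimately show "\<exists>s1 t1 s2 t2. s1 \<le> t1 \<and> t1 \<le> s2 \<and> s2 \<le> t2 \<and>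
           {s1..t1} \<subseteq> I \<and> {s2..t2} \<subseteq> I \<and> K \<subseteq> {s1<..<t1} \<union> {s2<..<t2}"
    using sub by blast
qed

lemma two_interval_exhaustible_punctured: "two_interval_exhaustible (- {0})"
  unfolding two_interval_exhaustible_def
proof (intro allI impI)
  fix K :: "real set" assume K: "compact K" "K \<subseteq> - {0}"
  have "open (- K)" "0 \<in> - K" using K compact_imp_closed by auto
  then obtain d where d: "d > 0" "ball 0 d \<subseteq> - K" using open_contains_ball by metis
  obtain M where M: "\<And>x. x \<in> K \<Longrightarrow> \<bar>x\<bar> \<le> M"
    using compact_imp_bounded[OF K(1)] unfolding bounded_iff by auto
  define N where "N = \<bar>M\<bar> + d + 1"
  have far: "\<bar>x\<bar> \<ge> d" if "x \<in> K" for x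
  proof (rule ccontr)
    assume "\<not> d \<le> \<bar>x\<bar>"
    then have "x \<in> ball 0 d" by (simp add: dist_real_def)
    then show False using d(2) that by blast
  qed
  have "- N \<le> - (d/2)" "- (d/2) \<le> d/2" "d/2 \<le> N" "{-N.. -(d/2)} \<subseteq> - {0}" "{d/2..N} \<subseteq> - {0}"
    using d(1) by (auto simp: N_def)
  moreover have "K \<subseteq> {-N<..< -(d/2)} \<union> {d/2<..<N}"
  proof
    fix x assume x: "x \<in> K"
    show "x \<in> {-N<..< -(d/2)} \<union> {d/2<..<N}"
      using far[OF x] M[OF x] d(1) unfolding N_def by (cases "x \<ge> 0") auto
  qed
  ultimately show "\<exists>s1 t1 s2 t2. s1 \<le> t1 \<and> t1 \<le> s2 \<and> s2 \<le> t2 \<and>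
           {s1..t1} \<subseteq> - {0} \<and> {s2..t2} \<subseteq> - {0} \<and> K \<subseteq> {s1<..<t1} \<union> {s2<..<t2}"
    by blast
qed

lemma primitive_on_locally_integrable:
  fixes F f :: "real \<Rightarrow> complex"
  assumes "two_interval_exhaustible \<Omega>" "primitive_on \<Omega> F f"
  shows "locally_integrable_on F \<Omega>" "locally_integrable_on f \<Omega>"
proof -
  have "F absolutely_integrable_on K \<and> f absolutely_integrable_on K" if K: "compact K" "K \<subseteq> \<Omega>" for K
  proof -
    obtain s1 t1 s2 t2 where *: "s1 \<le> t1" "s2 \<le> t2" "{s1..t1} \<subseteq> \<Omega>" "{s2..t2} \<subseteq> \<Omega>"
      "K \<subseteq> {s1<..<t1} \<union> {s2<..<t2}"
      using assms(1) K unfolding two_interval_exhaustible_def by metis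
    have sub: "K \<subseteq> {s1..t1} \<union> {s2..t2}" using *(5) by auto
    have Kl: "K \<in> sets lebesgue" using K(1) lmeasurable_compact by blast
    have "f absolutely_integrable_on {s1..t1} \<union> {s2..t2}"
      by (rule absolutely_integrable_Un[OF primitive_onD(1)[OF assms(2) *(1,3)] primitive_onD(1)[OF assms(2) *(2,4)]])
    moreover have "F absolutely_integrable_on {s1..t1} \<union> {s2..t2}"
      by (rule absolutely_integrable_Un;
          rule absolutely_integrable_continuous_real[OF primitive_on_continuous_Icc[OF assms(2)]])
         (fact *(3) *(4))+
    ultimately show ?thesis using set_integrable_subset[OF _ Kl sub] by blast
  qed
  then show "locally_integrable_on F \<Omega>" "locally_integrable_on f \<Omega>"
    unfolding locally_integrable_on_def by blast+
qed

text \<open>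
  The product rule on both intervals that cover the support of the test function, which
  vanishes at their end points.
\<close>

lemma primitive_on_imp_weak_deriv_on:
  fixes F f :: "real \<Rightarrow> complex"
  assumes \<Omega>: "two_interval_exhaustible \<Omega>" and F: "primitive_on \<Omega> F f"
  shows "weak_deriv_on \<Omega> F f"
  unfolding weak_deriv_on_def
proof (intro conjI allI impI)
  note loc = primitive_on_locally_integrable[OF \<Omega> F]
  show "locally_integrable_on F \<Omega>" "locally_integrable_on f \<Omega>" by (fact loc)+
  fix \<phi> assume \<phi>: "test_function_on \<Omega> \<phi>"
  note t = test_function_onD[OF \<phi>]
  have cK: "compact (closure {x. \<phi> x \<noteq> 0})" and sK: "closure {x. \<phi> x \<noteq> 0} \<subseteq> \<Omega>"
    using \<phi> unfolding test_function_on_def by blast+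
  then obtain s1 t1 s2 t2 where st: "s1 \<le> t1" "t1 \<le> s2" "s2 \<le> t2" "{s1..t1} \<subseteq> \<Omega>" "{s2..t2} \<subseteq> \<Omega>"
      "closure {x. \<phi> x \<noteq> 0} \<subseteq> {s1<..<t1} \<union> {s2<..<t2}"
    using \<Omega> unfolding two_interval_exhaustible_def by metis
  define J where "J = {s1..t1} \<union> {s2..t2}"
  have J: "compact J" "J \<subseteq> \<Omega>" "closure {x. \<phi> x \<noteq> 0} \<subseteq> J"
    unfolding J_def using st(4-6) by (auto intro: compact_Un)
  have vanish: "\<phi> x = 0" "deriv \<phi> x = 0" if "x \<notin> J" for x
    using t(4,5)[of x] J(3) that by blast+
  have ends: "\<phi> s1 = 0" "\<phi> t1 = 0" "\<phi> s2 = 0" "\<phi> t2 = 0"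
    by (rule t(4); use st in auto)+
  have \<phi>': "primitive_on \<Omega> (\<lambda>x. complex_of_real (\<phi> x)) (\<lambda>x. complex_of_real (deriv \<phi> x))"
    by (rule primitive_on_C1)
       (auto intro!: continuous_intros continuous_on_subset[OF t(3)] has_vector_derivative_of_real
         t(1))
  note pr = primitive_on_mult[OF \<phi>' F]
  let ?h = "\<lambda>x. complex_of_real (deriv \<phi> x) * F x + complex_of_real (\<phi> x) * f x"
  have "(?h has_integral 0) {s1..t1}" "(?h has_integral 0) {s2..t2}"
    using primitive_onD(2)[OF pr st(1,4)] primitive_onD(2)[OF pr st(3,5)] ends by simp_all
  moreover have "negligible ({s1..t1} \<inter> {s2..t2})"
    by (rule negligible_subset[of "{t1}"]) (use st in auto)
  ultimately have "(?h has_integral 0 + 0) J" unfolding J_def by (rule has_integral_Un)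
  then have "integral J ?h = 0" by (simp add: integral_unique)
  moreover have "integral J (\<lambda>x. deriv \<phi> x *\<^sub>R F x + \<phi> x *\<^sub>R f x) =
      integral J (\<lambda>x. deriv \<phi> x *\<^sub>R F x) + integral J (\<lambda>x. \<phi> x *\<^sub>R f x)"
    using set_lebesgue_integral_eq_integral(1)[OF test_integral(1)[OF loc(1) J(1,2) t(3) vanish(2)]]
      set_lebesgue_integral_eq_integral(1)[OF test_integral(1)[OF loc(2) J(1,2) t(2) vanish(1)]]
    by (rule Henstock_Kurzweil_Integration.integral_add)
  ultimately have "integral J (\<lambda>x. deriv \<phi> x *\<^sub>R F x) + integral J (\<lambda>x. \<phi> x *\<^sub>R f x) = 0"
    by (simp add: scaleR_conv_of_real)
  then show "(LINT x:\<Omega>|lebesgue. deriv \<phi> x *\<^sub>R F x) = - (LINT x:\<Omega>|lebesgue. \<phi> x *\<^sub>R f x)"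
    using test_integral(3)[OF loc(1) J(1,2) t(3) vanish(2)] test_integral(3)[OF loc(2) J(1,2) t(2) vanish(1)]
    by (simp add: eq_neg_iff_add_eq_0)
qed

lemma test_function_on_mono: "test_function_on I \<phi> \<Longrightarrow> I \<subseteq> \<Omega> \<Longrightarrow> test_function_on \<Omega> \<phi>"
  unfolding test_function_on_def by blast

lemma locally_integrable_on_subset: "locally_integrable_on h \<Omega> \<Longrightarrow> I \<subseteq> \<Omega> \<Longrightarrow> locally_integrable_on h I"
  unfolding locally_integrable_on_def by blast

text \<open>
  A continuous function whose increments over intervals of equal length agree is affine: after
  subtracting the chord, doubling the distance to the nearer end point doubles the value at a
  maximum of the modulus.
\<close>

lemma equal_increments_affine:
  fixes G :: "real \<Rightarrow> complex"
  assumes pq: "p < q" and cont: "continuous_on {p..q} G"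
    and inc: "\<And>a c L. p \<le> a \<Longrightarrow> a \<le> c \<Longrightarrow> 0 \<le> L \<Longrightarrow> c + L \<le> q \<Longrightarrow> G (a + L) - G a = G (c + L) - G c"
    and x: "x \<in> {p..q}"
  shows "G x = G p + of_real (x - p) * ((G q - G p) / of_real (q - p))"
proof -
  define k where "k = (G q - G p) / of_real (q - p)"
  define H where "H x = G x - G p - of_real (x - p) * k" for x
  have Hp: "H p = 0" by (simp add: H_def)
  have Hq: "H q = 0" using pq by (simp add: H_def k_def)
  have incH: "H (a + L) - H a = H (c + L) - H c" if "p \<le> a" "a \<le> c" "0 \<le> L" "c + L \<le> q" for a c L
    using inc[OF that] by (simp add: H_def algebra_simps)
  have "continuous_on {p..q} (\<lambda>x. norm (H x))"
    unfolding H_def by (intro continuous_intros cont)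
  then obtain m where m: "m \<in> {p..q}" "\<And>y. y \<in> {p..q} \<Longrightarrow> norm (H y) \<le> norm (H m)"
    using continuous_attains_sup[of "{p..q}" "\<lambda>x. norm (H x)"] pq by auto
  have "norm (H m) \<le> 0"
  proof (cases "m - p \<le> q - m")
    case True
    have "H (p + (m - p)) - H p = H (m + (m - p)) - H m"
      using True m(1) by (intro incH) auto
    then have "H (m + (m - p)) = 2 * H m" by (simp add: Hp)
    moreover have "norm (H (m + (m - p))) \<le> norm (H m)" using True m(1) by (intro m(2)) auto
    ultimately show ?thesis by (simp add: norm_mult)
  next
    case False
    have "H ((2 * m - q) + (q - m)) - H (2 * m - q) = H (m + (q - m)) - H m"
      using False m(1) by (intro incH) auto
    then have "H (2 * m - q) = 2 * H m" by (simp add: Hq algebra_simps)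
    moreover have "norm (H (2 * m - q)) \<le> norm (H m)" using False m(1) by (intro m(2)) auto
    ultimately show ?thesis by (simp add: norm_mult)
  qed
  then have "H x = 0" using m(2)[OF x] by simp
  then show ?thesis by (simp add: H_def k_def algebra_simps)
qed

text \<open>
  Since all integrals over subintervals vanish, Henstock's lemma says that the Riemann sums
  of \<open>|g|\<close> tend to zero.
\<close>

lemma zero_integrals_imp_negligible:
  fixes g :: "real \<Rightarrow> complex"
  assumes g: "g absolutely_integrable_on {a..b}"
    and zero: "\<And>s t. s \<le> t \<Longrightarrow> {s..t} \<subseteq> {a..b} \<Longrightarrow> integral {s..t} g = 0"
  shows "negligible {x \<in> {a..b}. g x \<noteq> 0}"
proof -
  have gi: "g integrable_on cbox a b" using g by (simp add: absolutely_integrable_on_def)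
  have "((\<lambda>x. norm (g x)) has_integral 0) (cbox a b)"
    unfolding has_integral
  proof (intro allI impI)
    fix e :: real assume "e > 0"
    obtain \<gamma> where \<gamma>: "gauge \<gamma>"
      "\<And>p. p tagged_partial_division_of cbox a b \<Longrightarrow> \<gamma> fine p \<Longrightarrow>
         (\<Sum>(x,k)\<in>p. norm (measure lborel k *\<^sub>R g x - integral k g)) < e"
      by (rule Henstock_lemma[OF gi \<open>e > 0\<close>]) blast
    have "norm ((\<Sum>(x,k)\<in>p. measure lborel k *\<^sub>R norm (g x)) - 0) < e"
      if p: "p tagged_division_of cbox a b" "\<gamma> fine p" for p
    proof -
      have "(\<Sum>(x,k)\<in>p. norm (measure lborel k *\<^sub>R g x - integral k g)) = (\<Sum>(x,k)\<in>p. measure lborel k *\<^sub>R norm (g x))"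
      proof (rule sum.cong[OF refl], clarify)
        fix x k assume xk: "(x, k) \<in> p"
        obtain c d where cd: "k = cbox c d" using tagged_division_ofD(4)[OF p(1) xk] by blast
        moreover have "k \<subseteq> cbox a b" "k \<noteq> {}" using tagged_division_ofD(2,3)[OF p(1) xk] by blast+
        ultimately have "integral k g = 0" using zero[of c d] by auto
        then show "norm (measure lborel k *\<^sub>R g x - integral k g) = measure lborel k *\<^sub>R norm (g x)"
          by simp
      qed
      moreover have "0 \<le> (\<Sum>(x,k)\<in>p. norm (measure lborel k *\<^sub>R g x - integral k g))"
        by (rule sum_nonneg) auto
      ultimately show ?thesis
        using \<gamma>(2)[OF _ p(2)] p(1) unfolding tagged_division_of_def by auto
    qed
    then show "\<exists>\<gamma>. gauge \<gamma> \<and> (\<forall>p. p tagged_division_of cbox a b \<and> \<gamma> fine p \<longrightarrow>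
        norm ((\<Sum>(x,k)\<in>p. measure lborel k *\<^sub>R norm (g x)) - 0) < e)"
      using \<gamma>(1) by blast
  qed
  then have "integral {a..b} (\<lambda>x. norm (g x)) = 0" by (simp add: integral_unique)
  moreover have ni: "(\<lambda>x. norm (g x)) absolutely_integrable_on {a..b}"
    using g by (rule absolutely_integrable_norm[unfolded o_def])
  ultimately have "(LINT x|lebesgue. indicator {a..b} x *\<^sub>R norm (g x)) = 0"
    using set_lebesgue_integral_eq_integral(2)[OF ni] by (simp add: set_lebesgue_integral_def)
  moreover have "integrable lebesgue (\<lambda>x. indicator {a..b} x *\<^sub>R norm (g x))"
    using ni by (simp add: set_integrable_def)
  ultimately have "AE x in lebesgue. indicator {a..b} x *\<^sub>R norm (g x) = 0"
    by (subst (asm) integral_nonneg_eq_0_iff_AE) auto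
  then obtain N where "N \<in> null_sets lebesgue" "{x. indicator {a..b} x *\<^sub>R norm (g x) \<noteq> 0} \<subseteq> N"
    unfolding eventually_ae_filter by auto
  moreover have "{x \<in> {a..b}. g x \<noteq> 0} \<subseteq> {x. indicator {a..b} x *\<^sub>R norm (g x) \<noteq> 0}" by auto
  ultimately show ?thesis
    unfolding negligible_iff_null_sets[symmetric] by (meson negligible_subset order_trans)
qed

text \<open>
  The shrinking steps converge boundedly to the indicator function of \<open>x > e\<close>.
\<close>

lemma scaled_step_integral_tendsto:
  fixes g :: "real \<Rightarrow> complex" and S :: "real \<Rightarrow> real"
  assumes G: "primitive_on {A..B} G g" and e: "e \<in> {A..B}" and \<delta>: "\<delta> > 0"
    and S: "continuous_on UNIV S" "\<And>x. x \<le> 0 \<Longrightarrow> S x = 0" "\<And>x. x \<ge> 1 \<Longrightarrow> S x = 1" "\<And>x. \<bar>S x\<bar> \<le> 1"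
  shows "(\<lambda>n. integral {A..B} (\<lambda>x. S ((x - e) / (\<delta> / real (Suc n))) *\<^sub>R g x)) \<longlonglongrightarrow> G B - G e"
proof -
  have AB: "A \<le> B" using e by simp
  note g = primitive_onD(1)[OF G AB order_refl]
  define f where "f n x = S ((x - e) / (\<delta> / real (Suc n))) *\<^sub>R g x" for n x
  define f0 where "f0 x = (if x \<in> {e<..B} then g x else 0)" for x
  have fint: "f n integrable_on {A..B}" for n
  proof -
    have c: "continuous_on {A..B} (\<lambda>x. S ((x - e) / (\<delta> / real (Suc n))))"
      by (rule continuous_on_compose2[OF S(1)]) (use \<delta> in \<open>auto intro!: continuous_intros\<close>)
    have "(\<lambda>x. complex_of_real (S ((x - e) / (\<delta> / real (Suc n)))) * g x) absolutely_integrable_on {A..B}"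
      by (rule absolutely_integrable_mult_continuous(2)[OF g continuous_on_of_real[OF c]])
    then show ?thesis unfolding f_def scaleR_conv_of_real by (rule set_lebesgue_integral_eq_integral(1))
  qed
  have "(\<lambda>n. integral {A..B} (f n)) \<longlonglongrightarrow> integral {A..B} f0"
  proof (rule dominated_convergence(2)[OF fint])
    show "(\<lambda>x. norm (g x)) integrable_on {A..B}" using g by (simp add: absolutely_integrable_on_def)
    show "norm (f n x) \<le> norm (g x)" for n x
      using mult_right_mono[OF S(4) norm_ge_zero[of "g x"]] by (simp add: f_def)
    fix x assume x: "x \<in> {A..B}"
    show "(\<lambda>n. f n x) \<longlonglongrightarrow> f0 x"
    proof (cases "x \<le> e")
      case True
      have "(x - e) / (\<delta> / real (Suc n)) \<le> 0" for n
        by (rule divide_nonpos_nonneg) (use True \<delta> in auto)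
      then have "f n x = 0" for n unfolding f_def by (simp only: S(2) scaleR_zero_left)
      then show ?thesis using True by (simp add: f0_def)
    next
      case False
      obtain N where N: "real N > \<delta> / (x - e)" using reals_Archimedean2 by blast
      have "f n x = g x" if "n \<ge> N" for n
      proof -
        have "\<delta> / (x - e) \<le> real (Suc n)" using N that by simp
        then have "1 \<le> (x - e) / (\<delta> / real (Suc n))"
          using False \<delta> by (simp add: field_simps)
        then show ?thesis by (simp add: f_def S(3))
      qed
      then have "\<forall>\<^sub>F n in sequentially. f n x = g x" by (auto simp: eventually_sequentially)
      moreover have "f0 x = g x" using False x by (simp add: f0_def)
      ultimately show ?thesis by (simp add: tendsto_eventually)
    qed
  qed
  moreover have "integral {A..B} f0 = G B - G e"
  proof -
    have "(g has_integral G B - G e) {e..B}" using e by (intro primitive_onD(2)[OF G]) auto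
    then have "((\<lambda>x. if x \<in> {e..B} then g x else 0) has_integral G B - G e) {A..B}"
      using e by (subst has_integral_restrict) auto
    then have "(f0 has_integral G B - G e) {A..B}"
      by (rule has_integral_spike_finite[of "{e}", rotated 2]) (auto simp: f0_def)
    then show ?thesis by (rule integral_unique)
  qed
  ultimately show ?thesis unfolding f_def by simp
qed

text \<open>
  Smoothed indicator functions of \<open>[a, a + L]\<close> and \<open>[c, c + L]\<close> have the same integral. Therefore the
  primitive of their difference is a test function, and the integrals of \<open>g\<close> over the two intervals
  agree in the limit.
\<close>

lemma weak_deriv_zero_imp_equal_increments:
  fixes g G :: "real \<Rightarrow> complex"
  assumes I: "open I" "is_interval I" and G: "primitive_on I G g" and g: "locally_integrable_on g I"
    and weak: "\<And>\<phi>. test_function_on I \<phi> \<Longrightarrow> (LINT x:I|lebesgue. deriv \<phi> x *\<^sub>R g x) = 0"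
    and ac: "a \<in> I" "a \<le> c" "0 \<le> L" "c + L \<in> I"
  shows "G (a + L) - G a = G (c + L) - G c"
proof -
  obtain \<sigma> :: "nat \<Rightarrow> real \<Rightarrow> real" where \<sigma>: "\<And>n x. (\<sigma> n has_real_derivative \<sigma> (Suc n) x) (at x)"
    "\<And>x. x \<le> 0 \<Longrightarrow> \<sigma> 0 x = 0" "\<And>x. x \<ge> 1 \<Longrightarrow> \<sigma> 0 x = x - 1 + \<sigma> 0 1"
    "\<And>x. x \<le> 0 \<Longrightarrow> \<sigma> 1 x = 0" "\<And>x. x \<ge> 1 \<Longrightarrow> \<sigma> 1 x = 1"
    "\<And>x. \<bar>\<sigma> 1 x\<bar> \<le> 1"
    by (rule smooth_step_exists) blast
  obtain e where e: "e > 0" "ball (c + L) e \<subseteq> I" using I(1) ac(4) open_contains_ball by metis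
  define \<delta> where "\<delta> = e / 2"
  have \<delta>: "\<delta> > 0" using e(1) by (simp add: \<delta>_def)
  define B where "B = c + L + \<delta>"
  have "B \<in> I" using e by (auto simp: subset_iff dist_real_def B_def \<delta>_def)
  then have sub: "{a..B} \<subseteq> I" using mem_is_interval_1_I[OF I(2) ac(1)] by auto
  have GB: "primitive_on {a..B} G g" by (rule primitive_on_subset[OF G sub])
  define d where "d n = \<delta> / real (Suc n)" for n
  have d: "d n > 0" "d n \<le> \<delta>" for n using \<delta> by (auto simp: d_def divide_le_eq mult_le_cancel_left1)
  have cont: "continuous_on UNIV (\<sigma> m)" for m
    by (rule continuous_at_imp_continuous_on) (auto intro: DERIV_isCont \<sigma>(1))
  \<comment> \<open>The test function and its derivatives. To the right of \<open>B\<close> the linear parts of the four terms cancel.\<close>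
  define D where "D n m x = d n * ((\<sigma> m ((x - a) / d n) - \<sigma> m ((x - (a + L)) / d n)
      - \<sigma> m ((x - c) / d n) + \<sigma> m ((x - (c + L)) / d n)) / d n ^ m)" for n m x
  have aff: "((\<lambda>x. \<sigma> m ((x - b) / d n)) has_real_derivative \<sigma> (Suc m) ((x - b) / d n) * (1 / d n)) (at x)" for m b n x
    by (rule DERIV_chain2[OF \<sigma>(1)]) (use d(1)[of n] in \<open>auto intro!: derivative_eq_intros\<close>)
  have DD: "(D n m has_real_derivative D n (Suc m) x) (at x)" for n m x
  proof -
    have "((\<lambda>x. d n * ((\<sigma> m ((x - a) / d n) - \<sigma> m ((x - (a + L)) / d n)
      - \<sigma> m ((x - c) / d n) + \<sigma> m ((x - (c + L)) / d n)) / d n ^ m)) has_real_derivative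
      d n * ((\<sigma> (Suc m) ((x - a) / d n) * (1 / d n) - \<sigma> (Suc m) ((x - (a + L)) / d n) * (1 / d n)
      - \<sigma> (Suc m) ((x - c) / d n) * (1 / d n) + \<sigma> (Suc m) ((x - (c + L)) / d n) * (1 / d n)) / d n ^ m)) (at x)"
      by (intro DERIV_cmult DERIV_cdivide DERIV_add DERIV_diff aff)
    then show ?thesis unfolding D_def by (rule DERIV_cong) (simp add: field_simps)
  qed
  have supp: "D n 0 x = 0" if "x \<notin> {a..B}" for n x
  proof (cases "x < a")
    case True
    then show ?thesis using d(1)[of n] ac by (simp add: D_def \<sigma>(2) divide_nonpos_pos)
  next
    case False
    then have "x \<ge> c + L + d n" using that d(2)[of n] by (simp add: B_def)
    then have "1 \<le> (x - b) / d n" if "b \<le> c + L" for b using that d(1)[of n] by (simp add: le_divide_eq)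
    then have k: "\<sigma> 0 ((x - b) / d n) = (x - b) / d n - 1 + \<sigma> 0 1" if "b \<le> c + L" for b using \<sigma>(3) that by blast
    have "a \<le> c + L" "a + L \<le> c + L" "c \<le> c + L" "c + L \<le> c + L" using ac by auto
    from this[THEN k] show ?thesis
      using d(1)[of n] by (simp only: D_def) (simp add: diff_divide_distrib add_divide_distrib)
  qed
  define J where "J n b = integral {a..B} (\<lambda>x. \<sigma> 1 ((x - b) / d n) *\<^sub>R g x)" for n b
  have zero: "J n a - J n (a + L) - J n c + J n (c + L) = 0" for n
  proof -
    have test: "test_function_on I (D n 0)"
      by (rule test_function_onI[of "D n", OF DD supp sub])
    have der: "deriv (D n 0) = D n 1" using DD[THEN DERIV_imp_deriv] by (auto simp: fun_eq_iff)
    have "continuous_on UNIV (D n 1)"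
      by (rule continuous_at_imp_continuous_on) (auto intro: DERIV_isCont DD)
    moreover have D1: "D n 1 x = \<sigma> 1 ((x - a) / d n) - \<sigma> 1 ((x - (a + L)) / d n) - \<sigma> 1 ((x - c) / d n) + \<sigma> 1 ((x - (c + L)) / d n)" for x
      using d(1)[of n] by (simp add: D_def)
    have "D n 1 x = 0" if x: "x \<notin> {a..B}" for x
    proof (cases "x < a")
      case True
      then have k: "\<sigma> 1 ((x - b) / d n) = 0" if "a \<le> b" for b
        by (intro \<sigma>(4) divide_nonpos_pos) (use that d(1)[of n] in auto)
      have "a \<le> a" "a \<le> a + L" "a \<le> c" "a \<le> c + L" using ac by auto
      from this[THEN k] show ?thesis by (simp only: D1; simp)
    next
      case False
      then have "x \<ge> c + L + d n" using x d(2)[of n] by (simp add: B_def)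
      then have "1 \<le> (x - b) / d n" if "b \<le> c + L" for b using that d(1)[of n] by (simp add: le_divide_eq)
      then have k: "\<sigma> 1 ((x - b) / d n) = 1" if "b \<le> c + L" for b using \<sigma>(5) that by blast
      have "a \<le> c + L" "a + L \<le> c + L" "c \<le> c + L" "c + L \<le> c + L" using ac by auto
      from this[THEN k] show ?thesis by (simp only: D1; simp)
    qed
    ultimately have "integral {a..B} (\<lambda>x. D n 1 x *\<^sub>R g x) = (LINT x:I|lebesgue. D n 1 x *\<^sub>R g x)"
      by (rule test_integral(3)[OF g compact_Icc sub, symmetric])
    also have "\<dots> = 0" using weak[OF test] by (simp only: der)
    finally have z: "integral {a..B} (\<lambda>x. D n 1 x *\<^sub>R g x) = 0" .
    have AB: "a \<le> B" using ac \<delta> by (simp add: B_def)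
    have int: "((\<lambda>x. \<sigma> 1 ((x - b) / d n) *\<^sub>R g x) has_integral J n b) {a..B}" for b
    proof -
      have c: "continuous_on {a..B} (\<lambda>x. \<sigma> 1 ((x - b) / d n))"
        by (rule continuous_on_compose2[OF cont]) (use d(1)[of n] in \<open>auto intro!: continuous_intros\<close>)
      have "(\<lambda>x. complex_of_real (\<sigma> 1 ((x - b) / d n)) * g x) absolutely_integrable_on {a..B}"
        by (rule absolutely_integrable_mult_continuous(2)[OF primitive_onD(1)[OF GB AB order_refl] continuous_on_of_real[OF c]])
      from set_lebesgue_integral_eq_integral(1)[OF this] show ?thesis
        unfolding J_def scaleR_conv_of_real by (rule integrable_integral)
    qed
    have "((\<lambda>x. \<sigma> 1 ((x - a) / d n) *\<^sub>R g x - \<sigma> 1 ((x - (a + L)) / d n) *\<^sub>R g x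
      - \<sigma> 1 ((x - c) / d n) *\<^sub>R g x + \<sigma> 1 ((x - (c + L)) / d n) *\<^sub>R g x) has_integral
       J n a - J n (a + L) - J n c + J n (c + L)) {a..B}"
      by (intro has_integral_add has_integral_diff int)
    then show ?thesis
      using z by (simp only: D1 scaleR_add_left scaleR_diff_left) (simp add: integral_unique)
  qed
  have lim: "(\<lambda>n. J n b) \<longlonglongrightarrow> G B - G b" if "b \<in> {a..B}" for b
    unfolding J_def d_def
    by (rule scaled_step_integral_tendsto[OF GB that \<delta> cont \<sigma>(4-6)])
  have "(\<lambda>n. J n a - J n (a + L) - J n c + J n (c + L)) \<longlonglongrightarrow>
      (G B - G a) - (G B - G (a + L)) - (G B - G c) + (G B - G (c + L))"
    by (intro tendsto_intros lim) (use ac \<delta> in \<open>auto simp: B_def\<close>)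
  then have "(G B - G a) - (G B - G (a + L)) - (G B - G c) + (G B - G (c + L)) = 0"
    unfolding zero using LIMSEQ_unique tendsto_const by blast
  then show ?thesis by (simp add: algebra_simps)
qed

text \<open>
  The lemma of du Bois-Reymond. The difference \<open>g\<close> of \<open>f\<close> and a primitive of \<open>f'\<close> has a vanishing weak
  derivative. By the previous lemmas the primitives of \<open>g\<close> are affine, so \<open>g\<close> is constant almost
  everywhere.
\<close>

lemma weak_deriv_on_imp_primitive_on:
  fixes f f' :: "real \<Rightarrow> complex"
  assumes I: "open I" "is_interval I" "p0 \<in> I" "q0 \<in> I" "p0 < q0" and "I \<subseteq> \<Omega>"
    and weak: "weak_deriv_on \<Omega> f f'"
  obtains F where "primitive_on I F f'" "AE x in lebesgue. x \<in> I \<longrightarrow> F x = f x"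
proof -
  have loc: "locally_integrable_on f I" "locally_integrable_on f' I"
    using weak locally_integrable_on_subset[OF _ \<open>I \<subseteq> \<Omega>\<close>] unfolding weak_deriv_on_def by blast+
  have Icc: "h absolutely_integrable_on {s..t}" if "locally_integrable_on h I" "{s..t} \<subseteq> I" for h s t
    using that unfolding locally_integrable_on_def by blast
  have exh: "two_interval_exhaustible I"
    using I by (intro two_interval_exhaustible_interval) auto
  obtain F where F: "primitive_on I F f'"
    by (rule primitive_on_exists[OF I(2,3) Icc[OF loc(2)]]) blast
  define g where "g x = f x - F x" for x
  note locF = primitive_on_locally_integrable(1)[OF exh F]
  have locg: "locally_integrable_on g I"
    unfolding locally_integrable_on_def g_def
    using loc(1) locF unfolding locally_integrable_on_def by (blast intro: set_integral_diff(1))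
  obtain G where G: "primitive_on I G g"
    by (rule primitive_on_exists[OF I(2,3) Icc[OF locg]]) blast
  have "(LINT x:I|lebesgue. deriv \<phi> x *\<^sub>R g x) = 0" if \<phi>: "test_function_on I \<phi>" for \<phi>
  proof -
    note t = test_function_onD[OF \<phi>]
    have K: "compact (closure {x. \<phi> x \<noteq> 0})" "closure {x. \<phi> x \<noteq> 0} \<subseteq> I"
      using \<phi> unfolding test_function_on_def by blast+
    have K': "closure {x. \<phi> x \<noteq> 0} \<subseteq> \<Omega>" using K(2) \<open>I \<subseteq> \<Omega>\<close> by blast
    have loc\<Omega>: "locally_integrable_on f \<Omega>" "locally_integrable_on f' \<Omega>"
      using weak unfolding weak_deriv_on_def by blast+
    have "(LINT x:I|lebesgue. deriv \<phi> x *\<^sub>R f x) = (LINT x:\<Omega>|lebesgue. deriv \<phi> x *\<^sub>R f x)"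
      by (rule trans[OF test_integral(3)[OF loc(1) K t(3,5)] test_integral(3)[OF loc\<Omega>(1) K(1) K' t(3,5), symmetric]])
    also have "\<dots> = - (LINT x:\<Omega>|lebesgue. \<phi> x *\<^sub>R f' x)"
      using weak test_function_on_mono[OF \<phi> \<open>I \<subseteq> \<Omega>\<close>] unfolding weak_deriv_on_def by blast
    also have "\<dots> = - (LINT x:I|lebesgue. \<phi> x *\<^sub>R f' x)"
      by (rule arg_cong[where f = uminus], rule trans[OF test_integral(3)[OF loc\<Omega>(2) K(1) K' t(2,4)] test_integral(3)[OF loc(2) K t(2,4), symmetric]])
    also have "\<dots> = (LINT x:I|lebesgue. deriv \<phi> x *\<^sub>R F x)"
      using primitive_on_imp_weak_deriv_on[OF exh F] \<phi> unfolding weak_deriv_on_def by auto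
    finally have "(LINT x:I|lebesgue. deriv \<phi> x *\<^sub>R f x) - (LINT x:I|lebesgue. deriv \<phi> x *\<^sub>R F x) = 0" by simp
    moreover have "(LINT x:I|lebesgue. deriv \<phi> x *\<^sub>R f x - deriv \<phi> x *\<^sub>R F x) =
        (LINT x:I|lebesgue. deriv \<phi> x *\<^sub>R f x) - (LINT x:I|lebesgue. deriv \<phi> x *\<^sub>R F x)"
      by (rule set_integral_diff(2)[OF test_integral(2)[OF loc(1) K t(3,5)] test_integral(2)[OF locF K t(3,5)]])
    ultimately show ?thesis by (simp only: g_def scaleR_diff_right)
  qed
  note inc = weak_deriv_zero_imp_equal_increments[OF I(1,2) G locg this]
  define k where "k = (G q0 - G p0) / complex_of_real (q0 - p0)"
  have affine: "G t - G s = of_real (t - s) * k" if st: "s \<le> t" "{s..t} \<subseteq> I" for s t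
  proof -
    \<comment> \<open>The interval contains the reference points \<open>p0\<close> and \<open>q0\<close>, which makes its slope equal to \<open>k\<close>.\<close>
    define p q where "p = min s p0" and "q = max t q0"
    have m: "p \<in> I" "q \<in> I" using st I(3,4) by (auto simp: p_def q_def min_def max_def)
    have sub: "{p..q} \<subseteq> I" using mem_is_interval_1_I[OF I(2) m] by auto
    have pq: "p < q" using I(5) by (auto simp: p_def q_def)
    define l where "l = (G q - G p) / complex_of_real (q - p)"
    have *: "G x = G p + of_real (x - p) * l" if "x \<in> {p..q}" for x
      unfolding l_def
    proof (rule equal_increments_affine[OF pq primitive_on_continuous_Icc[OF G sub] _ that])
      fix a c L assume "p \<le> a" "a \<le> c" "0 \<le> L" "c + L \<le> q"
      then show "G (a + L) - G a = G (c + L) - G c"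
        using sub by (intro inc) (auto simp: subset_iff)
    qed
    have in_pq: "s \<in> {p..q}" "t \<in> {p..q}" "p0 \<in> {p..q}" "q0 \<in> {p..q}"
      using st(1) I(5) by (auto simp: p_def q_def)
    have "G q0 - G p0 = of_real (q0 - p0) * l"
      unfolding *[OF in_pq(3)] *[OF in_pq(4)] by (simp add: algebra_simps)
    then have "k = l" using I(5) by (simp add: k_def del: of_real_diff)
    then show ?thesis unfolding *[OF in_pq(1)] *[OF in_pq(2)] by (simp add: algebra_simps)
  qed
  have neg: "negligible {x \<in> {s..t}. g x - k \<noteq> 0}" if sub: "{s..t} \<subseteq> I" for s t
  proof (rule zero_integrals_imp_negligible)
    show "(\<lambda>x. g x - k) absolutely_integrable_on {s..t}"
      by (rule set_integral_diff(1)[OF Icc[OF locg sub] absolutely_integrable_continuous_real[OF continuous_on_const]])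
    fix a b assume ab: "a \<le> b" "{a..b} \<subseteq> {s..t}"
    then have abI: "{a..b} \<subseteq> I" using sub by blast
    have "((\<lambda>x. g x - k) has_integral (G b - G a) - (b - a) *\<^sub>R k) {a..b}"
      by (rule has_integral_diff[OF primitive_onD(2)[OF G ab(1) abI] has_integral_const_real[of k a b, unfolded content_real[OF ab(1)]]])
    then show "integral {a..b} (\<lambda>x. g x - k) = 0"
      using affine[OF ab(1) abI] by (simp add: integral_unique scaleR_conv_of_real)
  qed
  define N where "N = {x \<in> I. g x - k \<noteq> 0}"
  have "negligible N"
    unfolding locally_negligible_alt[of N]
  proof
    fix x assume "x \<in> N"
    then have "x \<in> I" by (simp add: N_def)
    then obtain e where e: "e > 0" "cball x e \<subseteq> I" using I(1) open_contains_cball by blast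
    have cb: "cball x e = {x-e..x+e}" by (auto simp: dist_real_def)
    have "negligible (N \<inter> ball x e)"
      by (rule negligible_subset[OF neg[of "x-e" "x+e"]])
         (use e(2) in \<open>auto simp: cb N_def dist_real_def\<close>)
    moreover have "openin (top_of_set N) (N \<inter> ball x e)" by (simp add: openin_open_Int)
    ultimately show "\<exists>U. openin (top_of_set N) U \<and> x \<in> U \<and> negligible U"
      using \<open>x \<in> N\<close> e(1) by (intro exI[of _ "N \<inter> ball x e"]) simp
  qed
  then have "AE x in lebesgue. x \<notin> N"
    unfolding negligible_iff_null_sets by (rule AE_not_in)
  then have "AE x in lebesgue. x \<in> I \<longrightarrow> F x + k = f x"
    by (rule eventually_mono) (auto simp: N_def g_def algebra_simps)
  moreover have "primitive_on I (\<lambda>x. F x + k) f'"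
    using F unfolding primitive_on_def by simp
  ultimately show ?thesis using that by blast
qed

lemma AE_eq_continuous_imp_eq:
  fixes f g :: "real \<Rightarrow> complex"
  assumes I: "open I" and f: "continuous_on I f" and g: "continuous_on I g"
    and ae: "AE x in lebesgue. x \<in> I \<longrightarrow> f x = g x" and x: "x \<in> I"
  shows "f x = g x"
proof (rule ccontr)
  assume "f x \<noteq> g x"
  have op: "open {y \<in> I. f y - g y \<in> - {0}}"
    using continuous_open_preimage[OF continuous_on_diff[OF f g] I open_Compl[OF closed_singleton[of 0]]]
    by (simp add: vimage_def Int_def)
  obtain N where N: "N \<in> null_sets lebesgue" "{y. \<not> (y \<in> I \<longrightarrow> f y = g y)} \<subseteq> N"
    using ae unfolding eventually_ae_filter by auto
  have "{y \<in> I. f y - g y \<in> - {0}} \<subseteq> N" using N(2) by auto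
  then have "negligible {y \<in> I. f y - g y \<in> - {0}}"
    using N(1) negligible_iff_null_sets negligible_subset by blast
  then have "{y \<in> I. f y - g y \<in> - {0}} = {}" using op open_not_negligible by blast
  then show False using x \<open>f x \<noteq> g x\<close> by auto
qed

lemma weak_deriv_on_imp_primitive_on_continuous:
  fixes f f' :: "real \<Rightarrow> complex"
  assumes I: "open I" "is_interval I" "p0 \<in> I" "q0 \<in> I" "p0 < q0" and "I \<subseteq> \<Omega>"
    and weak: "weak_deriv_on \<Omega> f f'" and f: "continuous_on I f"
  shows "primitive_on I f f'"
proof -
  obtain F where F: "primitive_on I F f'" "AE x in lebesgue. x \<in> I \<longrightarrow> F x = f x"
    by (rule weak_deriv_on_imp_primitive_on[OF assms(1-7)])
  have "f x = F x" if "x \<in> I" for x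
    using AE_eq_continuous_imp_eq[OF I(1) primitive_on_continuous_open[OF F(1) I(1)] f F(2) that] by simp
  then show ?thesis by (intro primitive_on_cong[OF F(1)]) auto
qed

section \<open>Square integrable functions\<close>

abbreviation L2 :: "(real \<Rightarrow> complex) \<Rightarrow> bool" where
  "L2 f \<equiv> sq_integrable_on f UNIV"

text \<open>
  Estimates refer to functions rather than to their classes, because one-sided values and derivatives
  enter.
\<close>

definition l2norm :: "(real \<Rightarrow> complex) \<Rightarrow> real" where
  "l2norm f = sqrt (LINT x|lebesgue. (cmod (f x))\<^sup>2)"

lemma norm_abs_l2_eq: "L2 f \<Longrightarrow> norm (abs_l2 f) = l2norm f"
  by (simp add: norm_abs_l2 l2norm_def)

lemma l2norm_nonneg: "l2norm f \<ge> 0"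
  by (simp add: l2norm_def integral_nonneg_AE)

lemma l2norm_square: "(l2norm f)\<^sup>2 = (LINT x|lebesgue. (cmod (f x))\<^sup>2)"
  by (simp add: l2norm_def integral_nonneg_AE)

lemma L2D:
  assumes "L2 f"
  shows "f \<in> borel_measurable lebesgue" "integrable lebesgue (\<lambda>x. (cmod (f x))\<^sup>2)"
  using assms by (simp_all add: sq_integrable_on_UNIV)

lemma sq_integrable_AE:
  assumes f: "L2 f" and ae: "AE x in lebesgue. f x = g x"
  shows "L2 g"
  unfolding sq_integrable_on_UNIV
proof
  show g: "g \<in> borel_measurable lebesgue" by (rule borel_measurable_AE[OF L2D(1)[OF f] ae])
  show "integrable lebesgue (\<lambda>x. (cmod (g x))\<^sup>2)"
  proof (rule integrable_cong_AE_imp[OF L2D(2)[OF f]])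
    show "(\<lambda>x. (cmod (g x))\<^sup>2) \<in> borel_measurable lebesgue" using g by measurable
    show "AE x in lebesgue. (cmod (f x))\<^sup>2 = (cmod (g x))\<^sup>2" using ae by eventually_elim simp
  qed
qed

lemma l2norm_cong_AE:
  assumes "L2 f" "AE x in lebesgue. f x = g x"
  shows "l2norm f = l2norm g"
proof -
  have "(LINT x|lebesgue. (cmod (f x))\<^sup>2) = (LINT x|lebesgue. (cmod (g x))\<^sup>2)"
  proof (rule integral_cong_AE)
    show "AE x in lebesgue. (cmod (f x))\<^sup>2 = (cmod (g x))\<^sup>2" using assms(2) by eventually_elim simp
  qed (use L2D(2)[OF assms(1)] L2D(2)[OF sq_integrable_AE[OF assms]] in \<open>auto dest: borel_measurable_integrable\<close>)
  then show ?thesis by (simp add: l2norm_def)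
qed

lemma abs_l2_eqI:
  assumes "L2 f" "AE x in lebesgue. f x = g x"
  shows "abs_l2 f = abs_l2 g"
proof -
  have "l2_rel f g" using assms sq_integrable_AE[OF assms] by (simp add: l2_rel_def)
  then show ?thesis using Quotient3_rel_abs[OF Quotient3_l2] by blast
qed

lemma abs_l2_eqD: "L2 f \<Longrightarrow> L2 g \<Longrightarrow> abs_l2 f = abs_l2 g \<Longrightarrow> AE x in lebesgue. f x = g x"
  using Quotient3_rel[OF Quotient3_l2, of f g] by (auto simp: l2_rel_def)

lemma l2_cases:
  obtains f where "F = abs_l2 f" "L2 f"
proof -
  have "l2_rel (rep_l2 F) (rep_l2 F)" "abs_l2 (rep_l2 F) = F"
    using Quotient3_rep_reflp[OF Quotient3_l2] Quotient3_abs_rep[OF Quotient3_l2] by auto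
  then show ?thesis using that[of "rep_l2 F"] by (simp add: l2_rel_def)
qed

lemma abs_l2_ops:
  assumes "L2 f" "L2 g"
  shows "abs_l2 f + abs_l2 g = abs_l2 (\<lambda>x. f x + g x)"
    and "abs_l2 f - abs_l2 g = abs_l2 (\<lambda>x. f x - g x)"
    and "scaleC_l2 c (abs_l2 f) = abs_l2 (\<lambda>x. c * f x)"
    and "r *\<^sub>R abs_l2 f = abs_l2 (\<lambda>x. r *\<^sub>R f x)"
proof -
  have r: "l2_rel f f" "l2_rel g g" "l2_rel (\<lambda>x. - g x) (\<lambda>x. - g x)"
    using assms sq_integrable_uminus[OF assms(2)] by (simp_all add: l2_rel_def)
  show "abs_l2 f + abs_l2 g = abs_l2 (\<lambda>x. f x + g x)" by (simp add: plus_l2.abs_eq r)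
  show "abs_l2 f - abs_l2 g = abs_l2 (\<lambda>x. f x - g x)"
    by (simp add: minus_l2_def plus_l2.abs_eq uminus_l2.abs_eq r)
  show "scaleC_l2 c (abs_l2 f) = abs_l2 (\<lambda>x. c * f x)" by (simp add: scaleC_l2.abs_eq r)
  show "r *\<^sub>R abs_l2 f = abs_l2 (\<lambda>x. r *\<^sub>R f x)" by (simp add: scaleR_l2.abs_eq r)
qed

lemma sq_integrable_diff: "L2 f \<Longrightarrow> L2 g \<Longrightarrow> L2 (\<lambda>x. f x - g x)"
  using sq_integrable_add[OF _ sq_integrable_uminus] by fastforce

lemma l2norm_add: "L2 f \<Longrightarrow> L2 g \<Longrightarrow> l2norm (\<lambda>x. f x + g x) \<le> l2norm f + l2norm g"
  using norm_triangle_ineq[of "abs_l2 f" "abs_l2 g"]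
  by (simp add: abs_l2_ops norm_abs_l2_eq sq_integrable_add)

lemma l2norm_diff: "L2 f \<Longrightarrow> L2 g \<Longrightarrow> l2norm (\<lambda>x. f x - g x) \<le> l2norm f + l2norm g"
  using norm_triangle_ineq4[of "abs_l2 f" "abs_l2 g"]
  by (simp add: abs_l2_ops norm_abs_l2_eq sq_integrable_diff)

lemma l2norm_cmult: "l2norm (\<lambda>x. c * f x) = cmod c * l2norm f"
  by (simp add: l2norm_def norm_mult power_mult_distrib real_sqrt_mult)

lemma l2norm_mono:
  assumes g: "L2 g" and f: "f \<in> borel_measurable lebesgue" and le: "\<And>x. cmod (f x) \<le> cmod (g x)"
  shows "L2 f" "l2norm f \<le> l2norm g"
proof -
  have le2: "(cmod (f x))\<^sup>2 \<le> (cmod (g x))\<^sup>2" for x using le by (simp add: power_mono)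
  have i: "integrable lebesgue (\<lambda>x. (cmod (f x))\<^sup>2)"
    by (rule Bochner_Integration.integrable_bound[OF L2D(2)[OF g]]) (use f le2 in auto)
  then show "L2 f" using f by (simp add: sq_integrable_on_UNIV)
  show "l2norm f \<le> l2norm g"
    unfolding l2norm_def by (rule real_sqrt_le_mono, rule integral_mono[OF i L2D(2)[OF g] le2])
qed

text \<open>
  The Cauchy-Schwarz inequality of the inner product space, applied to \<open>|f|\<close> and \<open>|g|\<close>: the real
  part of the inner product is then the integral of \<open>|f g|\<close>.
\<close>

lemma L2_mult_integrable:
  assumes "L2 f" "L2 g"
  shows "integrable lebesgue (\<lambda>x. f x * g x)"
    and "(LINT x|lebesgue. cmod (f x * g x)) \<le> l2norm f * l2norm g"
proof -
  define F G where "F x = complex_of_real (cmod (f x))" and "G x = complex_of_real (cmod (g x))" for x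
  have m: "(\<lambda>x. complex_of_real (cmod (f x))) \<in> borel_measurable lebesgue"
    if "f \<in> borel_measurable lebesgue" for f using that by measurable
  have FG: "L2 F" "L2 G" "l2norm F = l2norm f" "l2norm G = l2norm g"
    unfolding F_def G_def l2norm_def sq_integrable_on_UNIV
    using m[OF L2D(1)[OF assms(1)]] m[OF L2D(1)[OF assms(2)]] L2D(2)[OF assms(1)] L2D(2)[OF assms(2)] by simp_all
  have eq: "F x \<bullet> G x = cmod (f x * g x)" for x by (simp add: F_def G_def norm_mult inner_complex_def)
  have int: "integrable lebesgue (\<lambda>x. cmod (f x * g x))"
    using sq_integrable_inner[OF FG(1,2)] unfolding eq .
  have meas: "(\<lambda>x. f x * g x) \<in> borel_measurable lebesgue"
    using L2D(1)[OF assms(1)] L2D(1)[OF assms(2)] by measurable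
  show "integrable lebesgue (\<lambda>x. f x * g x)"
    using int meas by (simp add: integrable_norm_iff)
  have r: "l2_rel F F" "l2_rel G G" using FG by (simp_all add: l2_rel_def)
  have "abs_l2 F \<bullet> abs_l2 G \<le> norm (abs_l2 F) * norm (abs_l2 G)" by (rule norm_cauchy_schwarz)
  then show "(LINT x|lebesgue. cmod (f x * g x)) \<le> l2norm f * l2norm g"
    by (simp add: inner_l2.abs_eq r eq norm_abs_l2_eq FG)
qed

lemma L2_indicator_bounded:
  fixes g :: "real \<Rightarrow> complex"
  assumes S: "S \<in> lmeasurable" and g: "g \<in> borel_measurable (lebesgue_on S)" and C: "C \<ge> 0" "\<And>x. x \<in> S \<Longrightarrow> cmod (g x) \<le> C"
  shows "L2 (\<lambda>x. if x \<in> S then g x else 0)"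
    and "l2norm (\<lambda>x. if x \<in> S then g x else 0) \<le> C * sqrt (measure lebesgue S)"
proof -
  have Sl: "S \<in> sets lebesgue" using S by auto
  have m: "(\<lambda>x. if x \<in> S then g x else 0) \<in> borel_measurable lebesgue"
    using g by (simp add: borel_measurable_if[OF Sl])
  define c where "c x = complex_of_real (C * indicator S x)" for x
  have i: "integrable lebesgue (\<lambda>x. indicator S x :: real)"
    by (rule integrable_real_indicator[OF Sl]) (use fmeasurableD2[OF S] in \<open>simp add: top.not_eq_extremum\<close>)
  have c2: "(cmod (c x))\<^sup>2 = C\<^sup>2 * indicator S x" for x by (simp add: c_def indicator_def)
  have c: "L2 c"
    unfolding sq_integrable_on_UNIV c2 using i Sl by (auto simp: c_def[abs_def])
  have le: "cmod (if x \<in> S then g x else 0) \<le> cmod (c x)" for x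
    using C(2)[of x] by (auto simp: c_def abs_of_nonneg C(1))
  show "L2 (\<lambda>x. if x \<in> S then g x else 0)" by (rule l2norm_mono(1)[OF c m le])
  have "l2norm c = C * sqrt (measure lebesgue S)"
    unfolding l2norm_def c2 using Sl C(1) by (simp add: real_sqrt_mult)
  then show "l2norm (\<lambda>x. if x \<in> S then g x else 0) \<le> C * sqrt (measure lebesgue S)"
    using l2norm_mono(2)[OF c m le] by simp
qed

text \<open>
  The factor \<open>sqrt (b - a)\<close> is the source of the rate \<open>\<surd>\<epsilon>\<close> in the final estimate.
\<close>

lemma L2_local_integral:
  fixes f g :: "real \<Rightarrow> complex"
  assumes f: "L2 f" and g: "continuous_on {a..b} g" and C: "C \<ge> 0" "\<And>x. x \<in> {a..b} \<Longrightarrow> cmod (g x) \<le> C" and ab: "a \<le> b"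
  shows "(\<lambda>x. g x * f x) absolutely_integrable_on {a..b}"
    and "cmod (integral {a..b} (\<lambda>x. g x * f x)) \<le> C * sqrt (b - a) * l2norm f"
proof -
  define G where "G x = (if x \<in> {a..b} then g x else 0)" for x
  have gm: "g \<in> borel_measurable (lebesgue_on {a..b})"
    by (rule continuous_imp_measurable_on_sets_lebesgue[OF g]) simp
  have G: "L2 G" "l2norm G \<le> C * sqrt (b - a)"
    using L2_indicator_bounded[OF _ gm C] ab unfolding G_def[abs_def] by simp_all
  note p = L2_mult_integrable[OF G(1) f]
  have eq: "G x * f x = indicator {a..b} x *\<^sub>R (g x * f x)" for x by (simp add: G_def indicator_def)
  show 1: "(\<lambda>x. g x * f x) absolutely_integrable_on {a..b}"
    using p(1) unfolding eq set_integrable_def .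
  have "integral {a..b} (\<lambda>x. g x * f x) = (LINT x|lebesgue. G x * f x)"
    unfolding eq using set_lebesgue_integral_eq_integral(2)[OF 1] by (simp add: set_lebesgue_integral_def)
  also have "cmod \<dots> \<le> (LINT x|lebesgue. cmod (G x * f x))" by (rule integral_norm_bound)
  also have "\<dots> \<le> l2norm G * l2norm f" by (rule p(2))
  also have "\<dots> \<le> C * sqrt (b - a) * l2norm f"
    by (rule mult_right_mono[OF G(2) l2norm_nonneg])
  finally show "cmod (integral {a..b} (\<lambda>x. g x * f x)) \<le> C * sqrt (b - a) * l2norm f" .
qed

lemma L2_absolutely_integrable_Icc:
  assumes "L2 f" shows "f absolutely_integrable_on {a..b}"
proof (cases "a \<le> b")
  case True
  have "(\<lambda>x. 1 * f x) absolutely_integrable_on {a..b}"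
    by (rule L2_local_integral(1)[OF assms _ _ _ True, of "\<lambda>x. 1" 1]) auto
  then show ?thesis by simp
qed simp

lemma L2_integral_bound:
  assumes "L2 f" "a \<le> b"
  shows "cmod (integral {a..b} f) \<le> sqrt (b - a) * l2norm f"
  using L2_local_integral(2)[OF assms(1) _ _ _ assms(2), of "\<lambda>x. 1" 1] by simp

lemma L2_reflect:
  assumes f: "L2 f"
  shows "L2 (\<lambda>x. f (- x))"
proof -
  have "f \<circ> (\<lambda>x. (-1) *\<^sub>R x) \<in> borel_measurable lebesgue"
    by (rule measurable_comp[OF lebesgue_measurable_scaling L2D(1)[OF f]])
  then have m: "(\<lambda>x. f (- x)) \<in> borel_measurable lebesgue" by (simp add: o_def)
  have "(\<lambda>x. (cmod (f (- x)))\<^sup>2) absolutely_integrable_on UNIV"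
    using has_absolute_integral_reflect_real[of UNIV UNIV "\<lambda>x. (cmod (f x))\<^sup>2"] L2D(2)[OF f]
    by (auto simp: set_integrable_def)
  then show ?thesis using m by (simp add: sq_integrable_on_UNIV set_integrable_def)
qed

lemma L2_punctured: "sq_integrable_on f (- {0}) \<longleftrightarrow> L2 f"
proof -
  have "{0::real} \<in> null_sets lebesgue" by (simp flip: negligible_iff_null_sets)
  from AE_not_in[OF this] have N: "AE x in lebesgue. x \<noteq> (0::real)" by simp
  define g where "g x = (if x \<in> - {0} then f x else 0)" for x :: real
  have ae: "AE x in lebesgue. g x = f x" "AE x in lebesgue. f x = g x"
    by (rule eventually_mono[OF N]; simp add: g_def)+
  have eq: "indicator (- {0}) x *\<^sub>R f x = g x" "indicator (- {0}) x *\<^sub>R (cmod (f x))\<^sup>2 = (cmod (g x))\<^sup>2" for x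
    by (simp_all add: g_def indicator_def)
  have "sq_integrable_on f (- {0}) \<longleftrightarrow> L2 g"
    unfolding sq_integrable_on_UNIV unfolding sq_integrable_on_def set_borel_measurable_def set_integrable_def eq ..
  then show ?thesis using sq_integrable_AE[OF _ ae(1)] sq_integrable_AE[OF _ ae(2)] by blast
qed

text \<open>Monotone convergence along the intervals \<open>[-n,n]\<close>.\<close>

lemma L2_from_bounded_integrals:
  assumes c: "continuous_on UNIV p"
    and M: "\<And>s t. s \<le> t \<Longrightarrow> integral {s..t} (\<lambda>x. (cmod (p x))\<^sup>2) \<le> M"
  shows "L2 p"
proof -
  define F where "F n x = (if x \<in> {- real n..real n} then (cmod (p x))\<^sup>2 else 0)" for n x
  have ci: "(\<lambda>x. (cmod (p x))\<^sup>2) integrable_on {s..t}" for s t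
    by (intro integrable_continuous_interval continuous_intros continuous_on_subset[OF c]) auto
  have Fi: "F n integrable_on UNIV" and Fv: "integral UNIV (F n) = integral {- real n..real n} (\<lambda>x. (cmod (p x))\<^sup>2)" for n
    unfolding F_def using ci by (simp_all only: integrable_restrict_UNIV integral_restrict_UNIV)
  have "(\<lambda>x. (cmod (p x))\<^sup>2) integrable_on UNIV"
  proof (rule conjunct1[OF monotone_convergence_increasing[of F, OF Fi]])
    show "F n x \<le> F (Suc n) x" for n x
    proof (cases "x \<in> {- real n..real n}")
      case True
      then have "x \<in> {- real (Suc n)..real (Suc n)}" by simp
      then show ?thesis using True unfolding F_def by (simp only: if_True order_refl)
    next
      case False
      then show ?thesis unfolding F_def by (simp only: if_False) simp
    qed
    show "(\<lambda>n. F n x) \<longlonglongrightarrow> (cmod (p x))\<^sup>2" for x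
    proof (rule tendsto_eventually)
      obtain N where N: "real N \<ge> \<bar>x\<bar>" using real_arch_simple by blast
      have "F n x = (cmod (p x))\<^sup>2" if "n \<ge> N" for n
      proof -
        have "real N \<le> real n" using that by simp
        then have "\<bar>x\<bar> \<le> real n" using N by linarith
        then have "x \<in> {- real n..real n}" by (simp add: abs_le_iff)
        then show ?thesis unfolding F_def by (simp only: if_True)
      qed
      then show "\<forall>\<^sub>F n in sequentially. F n x = (cmod (p x))\<^sup>2" by (auto simp: eventually_sequentially)
    qed
    show "bounded (range (\<lambda>n. integral UNIV (F n)))"
    proof (rule boundedI)
      fix y assume "y \<in> range (\<lambda>n. integral UNIV (F n))"
      then obtain n where y: "y = integral {- real n..real n} (\<lambda>x. (cmod (p x))\<^sup>2)" by (auto simp: Fv)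
      moreover have "0 \<le> y" unfolding y by (rule Henstock_Kurzweil_Integration.integral_nonneg[OF ci]) simp
      ultimately show "norm y \<le> M" using M[of "- real n" "real n"] by simp
    qed
  qed
  then have "(\<lambda>x. (cmod (p x))\<^sup>2) absolutely_integrable_on UNIV"
    by (rule nonnegative_absolutely_integrable_1) simp
  moreover have "p \<in> borel_measurable lebesgue"
    using borel_measurable_continuous_onI[OF c] by (intro measurable_completion) simp
  ultimately show ?thesis by (simp add: sq_integrable_on_UNIV set_integrable_def)
qed

text \<open>
  There are no boundary terms at infinity because \<open>h\<close> itself is integrable. Instead of limits of \<open>h\<close>,
  the proof uses the tent functions \<open>max 0 (1 - |x| / n)\<close>: their derivatives \<open>\<plusminus>1/n\<close> contribute
  at most \<open>(\<integral> |h|) / n\<close>.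
\<close>

lemma integral_derivative_zero:
  fixes h h' :: "real \<Rightarrow> complex"
  assumes h: "primitive_on UNIV h h'" and i: "integrable lebesgue h" "integrable lebesgue h'"
  shows "(LINT x|lebesgue. h' x) = 0"
proof -
  define tent where "tent n x = (if x \<in> {- real (Suc n)..real (Suc n)} then 1 - \<bar>x\<bar> / real (Suc n) else 0)" for n x
  have tent_bd: "\<bar>tent n x\<bar> \<le> 1" for n x by (auto simp: tent_def abs_le_iff divide_le_eq)
  have meas: "(\<lambda>x. tent n x *\<^sub>R h' x) \<in> borel_measurable lebesgue" for n
  proof -
    have "tent n \<in> borel_measurable borel" unfolding tent_def[abs_def] by measurable
    then have "tent n \<in> borel_measurable lebesgue" by (intro measurable_completion) simp
    then show ?thesis using borel_measurable_integrable[OF i(2)] by measurable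
  qed
  have "(\<lambda>n. LINT x|lebesgue. tent n x *\<^sub>R h' x) \<longlonglongrightarrow> (LINT x|lebesgue. h' x)"
  proof (rule integral_dominated_convergence[where w = "\<lambda>x. norm (h' x)"])
    show "AE x in lebesgue. (\<lambda>n. tent n x *\<^sub>R h' x) \<longlonglongrightarrow> h' x"
    proof (rule AE_I2)
      fix x :: real
      obtain N where N: "real N \<ge> \<bar>x\<bar>" using real_arch_simple by blast
      have "(\<lambda>n. 1 - \<bar>x\<bar> / real (Suc n)) \<longlonglongrightarrow> 1 - 0"
        by (intro tendsto_diff tendsto_const real_tendsto_divide_at_top[OF tendsto_const]
            filterlim_compose[OF filterlim_real_sequentially filterlim_Suc])
      moreover have "\<forall>\<^sub>F n in sequentially. 1 - \<bar>x\<bar> / real (Suc n) = tent n x"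
        unfolding eventually_sequentially using N by (intro exI[of _ N]) (auto simp: tent_def abs_le_iff)
      ultimately have "(\<lambda>n. tent n x) \<longlonglongrightarrow> 1" by (simp add: filterlim_cong)
      from tendsto_scaleR[OF this tendsto_const[of "h' x"]] show "(\<lambda>n. tent n x *\<^sub>R h' x) \<longlonglongrightarrow> h' x" by simp
    qed
    show "AE x in lebesgue. norm (tent n x *\<^sub>R h' x) \<le> norm (h' x)" for n
      using mult_right_mono[OF tent_bd norm_ge_zero] by (intro AE_I2) simp
  qed (use i(2) meas borel_measurable_integrable[OF i(2)] in auto)
  moreover have "cmod (LINT x|lebesgue. tent n x *\<^sub>R h' x) \<le> (LINT x|lebesgue. cmod (h x)) / real (Suc n)" for n
  proof -
    define m where "m = real (Suc n)"
    have m: "m > 0" by (simp add: m_def)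
    have tm: "tent n x = (if x \<in> {-m..m} then 1 - \<bar>x\<bar> / m else 0)" for x
      unfolding tent_def m_def ..
    have half: "((\<lambda>x. h' x * of_real (1 + c * x) + h x * of_real c) has_integral
         h t * of_real (1 + c * t) - h s * of_real (1 + c * s)) {s..t}" if "s \<le> t" for c s t
    proof -
      have "primitive_on UNIV (\<lambda>x. complex_of_real (1 + c * x)) (\<lambda>x. complex_of_real c)"
        by (rule primitive_on_C1) (auto intro!: derivative_eq_intros has_vector_derivative_of_real)
      from primitive_onD(2)[OF primitive_on_mult[OF h this] that subset_UNIV] show ?thesis .
    qed
    define k where "k x = (if x \<le> 0 then h x * of_real (1/m) else - (h x * of_real (1/m)))" for x
    have "((\<lambda>x. tent n x *\<^sub>R h' x + k x) has_integral h 0) {-m..0}"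
    proof (rule has_integral_eq[rotated])
      show "((\<lambda>x. h' x * of_real (1 + (1/m) * x) + h x * of_real (1/m)) has_integral h 0) {-m..0}"
        using half[of "-m" 0 "1/m"] m by simp
    qed (use m in \<open>auto simp: tm k_def scaleR_conv_of_real\<close>)
    moreover have "((\<lambda>x. tent n x *\<^sub>R h' x + k x) has_integral - h 0) {0..m}"
    proof (rule has_integral_spike_finite[of "{0}", rotated 2])
      show "((\<lambda>x. h' x * of_real (1 + (-1/m) * x) + h x * of_real (-1/m)) has_integral - h 0) {0..m}"
        using half[of 0 m "-1/m"] m by simp
    qed (use m in \<open>auto simp: tm k_def scaleR_conv_of_real\<close>)
    ultimately have "((\<lambda>x. tent n x *\<^sub>R h' x + k x) has_integral h 0 + - h 0) {-m..m}"
      by (intro has_integral_combine[of "-m" 0 m]) (use m in auto)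
    then have sum: "integral {-m..m} (\<lambda>x. tent n x *\<^sub>R h' x + k x) = 0" by (simp add: integral_unique)
    have cint: "integrable lebesgue (\<lambda>x. tent n x *\<^sub>R h' x)"
      by (rule Bochner_Integration.integrable_bound[OF i(2) meas])
         (use mult_right_mono[OF tent_bd norm_ge_zero] in \<open>intro AE_I2, simp\<close>)
    have "h \<in> borel_measurable lebesgue" by (rule borel_measurable_integrable[OF i(1)])
    moreover have "(\<lambda>x::real. if x \<le> 0 then 1/m else - (1/m)) \<in> borel_measurable lborel" by measurable
    then have "(\<lambda>x::real. if x \<le> 0 then 1/m else - (1/m)) \<in> borel_measurable lebesgue"
      by (rule measurable_completion)
    ultimately have "(\<lambda>x. h x * complex_of_real (if x \<le> 0 then 1/m else - (1/m))) \<in> borel_measurable lebesgue"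
      by measurable
    moreover have "(\<lambda>x. h x * complex_of_real (if x \<le> 0 then 1/m else - (1/m))) = k"
      by (auto simp: fun_eq_iff k_def)
    ultimately have km: "k \<in> borel_measurable lebesgue" by metis
    have kb: "cmod (k x) = cmod (h x) / m" for x using m by (simp add: k_def norm_mult norm_divide)
    have kint: "integrable lebesgue k"
      by (rule Bochner_Integration.integrable_bound[of _ "\<lambda>x. cmod (h x) / m"]) (use i(1) km kb m in \<open>auto intro!: AE_I2\<close>)
    have Icc: "g absolutely_integrable_on {-m..m}" if "integrable lebesgue g" for g :: "real \<Rightarrow> complex"
      by (rule set_integrable_subset[of _ UNIV]) (use that in \<open>auto simp: set_integrable_def\<close>)
    have "integral {-m..m} (\<lambda>x. tent n x *\<^sub>R h' x) = - integral {-m..m} k"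
      using sum Henstock_Kurzweil_Integration.integral_add[OF set_lebesgue_integral_eq_integral(1)[OF Icc[OF cint]]
          set_lebesgue_integral_eq_integral(1)[OF Icc[OF kint]]] by (simp add: eq_neg_iff_add_eq_0)
    moreover have "(LINT x|lebesgue. tent n x *\<^sub>R h' x) = integral {-m..m} (\<lambda>x. tent n x *\<^sub>R h' x)"
    proof -
      have eqn: "indicator {-m..m} x *\<^sub>R (tent n x *\<^sub>R h' x) = tent n x *\<^sub>R h' x" for x
        by (simp add: tm indicator_def)
      show ?thesis
        using set_lebesgue_integral_eq_integral(2)[OF Icc[OF cint]] unfolding set_lebesgue_integral_def eqn .
    qed
    moreover have "cmod (integral {-m..m} k) \<le> (LINT x|lebesgue. cmod (h x)) / m"
    proof -
      have "cmod (integral {-m..m} k) = cmod (LINT x|lebesgue. indicator {-m..m} x *\<^sub>R k x)"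
        using set_lebesgue_integral_eq_integral(2)[OF Icc[OF kint]] by (simp add: set_lebesgue_integral_def)
      also have "\<dots> \<le> (LINT x|lebesgue. cmod (indicator {-m..m} x *\<^sub>R k x))" by (rule integral_norm_bound)
      also have "\<dots> \<le> (LINT x|lebesgue. cmod (k x))"
        by (rule integral_mono[OF integrable_norm[OF Icc[OF kint, unfolded set_integrable_def]] integrable_norm[OF kint]])
           (simp add: indicator_def)
      also have "\<dots> = (LINT x|lebesgue. cmod (h x)) / m" unfolding kb by simp
      finally show ?thesis by simp
    qed
    ultimately show ?thesis by (simp add: m_def)
  qed
  moreover have "(\<lambda>n. (LINT x|lebesgue. cmod (h x)) / real (Suc n)) \<longlonglongrightarrow> 0"
    by (intro real_tendsto_divide_at_top[OF tendsto_const] filterlim_compose[OF filterlim_real_sequentially filterlim_Suc])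
  ultimately have "(\<lambda>n. LINT x|lebesgue. tent n x *\<^sub>R h' x) \<longlonglongrightarrow> 0"
    by (intro Lim_null_comparison[of "\<lambda>n. LINT x|lebesgue. tent n x *\<^sub>R h' x"]) auto
  then show ?thesis
    using \<open>(\<lambda>n. LINT x|lebesgue. tent n x *\<^sub>R h' x) \<longlonglongrightarrow> (LINT x|lebesgue. h' x)\<close> LIMSEQ_unique by blast
qed

section \<open>Energy identities\<close>

lemma integrable_AE_eq:
  fixes f g :: "real \<Rightarrow> complex"
  assumes f: "integrable lebesgue f" and ae: "AE x in lebesgue. g x = f x"
  shows "integrable lebesgue g"
proof (rule integrable_cong_AE_imp[OF f])
  have ae': "AE x in lebesgue. f x = g x" by (rule eventually_mono[OF ae]) simp
  show "g \<in> borel_measurable lebesgue" by (rule borel_measurable_AE[OF borel_measurable_integrable[OF f] ae'])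
  show "AE x in lebesgue. f x = g x" by (rule ae')
qed

lemma L2_cnj: "L2 f \<Longrightarrow> L2 (\<lambda>x. cnj (f x))" "l2norm (\<lambda>x. cnj (f x)) = l2norm f"
proof -
  show "l2norm (\<lambda>x. cnj (f x)) = l2norm f" by (simp add: l2norm_def)
  assume f: "L2 f"
  have "cnj \<in> borel_measurable borel" by (intro borel_measurable_continuous_onI continuous_intros)
  from measurable_compose[OF L2D(1)[OF f] this] show "L2 (\<lambda>x. cnj (f x))"
    using L2D(2)[OF f] by (simp add: sq_integrable_on_UNIV)
qed

text \<open>
  The imaginary part of the energy identity. The flux \<open>Im (y' cnj y)\<close> is integrable, so the integral
  of its derivative vanishes, and this derivative contains neither the real potential nor \<open>|y'|\<^sup>2\<close>.
  The identities are required almost everywhere, which leaves room for a jump of \<open>y\<close> and \<open>y'\<close>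
  at one point.
\<close>

lemma flux_bound:
  fixes y y' f H H' :: "real \<Rightarrow> complex"
  assumes y: "L2 y" "L2 y'" and f: "L2 f" and H: "primitive_on UNIV H H'"
    and Hae: "AE x in lebesgue. H x = of_real (Im (y' x * cnj (y x)))"
    and H'ae: "AE x in lebesgue. H' x = of_real (- (Im z * (cmod (y x))\<^sup>2) - Im (f x * cnj (y x)))"
  shows "\<bar>Im z\<bar> * l2norm y \<le> l2norm f"
proof -
  have i1: "integrable lebesgue (\<lambda>x. y' x * cnj (y x))" by (rule L2_mult_integrable(1)[OF y(2) L2_cnj(1)[OF y(1)]])
  have i2: "integrable lebesgue (\<lambda>x. f x * cnj (y x))" by (rule L2_mult_integrable(1)[OF f L2_cnj(1)[OF y(1)]])
  have H_int: "integrable lebesgue H"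
    by (rule integrable_AE_eq[OF integrable_of_real[OF integrable_Im[OF i1]] Hae])
  have i3: "integrable lebesgue (\<lambda>x. - (Im z * (cmod (y x))\<^sup>2) - Im (f x * cnj (y x)))"
    by (intro Bochner_Integration.integrable_diff Bochner_Integration.integrable_minus integrable_mult_right L2D(2)[OF y(1)] integrable_Im[OF i2])
  have H'_int: "integrable lebesgue H'"
    by (rule integrable_AE_eq[OF integrable_of_real[OF i3] H'ae])
  have "0 = (LINT x|lebesgue. H' x)" using integral_derivative_zero[OF H H_int H'_int] by simp
  also have "\<dots> = (LINT x|lebesgue. complex_of_real (- (Im z * (cmod (y x))\<^sup>2) - Im (f x * cnj (y x))))"
    by (rule integral_cong_AE[OF borel_measurable_integrable[OF H'_int] borel_measurable_integrable[OF integrable_of_real[OF i3]] H'ae])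
  also have "\<dots> = of_real (LINT x|lebesgue. - (Im z * (cmod (y x))\<^sup>2) - Im (f x * cnj (y x)))"
    by (rule integral_complex_of_real)
  also have "(LINT x|lebesgue. - (Im z * (cmod (y x))\<^sup>2) - Im (f x * cnj (y x))) =
      - (Im z * (l2norm y)\<^sup>2) - (LINT x|lebesgue. Im (f x * cnj (y x)))"
    unfolding l2norm_square
    by (subst Bochner_Integration.integral_diff)
       (use L2D(2)[OF y(1)] integrable_Im[OF i2] in simp_all)
  finally have "0 = complex_of_real (- (Im z * (l2norm y)\<^sup>2) - (LINT x|lebesgue. Im (f x * cnj (y x))))" .
  then have "- (Im z * (l2norm y)\<^sup>2) - (LINT x|lebesgue. Im (f x * cnj (y x))) = 0"
    by (metis of_real_eq_0_iff)
  then have "Im z * (l2norm y)\<^sup>2 = - (LINT x|lebesgue. Im (f x * cnj (y x)))" by linarith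
  then have "\<bar>Im z * (l2norm y)\<^sup>2\<bar> = \<bar>LINT x|lebesgue. Im (f x * cnj (y x))\<bar>" by simp
  also have "\<dots> \<le> (LINT x|lebesgue. \<bar>Im (f x * cnj (y x))\<bar>)" by (rule integral_abs_bound)
  also have "\<dots> \<le> (LINT x|lebesgue. cmod (f x * cnj (y x)))"
    by (rule integral_mono[OF integrable_abs[OF integrable_Im[OF i2]] integrable_norm[OF i2] abs_Im_le_cmod])
  also have "\<dots> \<le> l2norm f * l2norm y"
    using L2_mult_integrable(2)[OF f L2_cnj(1)[OF y(1)]] by (simp only: L2_cnj(2))
  finally have "(\<bar>Im z\<bar> * l2norm y) * l2norm y \<le> l2norm f * l2norm y"
    by (simp add: abs_mult power2_eq_square mult.assoc)
  then show ?thesis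
    using l2norm_nonneg[of y] l2norm_nonneg[of f] by (cases "l2norm y = 0") auto
qed

text \<open>
  The energy identity itself, \<open>(y' cnj y)' = y'' cnj y + |y'|\<^sup>2\<close>, integrated over the line.
\<close>

lemma gradient_bound:
  fixes y y' y'' H H' :: "real \<Rightarrow> complex"
  assumes y: "L2 y" "L2 y'" "L2 y''" and H: "primitive_on UNIV H H'"
    and Hae: "AE x in lebesgue. H x = y' x * cnj (y x)"
    and H'ae: "AE x in lebesgue. H' x = y'' x * cnj (y x) + of_real ((cmod (y' x))\<^sup>2)"
  shows "(l2norm y')\<^sup>2 \<le> l2norm y'' * l2norm y"
proof -
  have i1: "integrable lebesgue (\<lambda>x. y' x * cnj (y x))" by (rule L2_mult_integrable(1)[OF y(2) L2_cnj(1)[OF y(1)]])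
  have i2: "integrable lebesgue (\<lambda>x. y'' x * cnj (y x))" by (rule L2_mult_integrable(1)[OF y(3) L2_cnj(1)[OF y(1)]])
  have i3: "integrable lebesgue (\<lambda>x. complex_of_real ((cmod (y' x))\<^sup>2))" by (rule integrable_of_real[OF L2D(2)[OF y(2)]])
  have H_int: "integrable lebesgue H" by (rule integrable_AE_eq[OF i1 Hae])
  have H'_int: "integrable lebesgue H'" by (rule integrable_AE_eq[OF Bochner_Integration.integrable_add[OF i2 i3] H'ae])
  have "0 = (LINT x|lebesgue. H' x)" using integral_derivative_zero[OF H H_int H'_int] by simp
  also have "\<dots> = (LINT x|lebesgue. y'' x * cnj (y x) + of_real ((cmod (y' x))\<^sup>2))"
    by (rule integral_cong_AE[OF borel_measurable_integrable[OF H'_int] borel_measurable_integrable[OF Bochner_Integration.integrable_add[OF i2 i3]] H'ae])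
  also have "\<dots> = (LINT x|lebesgue. y'' x * cnj (y x)) + of_real ((l2norm y')\<^sup>2)"
    unfolding l2norm_square Bochner_Integration.integral_add[OF i2 i3] integral_complex_of_real ..
  finally have "of_real ((l2norm y')\<^sup>2) = - (LINT x|lebesgue. y'' x * cnj (y x))"
    by (simp add: eq_neg_iff_add_eq_0 add.commute)
  then have "cmod (of_real ((l2norm y')\<^sup>2)) = cmod (LINT x|lebesgue. y'' x * cnj (y x))" by (metis norm_minus_cancel)
  then have "(l2norm y')\<^sup>2 = cmod (LINT x|lebesgue. y'' x * cnj (y x))" by (simp add: norm_power abs_of_nonneg l2norm_nonneg)
  also have "\<dots> \<le> (LINT x|lebesgue. cmod (y'' x * cnj (y x)))" by (rule integral_norm_bound)
  also have "\<dots> \<le> l2norm y'' * l2norm y"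
    using L2_mult_integrable(2)[OF y(3) L2_cnj(1)[OF y(1)]] by (simp only: L2_cnj(2))
  finally show ?thesis .
qed

text \<open>
  Integration by parts against \<open>s - (x + 1)\<close>, which vanishes at the right end point, expresses the value at
  \<open>x\<close> by integrals over an interval of length one.
\<close>

lemma sup_bound_right:
  fixes y y' :: "real \<Rightarrow> complex"
  assumes y: "primitive_on {x..x+1} y y'" "L2 y" "L2 y'"
  shows "cmod (y x) \<le> l2norm y + l2norm y'"
proof -
  define \<chi>' where "\<chi>' s = complex_of_real (s - (x + 1))" for s
  have c: "primitive_on {x..x+1} \<chi>' (\<lambda>s. 1)"
    unfolding \<chi>'_def by (rule primitive_on_C1) (auto intro!: derivative_eq_intros simp: has_vector_derivative_def scaleR_conv_of_real)
  have le: "x \<le> x + 1" by simp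
  have cc: "continuous_on {x..x+1} \<chi>'" by (rule primitive_on_continuous_Icc[OF c order_refl])
  have b: "cmod (\<chi>' s) \<le> 1" if "s \<in> {x..x+1}" for s
    unfolding \<chi>'_def norm_of_real using that by auto
  note L = L2_local_integral[OF y(3) cc zero_le_one b le]
  have "integral {x..x+1} (\<lambda>s. 1 * y s + \<chi>' s * y' s) = \<chi>' (x+1) * y (x+1) - \<chi>' x * y x"
    by (rule primitive_on_integral[OF primitive_on_mult[OF c y(1)] le order_refl])
  moreover have "integral {x..x+1} (\<lambda>s. 1 * y s + \<chi>' s * y' s) = integral {x..x+1} y + integral {x..x+1} (\<lambda>s. \<chi>' s * y' s)"
    using Henstock_Kurzweil_Integration.integral_add[OF
        set_lebesgue_integral_eq_integral(1)[OF L2_absolutely_integrable_Icc[OF y(2)]] set_lebesgue_integral_eq_integral(1)[OF L(1)]]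
    by simp
  ultimately have "y x = integral {x..x+1} y + integral {x..x+1} (\<lambda>s. \<chi>' s * y' s)" by (simp add: \<chi>'_def)
  then have "cmod (y x) \<le> cmod (integral {x..x+1} y) + cmod (integral {x..x+1} (\<lambda>s. \<chi>' s * y' s))"
    by (metis norm_triangle_ineq)
  also have "\<dots> \<le> l2norm y + l2norm y'"
    using L2_integral_bound[OF y(2) le] L(2) by simp
  finally show ?thesis .
qed

lemma l2norm_reflect: "L2 f \<Longrightarrow> l2norm (\<lambda>x. f (- x)) = l2norm f"
proof -
  assume f: "L2 f"
  have a: "(\<lambda>x. (cmod (f x))\<^sup>2) absolutely_integrable_on UNIV" using L2D(2)[OF f] by (simp add: set_integrable_def)
  then have b: "(\<lambda>x. (cmod (f (- x)))\<^sup>2) absolutely_integrable_on UNIV \<and> integral UNIV (\<lambda>x. (cmod (f (- x)))\<^sup>2) = integral UNIV (\<lambda>x. (cmod (f x))\<^sup>2)"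
    using has_absolute_integral_reflect_real[of UNIV UNIV "\<lambda>x. (cmod (f x))\<^sup>2"] by auto
  show ?thesis
    unfolding l2norm_def
    using set_lebesgue_integral_eq_integral(2)[OF a] set_lebesgue_integral_eq_integral(2)[OF conjunct1[OF b]] conjunct2[OF b]
    by (simp add: set_lebesgue_integral_def)
qed

lemma primitive_on_reflect':
  fixes F :: "real \<Rightarrow> complex"
  assumes "primitive_on I F f" "J = uminus ` I"
  shows "primitive_on J (\<lambda>x. F (- x)) (\<lambda>x. - f (- x))"
  using primitive_on_reflect[OF assms(1)] unfolding assms(2) .

lemma sup_bound_left:
  fixes y y' :: "real \<Rightarrow> complex"
  assumes y: "primitive_on {x-1..x} y y'" "L2 y" "L2 y'"
  shows "cmod (y x) \<le> l2norm y + l2norm y'"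
proof -
  have im: "{-x.. -x + 1} = uminus ` {x-1..x}" by simp
  have "cmod (y (- (- x))) \<le> l2norm (\<lambda>x. y (- x)) + l2norm (\<lambda>x. - y' (- x))"
    by (rule sup_bound_right[OF primitive_on_reflect'[OF y(1) im] L2_reflect[OF y(2)] sq_integrable_uminus[OF L2_reflect[OF y(3)]]])
  moreover have "l2norm (\<lambda>x. - y' (- x)) = l2norm (\<lambda>x. y' (- x))" by (simp add: l2norm_def)
  ultimately show ?thesis using y by (simp add: l2norm_reflect)
qed

section \<open>Resolvents of linear graphs\<close>

definition linear_graph :: "(l2 \<times> l2) set \<Rightarrow> bool" where
  "linear_graph A \<longleftrightarrow>
     (\<forall>y g y' g'. (y, g) \<in> A \<longrightarrow> (y', g') \<in> A \<longrightarrow> (y + y', g + g') \<in> A) \<and>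
     (\<forall>r y g. (y, g) \<in> A \<longrightarrow> (r *\<^sub>R y, r *\<^sub>R g) \<in> A)"

lemma scaleC_l2_add: "scaleC_l2 c (x + y) = scaleC_l2 c x + scaleC_l2 c y"
  by (cases x rule: l2_cases; cases y rule: l2_cases) (simp add: abs_l2_ops sq_integrable_add sq_integrable_cmult algebra_simps)

lemma scaleC_l2_scaleR: "scaleC_l2 c (r *\<^sub>R x) = r *\<^sub>R scaleC_l2 c x"
  by (cases x rule: l2_cases) (simp add: abs_l2_ops sq_integrable_scaleR sq_integrable_cmult)

text \<open>
  The bound makes solutions unique. Hence the solution operator is well defined and inherits
  linearity from the graph.
\<close>

lemma has_resolvent_exists:
  assumes lin: "linear_graph A"
    and ex: "\<And>f. \<exists>y g. (y, g) \<in> A \<and> g - scaleC_l2 z y = f"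
    and bound: "\<And>y g. (y, g) \<in> A \<Longrightarrow> norm y \<le> C * norm (g - scaleC_l2 z y)"
  obtains R where "has_resolvent A z R"
proof -
  define T where "T f = (SOME y. \<exists>g. (y, g) \<in> A \<and> g - scaleC_l2 z y = f)" for f
  have T: "\<exists>g. (T f, g) \<in> A \<and> g - scaleC_l2 z (T f) = f" for f
    unfolding T_def by (rule someI_ex) (rule ex)
  have uniq: "y = y'" if "(y, g) \<in> A" "(y', g') \<in> A" "g - scaleC_l2 z y = g' - scaleC_l2 z y'" for y g y' g'
  proof -
    have "(y + (-1) *\<^sub>R y', g + (-1) *\<^sub>R g') \<in> A" using lin that unfolding linear_graph_def by blast
    from bound[OF this] have "norm (y - y') \<le> C * norm ((g - scaleC_l2 z y) - (g' - scaleC_l2 z y'))"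
      by (simp only: scaleC_l2_add scaleC_l2_scaleR) (simp add: algebra_simps)
    then show ?thesis using that(3) by simp
  qed
  have T_eq: "T f = y \<longleftrightarrow> (\<exists>g. (y, g) \<in> A \<and> g - scaleC_l2 z y = f)" for f y
    using T[of f] uniq by blast
  have bl: "bounded_linear T"
  proof (rule bounded_linear_intro)
    show "T (f1 + f2) = T f1 + T f2" for f1 f2
    proof -
      obtain g1 g2 where g: "(T f1, g1) \<in> A" "g1 - scaleC_l2 z (T f1) = f1" "(T f2, g2) \<in> A" "g2 - scaleC_l2 z (T f2) = f2"
        using T[of f1] T[of f2] by blast
      have "(T f1 + T f2, g1 + g2) \<in> A" using lin g unfolding linear_graph_def by blast
      moreover have "(g1 + g2) - scaleC_l2 z (T f1 + T f2) = f1 + f2"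
      proof -
        have "(g1 + g2) - scaleC_l2 z (T f1 + T f2) = (g1 - scaleC_l2 z (T f1)) + (g2 - scaleC_l2 z (T f2))"
          by (simp add: scaleC_l2_add algebra_simps)
        then show ?thesis using g by simp
      qed
      ultimately show ?thesis unfolding T_eq by blast
    qed
    show "T (r *\<^sub>R f) = r *\<^sub>R T f" for r f
    proof -
      obtain g where g: "(T f, g) \<in> A" "g - scaleC_l2 z (T f) = f" using T[of f] by blast
      have "(r *\<^sub>R T f, r *\<^sub>R g) \<in> A" using lin g unfolding linear_graph_def by blast
      moreover have "r *\<^sub>R g - scaleC_l2 z (r *\<^sub>R T f) = r *\<^sub>R f"
        using arg_cong[OF g(2), of "scaleR r"] by (simp add: scaleC_l2_scaleR scaleR_diff_right)
      ultimately show ?thesis unfolding T_eq by blast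
    qed
    show "norm (T f) \<le> norm f * C" for f
    proof -
      obtain g where g: "(T f, g) \<in> A" "g - scaleC_l2 z (T f) = f" using T[of f] by blast
      then show ?thesis using bound[OF g(1)] by (simp add: mult.commute)
    qed
  qed
  have "has_resolvent A z (Blinfun T)"
    unfolding has_resolvent_def bounded_linear_Blinfun_apply[OF bl] using T_eq by blast
  then show ?thesis using that by blast
qed

lemma norm_resolvent_diff_le:
  assumes R: "has_resolvent A z R" "has_resolvent B z S" and K: "K \<ge> 0"
    and est: "\<And>f y g y' g'. (y, g) \<in> A \<Longrightarrow> g - scaleC_l2 z y = f \<Longrightarrow> (y', g') \<in> B \<Longrightarrow> g' - scaleC_l2 z y' = f \<Longrightarrow>
       norm (y - y') \<le> K * norm f"
  shows "norm (resolvent A z - resolvent B z) \<le> K"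
proof -
  have "norm (blinfun_apply (R - S) f) \<le> K * norm f" for f
    using R est unfolding has_resolvent_def blinfun.diff_left by metis
  then show ?thesis
    unfolding resolvent_eqI[OF R(1)] resolvent_eqI[OF R(2)] using K by (intro norm_blinfun_bound) auto
qed

section \<open>Decaying exponentials and the free resolvent\<close>

lemma primitive_on_exp:
  fixes C c :: complex
  shows "primitive_on I (\<lambda>x. C * exp (c * of_real (x - s))) (\<lambda>x. c * (C * exp (c * of_real (x - s))))"
proof (rule primitive_on_C1)
  fix x :: real
  have "((\<lambda>w. C * exp (c * (w - of_real s))) has_field_derivative c * (C * exp (c * (of_real x - of_real s)))) (at (of_real x))"
    by (auto intro!: derivative_eq_intros)
  from has_vector_derivative_real_field[OF this]
  show "((\<lambda>x. C * exp (c * of_real (x - s))) has_vector_derivative c * (C * exp (c * of_real (x - s)))) (at x)"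
    by (simp add: o_def)
qed (intro continuous_intros)

text \<open>
  The product of \<open>m\<close> with the reciprocal of the exponential is constant.
\<close>

lemma exponential_ode:
  fixes m :: "real \<Rightarrow> complex"
  assumes m: "primitive_on {s..} m (\<lambda>x. c * m x)" and "x \<ge> s"
  shows "m x = m s * exp (c * of_real (x - s))"
proof -
  have "primitive_on {s..} (\<lambda>x. (1 * exp ((- c) * of_real (x - s))) * m x) (\<lambda>x. 0)"
    by (rule primitive_on_cong[OF primitive_on_mult[OF primitive_on_exp[where C = 1 and c = "- c" and s = s] m]])
       (auto simp: algebra_simps)
  from primitive_on_integral[OF this \<open>x \<ge> s\<close>]
  have "exp (- (c * of_real (x - s))) * m x = m s" by (simp add: atLeast_def subset_iff)
  then have "exp (c * of_real (x - s)) * (exp (- (c * of_real (x - s))) * m x) = exp (c * of_real (x - s)) * m s" by simp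
  then show ?thesis by (simp add: mult.assoc[symmetric] exp_minus)
qed

lemma exp_tail:
  fixes k C :: complex
  assumes k: "Im k > 0"
  shows "L2 (\<lambda>x. if x \<ge> s then C * exp (\<i> * k * of_real (x - s)) else 0)"
    and "(l2norm (\<lambda>x. if x \<ge> s then C * exp (\<i> * k * of_real (x - s)) else 0))\<^sup>2 = (cmod C)\<^sup>2 / (2 * Im k)"
proof -
  define f where "f x = (if x \<ge> s then C * exp (\<i> * k * of_real (x - s)) else 0)" for x
  define a where "a = 2 * Im k"
  have a: "a > 0" using k by (simp add: a_def)
  define D where "D = (cmod C)\<^sup>2 * exp (a * s)"
  have f2: "(cmod (f x))\<^sup>2 = (if x \<in> {s..} then D * exp (- a * x) else 0)" for x
  proof (cases "x \<ge> s")
    case True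
    have "(cmod (f x))\<^sup>2 = (cmod C)\<^sup>2 * (exp (- Im k * (x - s)))\<^sup>2"
      using True by (simp add: f_def norm_mult power_mult_distrib)
    also have "(exp (- Im k * (x - s)))\<^sup>2 = exp (a * s) * exp (- a * x)"
      by (simp add: a_def exp_double[symmetric] mult_exp_exp algebra_simps)
    finally show ?thesis using True by (simp add: D_def)
  qed (simp add: f_def)
  have "((\<lambda>x. D * exp (- a * x)) has_integral D * (exp (- a * s) / a)) {s..}"
    by (rule has_integral_mult_right[OF has_integral_exp_minus_to_infinity[OF a]])
  then have "((\<lambda>x. if x \<in> {s..} then D * exp (- a * x) else 0) has_integral D * (exp (- a * s) / a)) UNIV"
    by (simp only: has_integral_restrict_UNIV)
  then have hi: "((\<lambda>x. (cmod (f x))\<^sup>2) has_integral D * (exp (- a * s) / a)) UNIV" unfolding f2 .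
  have ai: "(\<lambda>x. (cmod (f x))\<^sup>2) absolutely_integrable_on UNIV"
    by (rule nonnegative_absolutely_integrable_1) (use hi in \<open>auto simp: integrable_on_def\<close>)
  have "(\<lambda>x. C * exp (\<i> * k * complex_of_real (x - s))) \<in> borel_measurable borel"
    by (intro borel_measurable_continuous_onI continuous_intros)
  then have "f \<in> borel_measurable borel" unfolding f_def[abs_def] by measurable
  then have fm: "f \<in> borel_measurable lebesgue" by (intro measurable_completion) simp
  show "L2 (\<lambda>x. if x \<ge> s then C * exp (\<i> * k * of_real (x - s)) else 0)"
    using ai fm unfolding f_def[symmetric] by (simp add: sq_integrable_on_UNIV set_integrable_def)
  have "(l2norm f)\<^sup>2 = D * (exp (- a * s) / a)"
    unfolding l2norm_square using set_lebesgue_integral_eq_integral(2)[OF ai] integral_unique[OF hi]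
    by (simp add: set_lebesgue_integral_def)
  also have "\<dots> = (cmod C)\<^sup>2 / (2 * Im k)" by (simp add: D_def a_def mult_exp_exp)
  finally show "(l2norm (\<lambda>x. if x \<ge> s then C * exp (\<i> * k * of_real (x - s)) else 0))\<^sup>2 = (cmod C)\<^sup>2 / (2 * Im k)"
    unfolding f_def .
qed

text \<open>
  Square integrability selects the decaying one of the two exponential solutions: the combination
  \<open>d' - \<i> k d\<close> is a multiple of the growing exponential, so it has to vanish.
\<close>

lemma decaying_solution_right:
  fixes d d' :: "real \<Rightarrow> complex"
  assumes k: "Im k > 0" and d: "primitive_on {s..} d d'" "primitive_on {s..} d' (\<lambda>x. - (k * k) * d x)"
    and L: "L2 d" "L2 d'"
  shows "d' s = \<i> * k * d s" and "\<And>x. x \<ge> s \<Longrightarrow> d x = d s * exp (\<i> * k * of_real (x - s))"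
    and "(cmod (d s))\<^sup>2 \<le> 2 * Im k * (l2norm d)\<^sup>2"
proof -
  define m where "m x = d' x - \<i> * k * d x" for x
  have "primitive_on {s..} m (\<lambda>x. (- \<i> * k) * m x)"
    unfolding m_def
    by (rule primitive_on_cong[OF primitive_on_diff[OF d(2) primitive_on_cmult[OF d(1), of "\<i> * k"]]])
       (auto simp: algebra_simps)
  from exponential_ode[OF this] have m_exp: "m x = m s * exp ((- \<i> * k) * of_real (x - s))" if "x \<ge> s" for x
    using that by blast
  have m_low: "cmod (m s) \<le> cmod (m x)" if "x \<ge> s" for x
    unfolding m_exp[OF that] using that k by (simp add: norm_mult mult_le_cancel_left1)
  have Lm: "L2 m" unfolding m_def by (rule sq_integrable_diff[OF L(2) sq_integrable_cmult[OF L(1)]])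
  have m0: "m s = 0"
  proof (rule ccontr)
    assume "m s \<noteq> 0"
    then have pos: "(cmod (m s))\<^sup>2 > 0" by simp
    have i: "(\<lambda>x. (cmod (m x))\<^sup>2) absolutely_integrable_on UNIV" using L2D(2)[OF Lm] by (simp add: set_integrable_def)
    then have iU: "(\<lambda>x. (cmod (m x))\<^sup>2) integrable_on UNIV" by (rule set_lebesgue_integral_eq_integral(1))
    obtain n where n: "real n * (cmod (m s))\<^sup>2 > integral UNIV (\<lambda>x. (cmod (m x))\<^sup>2)"
      using ex_less_of_nat_mult[OF pos] by blast
    have iI: "(\<lambda>x. (cmod (m x))\<^sup>2) integrable_on {s..s + real n}" by (rule integrable_on_subinterval[OF iU subset_UNIV])
    have "real n * (cmod (m s))\<^sup>2 = integral {s..s + real n} (\<lambda>x. (cmod (m s))\<^sup>2)" by simp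
    also have "\<dots> \<le> integral {s..s + real n} (\<lambda>x. (cmod (m x))\<^sup>2)"
      by (rule integral_le[OF _ iI]) (use m_low in \<open>auto intro!: power_mono\<close>)
    also have "\<dots> \<le> integral UNIV (\<lambda>x. (cmod (m x))\<^sup>2)"
      by (rule integral_subset_le[OF subset_UNIV iI iU]) simp
    finally show False using n by simp
  qed
  then show "d' s = \<i> * k * d s" by (simp add: m_def)
  have "m x = 0" if "x \<ge> s" for x using m_exp[OF that] m0 by simp
  then have "primitive_on {s..} d (\<lambda>x. (\<i> * k) * d x)"
    by (intro primitive_on_cong[OF d(1)] AE_I2) (auto simp: m_def)
  from exponential_ode[OF this] show dx: "\<And>x. x \<ge> s \<Longrightarrow> d x = d s * exp (\<i> * k * of_real (x - s))" .
  define t where "t x = (if x \<ge> s then d s * exp (\<i> * k * of_real (x - s)) else 0)" for x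
  have Lt: "L2 t" "(l2norm t)\<^sup>2 = (cmod (d s))\<^sup>2 / (2 * Im k)"
    unfolding t_def[abs_def] by (rule exp_tail[OF k])+
  have "l2norm t \<le> l2norm d"
  proof (rule l2norm_mono(2)[OF L(1) L2D(1)[OF Lt(1)]])
    show "cmod (t x) \<le> cmod (d x)" for x
    proof (cases "x \<ge> s")
      case True
      then have "t x = d x" unfolding t_def using dx[OF True] by (simp only: if_True)
      then show ?thesis by simp
    qed (simp add: t_def)
  qed
  then have "(l2norm t)\<^sup>2 \<le> (l2norm d)\<^sup>2" by (intro power_mono l2norm_nonneg)
  then show "(cmod (d s))\<^sup>2 \<le> 2 * Im k * (l2norm d)\<^sup>2"
    using k by (simp add: Lt(2) divide_le_eq mult.commute)
qed

lemma decaying_solution_left: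
  fixes d d' :: "real \<Rightarrow> complex"
  assumes k: "Im k > 0" and d: "primitive_on {..s} d d'" "primitive_on {..s} d' (\<lambda>x. - (k * k) * d x)"
    and L: "L2 d" "L2 d'"
  shows "d' s = - \<i> * k * d s" and "\<And>x. x \<le> s \<Longrightarrow> d x = d s * exp (\<i> * k * of_real (s - x))"
    and "(cmod (d s))\<^sup>2 \<le> 2 * Im k * (l2norm d)\<^sup>2"
proof -
  have im: "{- s..} = uminus ` {..s}" by simp
  have r1: "primitive_on {- s..} (\<lambda>x. d (- x)) (\<lambda>x. - d' (- x))"
    by (rule primitive_on_reflect'[OF d(1) im])
  have r2: "primitive_on {- s..} (\<lambda>x. - d' (- x)) (\<lambda>x. - (k * k) * d (- x))"
    using primitive_on_cmult[OF primitive_on_reflect'[OF d(2) im], of "- 1"] by simp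
  note D = decaying_solution_right[OF k r1 r2 L2_reflect[OF L(1)] sq_integrable_uminus[OF L2_reflect[OF L(2)]]]
  have "- d' s = \<i> * k * d s" using D(1) by (simp only: minus_minus)
  then have "- (- d' s) = - (\<i> * k * d s)" by (rule arg_cong)
  then show "d' s = - \<i> * k * d s" by (simp only: minus_minus mult_minus_left)
  show "d x = d s * exp (\<i> * k * of_real (s - x))" if "x \<le> s" for x
    using D(2)[of "- x"] that by simp
  show "(cmod (d s))\<^sup>2 \<le> 2 * Im k * (l2norm d)\<^sup>2" using D(3) by (simp add: l2norm_reflect[OF L(1)])
qed

text \<open>
  The solution \<open>p(x) = \<integral>\<^sub>-\<^sub>\<infinity>\<^sup>x exp (\<i> k (x - s)) f(s) ds\<close> is bounded by the Cauchy-Schwarz inequality,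
  and integrating \<open>(|p|\<^sup>2)' = - 2 Im k |p|\<^sup>2 + 2 Re (f cnj p)\<close> bounds its square integrals.
\<close>

lemma convolution_exists:
  fixes f :: "real \<Rightarrow> complex"
  assumes k: "Im k > 0" and f: "L2 f"
  obtains p where "L2 p" "primitive_on UNIV p (\<lambda>x. \<i> * k * p x + f x)"
proof -
  define E where "E x = exp (- (\<i> * k) * complex_of_real x)" for x :: real
  define g where "g s = E s * f s" for s
  define E' where "E' x s = (if - s \<ge> - x then 1 * exp (\<i> * k * of_real (- s - (- x))) else 0)" for x s :: real
  have LE': "L2 (E' x)" "l2norm (E' x) = sqrt (1 / (2 * Im k))" for x
  proof -
    note t = exp_tail[OF k, of "- x" 1]
    show "L2 (E' x)" unfolding E'_def[abs_def] by (rule L2_reflect[OF t(1)])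
    have "l2norm (E' x) = l2norm (\<lambda>y. if - x \<le> y then 1 * exp (\<i> * k * complex_of_real (y - - x)) else 0)"
      unfolding E'_def[abs_def] by (rule l2norm_reflect[OF t(1)])
    then have "(l2norm (E' x))\<^sup>2 = (cmod 1)\<^sup>2 / (2 * Im k)" using t(2) by (simp only:)
    then have "(l2norm (E' x))\<^sup>2 = 1 / (2 * Im k)" by (simp only: norm_one one_power2)
    from real_sqrt_unique[OF this l2norm_nonneg] show "l2norm (E' x) = sqrt (1 / (2 * Im k))" by (rule sym)
  qed
  have E'_eq: "E' x s * f s = exp (\<i> * k * of_real x) * (indicator {..x} s *\<^sub>R g s)" for x s
  proof (cases "s \<le> x")
    case True
    have "exp (\<i> * k * of_real (- s - (- x))) = exp (\<i> * k * of_real x) * E s"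
      by (simp add: E_def mult_exp_exp algebra_simps)
    then show ?thesis using True by (simp add: E'_def g_def)
  qed (simp add: E'_def)

  have gi: "set_integrable lebesgue {..x} g" for x
  proof -
    have e: "exp (- (\<i> * k * of_real x)) * (exp (\<i> * k * of_real x) * c) = c" for c
      by (simp add: mult.assoc[symmetric] mult_exp_exp)
    have "integrable lebesgue (\<lambda>s. exp (- (\<i> * k * of_real x)) * (E' x s * f s))"
      by (rule integrable_mult_right[OF L2_mult_integrable(1)[OF LE'(1) f]])
    then show ?thesis unfolding set_integrable_def E'_eq e .
  qed
  define P where "P x = (LINT s:{..x}|lebesgue. g s)" for x
  define p where "p x = exp (\<i> * k * of_real (x - 0)) * P x" for x
  have P: "primitive_on UNIV P g"
    unfolding primitive_on_def
  proof (intro allI impI)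
    fix s t :: real assume st: "s \<le> t"
    have g1: "set_integrable lebesgue {s<..t} g" by (rule set_integrable_subset[OF gi[of t]]) auto
    have g2: "set_integrable lebesgue {s..t} g" by (rule set_integrable_subset[OF gi[of t]]) auto
    have "{..t} = {..s} \<union> {s<..t}" "{..s} \<inter> {s<..t} = {}" using st by auto
    then have "P t = P s + (LINT s:{s<..t}|lebesgue. g s)"
      unfolding P_def using set_integral_Un[OF _ gi[of s] g1] by simp
    moreover have "integral {s<..t} g = integral {s..t} g"
      by (rule integral_subset_negligible) (auto intro: negligible_subset[of "{s}"])
    ultimately have "integral {s..t} g = P t - P s"
      using set_lebesgue_integral_eq_integral(2)[OF g1] by simp
    then show "g absolutely_integrable_on {s..t} \<and> (g has_integral P t - P s) {s..t}"
      using g2 integrable_integral[OF set_lebesgue_integral_eq_integral(1)[OF g2]] by simp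
  qed
  have pp: "primitive_on UNIV p (\<lambda>x. \<i> * k * p x + f x)"
  proof (rule primitive_on_cong[OF primitive_on_mult[OF primitive_on_exp[where C = 1 and c = "\<i> * k" and s = 0] P]])
    show "AE x in lebesgue. x \<in> UNIV \<longrightarrow> \<i> * k * p x + f x =
        \<i> * k * (1 * exp (\<i> * k * complex_of_real (x - 0))) * P x + 1 * exp (\<i> * k * complex_of_real (x - 0)) * g x"
    proof (intro AE_I2 impI)
      fix x :: real
      have "exp (\<i> * k * of_real x) * E x = 1" by (simp add: E_def mult_exp_exp)
      then have "exp (\<i> * k * of_real x) * g x = f x" by (simp add: g_def mult.assoc[symmetric])
      then show "\<i> * k * p x + f x =
        \<i> * k * (1 * exp (\<i> * k * complex_of_real (x - 0))) * P x + 1 * exp (\<i> * k * complex_of_real (x - 0)) * g x"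
        by (simp add: p_def)
    qed
  qed (simp add: p_def)
  define B where "B = sqrt (1 / (2 * Im k)) * l2norm f"
  have p_bound: "cmod (p x) \<le> B" for x
  proof -
    have "p x = (LINT s|lebesgue. E' x s * f s)"
      unfolding p_def P_def E'_eq set_lebesgue_integral_def by (simp only: integral_mult_right_zero diff_zero)
    then have "cmod (p x) \<le> (LINT s|lebesgue. cmod (E' x s * f s))" by (metis integral_norm_bound)
    also have "\<dots> \<le> B" unfolding B_def LE'(2)[of x, symmetric] by (rule L2_mult_integrable(2)[OF LE'(1) f])
    finally show ?thesis .
  qed
  have cp: "continuous_on UNIV p" by (rule primitive_on_continuous_open[OF pp open_UNIV])
  have fi: "(\<lambda>x. (cmod (f x))\<^sup>2) integrable_on UNIV"
    using set_lebesgue_integral_eq_integral(1)[of UNIV "\<lambda>x. (cmod (f x))\<^sup>2"] L2D(2)[OF f] by (simp add: set_integrable_def)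
  have "L2 p"
  proof (rule L2_from_bounded_integrals[OF cp, of "B\<^sup>2 / Im k + (l2norm f)\<^sup>2 / (Im k)\<^sup>2"])
    fix s t :: real assume st: "s \<le> t"
    have pc: "primitive_on UNIV (\<lambda>x. cnj (p x)) (\<lambda>x. cnj (\<i> * k * p x + f x))"
      by (rule primitive_on_linear[OF pp bounded_linear_cnj])
    let ?h = "\<lambda>x. (\<i> * k * p x + f x) * cnj (p x) + p x * cnj (\<i> * k * p x + f x)"
    have "((\<lambda>x. Re (?h x)) has_integral Re (p t * cnj (p t) - p s * cnj (p s))) {s..t}"
      by (rule has_integral_Re[OF primitive_onD(2)[OF primitive_on_mult[OF pp pc] st subset_UNIV]])
    then have hR: "((\<lambda>x. Re (?h x)) has_integral ((cmod (p t))\<^sup>2 - (cmod (p s))\<^sup>2)) {s..t}"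
      by (simp add: complex_norm_square[symmetric] flip: of_real_diff)
    have pi: "(\<lambda>x. (cmod (p x))\<^sup>2) integrable_on {s..t}"
      by (intro integrable_continuous_interval continuous_intros continuous_on_subset[OF cp]) auto
    have fi': "(\<lambda>x. (cmod (f x))\<^sup>2) integrable_on {s..t}" by (rule integrable_on_subinterval[OF fi subset_UNIV])
    let ?r = "\<lambda>x. - Im k * (cmod (p x))\<^sup>2 + (1 / Im k) * (cmod (f x))\<^sup>2"
    have "(cmod (p t))\<^sup>2 - (cmod (p s))\<^sup>2 \<le> - Im k * integral {s..t} (\<lambda>x. (cmod (p x))\<^sup>2) + (1 / Im k) * integral {s..t} (\<lambda>x. (cmod (f x))\<^sup>2)"
    proof (rule has_integral_le[OF hR])
      show "(?r has_integral - Im k * integral {s..t} (\<lambda>x. (cmod (p x))\<^sup>2) + (1 / Im k) * integral {s..t} (\<lambda>x. (cmod (f x))\<^sup>2)) {s..t}"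
        by (intro has_integral_add has_integral_mult_right integrable_integral pi fi')
      fix x
      have "Re (?h x) = - 2 * Im k * (cmod (p x))\<^sup>2 + 2 * Re (f x * cnj (p x))"
        unfolding cmod_power2 by (simp add: algebra_simps power2_eq_square)
      moreover have "Re (f x * cnj (p x)) \<le> cmod (f x) * cmod (p x)"
        using complex_Re_le_cmod[of "f x * cnj (p x)"] by (simp add: norm_mult)
      moreover have "2 * (cmod (f x) * cmod (p x)) \<le> Im k * (cmod (p x))\<^sup>2 + (1 / Im k) * (cmod (f x))\<^sup>2"
      proof -
        have "0 \<le> (Im k * cmod (p x) - cmod (f x))\<^sup>2 / Im k" using k by simp
        also have "\<dots> = Im k * (cmod (p x))\<^sup>2 + (1 / Im k) * (cmod (f x))\<^sup>2 - 2 * (cmod (f x) * cmod (p x))"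
          using k by (simp add: field_simps power2_eq_square)
        finally show ?thesis by simp
      qed
      ultimately show "Re (?h x) \<le> ?r x" by (simp add: algebra_simps)
    qed
    moreover have "(cmod (p s))\<^sup>2 \<le> B\<^sup>2" using p_bound by (intro power_mono) auto
    moreover have "integral {s..t} (\<lambda>x. (cmod (f x))\<^sup>2) \<le> (l2norm f)\<^sup>2"
    proof -
      have "integral {s..t} (\<lambda>x. (cmod (f x))\<^sup>2) \<le> integral UNIV (\<lambda>x. (cmod (f x))\<^sup>2)"
        by (rule integral_subset_le[OF subset_UNIV fi' fi]) simp
      also have "\<dots> = (l2norm f)\<^sup>2"
        unfolding l2norm_square using set_lebesgue_integral_eq_integral(2)[of UNIV "\<lambda>x. (cmod (f x))\<^sup>2"] L2D(2)[OF f]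
        by (simp add: set_integrable_def set_lebesgue_integral_def)
      finally show ?thesis .
    qed
    then have "(1 / Im k) * integral {s..t} (\<lambda>x. (cmod (f x))\<^sup>2) \<le> (1 / Im k) * (l2norm f)\<^sup>2"
      using k by (intro mult_left_mono) auto
    ultimately have "Im k * integral {s..t} (\<lambda>x. (cmod (p x))\<^sup>2) \<le> B\<^sup>2 + (1 / Im k) * (l2norm f)\<^sup>2"
      using zero_le_power2[of "cmod (p t)"] by linarith
    then have "integral {s..t} (\<lambda>x. (cmod (p x))\<^sup>2) \<le> (B\<^sup>2 + (1 / Im k) * (l2norm f)\<^sup>2) / Im k"
      using k by (simp add: le_divide_eq mult.commute)
    then show "integral {s..t} (\<lambda>x. (cmod (p x))\<^sup>2) \<le> B\<^sup>2 / Im k + (l2norm f)\<^sup>2 / (Im k)\<^sup>2"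
      by (simp add: add_divide_distrib power2_eq_square)
  qed
  then show ?thesis using that pp by blast
qed

text \<open>
  The sum of the forward convolution and its mirror image is the convolution with
  \<open>exp (\<i> k |x|)\<close>; the factor \<open>\<i> / (2 k)\<close> makes it the free Green's function.
\<close>

lemma free_resolvent_exists:
  fixes f :: "real \<Rightarrow> complex"
  assumes k: "Im k > 0" and f: "L2 f"
  obtains v v' where "L2 v" "L2 v'" "primitive_on UNIV v v'" "primitive_on UNIV v' (\<lambda>x. - (k * k) * v x - f x)"
proof -
  obtain p where p: "L2 p" "primitive_on UNIV p (\<lambda>x. \<i> * k * p x + f x)"
    by (rule convolution_exists[OF k f])
  obtain q where q: "L2 q" "primitive_on UNIV q (\<lambda>x. \<i> * k * q x + f (- x))"
    by (rule convolution_exists[OF k L2_reflect[OF f]])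
  define r where "r x = q (- x)" for x
  have Lr: "L2 r" unfolding r_def by (rule L2_reflect[OF q(1)])
  have r: "primitive_on UNIV r (\<lambda>x. - (\<i> * k * r x + f x))"
    using primitive_on_reflect'[OF q(2), of UNIV] by (simp add: r_def[abs_def] surj_uminus)
  have k0: "k \<noteq> 0" using k by auto
  show ?thesis
  proof (rule that)
    show "L2 (\<lambda>x. (\<i> / (2 * k)) * (p x + r x))" "L2 (\<lambda>x. (- 1 / 2) * (p x - r x))"
      by (intro sq_integrable_cmult sq_integrable_add sq_integrable_diff p(1) Lr)+
    show "primitive_on UNIV (\<lambda>x. (\<i> / (2 * k)) * (p x + r x)) (\<lambda>x. (- 1 / 2) * (p x - r x))"
      by (rule primitive_on_cong[OF primitive_on_cmult[OF primitive_on_add[OF p(2) r], of "\<i> / (2 * k)"]])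
         (use k0 in \<open>auto simp: field_simps\<close>)
    show "primitive_on UNIV (\<lambda>x. (- 1 / 2) * (p x - r x)) (\<lambda>x. - (k * k) * ((\<i> / (2 * k)) * (p x + r x)) - f x)"
      by (rule primitive_on_cong[OF primitive_on_cmult[OF primitive_on_diff[OF p(2) r], of "- 1 / 2"]])
         (use k0 in \<open>auto simp: field_simps\<close>)
  qed
qed

lemma complex_sqrt_upper:
  assumes "z \<notin> \<real>"
  obtains k where "k * k = z" "Im k > 0"
proof -
  define c where "c = csqrt z"
  have c: "c * c = z" by (simp add: c_def flip: power2_eq_square)
  have "Im c \<noteq> 0"
  proof
    assume "Im c = 0"
    then have "c \<in> \<real>" by (simp add: complex_is_Real_iff)
    then show False using c assms Reals_mult by blast
  qed
  then show ?thesis using that[of c] that[of "- c"] c by (cases "Im c > 0") auto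
qed

section \<open>The graphs in terms of primitives\<close>

lemma exhaustible_UNIV: "two_interval_exhaustible UNIV"
  by (rule two_interval_exhaustible_interval) auto

text \<open>
  The continuous representatives of \<open>y\<close> and \<open>y'\<close> may be used, because a change of \<open>y\<close> on a null set changes
  \<open>q y\<close> on a null set.
\<close>

lemma schroedinger_op_iff:
  "(Y, G) \<in> schroedinger_op q \<longleftrightarrow>
    (\<exists>y y' y''. Y = abs_l2 y \<and> G = abs_l2 (\<lambda>x. - y'' x + complex_of_real (q x) * y x) \<and>
       primitive_on UNIV y y' \<and> primitive_on UNIV y' y'' \<and> L2 y \<and> L2 y' \<and>
       L2 (\<lambda>x. - y'' x + complex_of_real (q x) * y x))" (is "?L = ?R")
proof
  assume ?L
  then obtain y y' y'' where y: "Y = abs_l2 y" "G = abs_l2 (\<lambda>x. - y'' x + complex_of_real (q x) * y x)"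
    "weak_deriv_on UNIV y y'" "weak_deriv_on UNIV y' y''" "L2 y" "L2 y'"
    "L2 (\<lambda>x. - y'' x + complex_of_real (q x) * y x)"
    unfolding schroedinger_op_def by blast
  obtain w where w: "primitive_on UNIV w y'" "AE x in lebesgue. x \<in> UNIV \<longrightarrow> w x = y x"
    by (rule weak_deriv_on_imp_primitive_on[of UNIV 0 1 UNIV y y']) (use y(3) in auto)
  obtain w' where w': "primitive_on UNIV w' y''" "AE x in lebesgue. x \<in> UNIV \<longrightarrow> w' x = y' x"
    by (rule weak_deriv_on_imp_primitive_on[of UNIV 0 1 UNIV y' y'']) (use y(4) in auto)
  have ae: "AE x in lebesgue. y x = w x" by (rule eventually_mono[OF w(2)]) simp
  have ae': "AE x in lebesgue. y' x = w' x" by (rule eventually_mono[OF w'(2)]) simp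
  have ae'': "AE x in lebesgue. - y'' x + complex_of_real (q x) * y x = - y'' x + complex_of_real (q x) * w x"
    by (rule eventually_mono[OF ae]) simp
  have "primitive_on UNIV w w'"
    by (rule primitive_on_cong[OF w(1) _ w'(2)]) simp
  moreover have "Y = abs_l2 w" unfolding y(1) by (rule abs_l2_eqI[OF y(5) ae])
  moreover have "G = abs_l2 (\<lambda>x. - y'' x + complex_of_real (q x) * w x)"
    unfolding y(2) by (rule abs_l2_eqI[OF y(7) ae''])
  ultimately show ?R
    using w'(1) sq_integrable_AE[OF y(5) ae] sq_integrable_AE[OF y(6) ae'] sq_integrable_AE[OF y(7) ae''] by blast
next
  assume ?R
  then obtain y y' y'' where y: "Y = abs_l2 y" "G = abs_l2 (\<lambda>x. - y'' x + complex_of_real (q x) * y x)"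
    "primitive_on UNIV y y'" "primitive_on UNIV y' y''" "L2 y" "L2 y'"
    "L2 (\<lambda>x. - y'' x + complex_of_real (q x) * y x)"
    by blast
  note w = primitive_on_imp_weak_deriv_on[OF exhaustible_UNIV y(3)] primitive_on_imp_weak_deriv_on[OF exhaustible_UNIV y(4)]
  show ?L
    unfolding schroedinger_op_def using y(1,2,5-7) w by blast
qed

lemma linear_graph_schroedinger_op: "linear_graph (schroedinger_op q)"
  unfolding linear_graph_def
proof (intro conjI allI impI)
  fix Y G Y' G' assume A: "(Y, G) \<in> schroedinger_op q" "(Y', G') \<in> schroedinger_op q"
  from A(1) obtain y y' y'' where
    y: "Y = abs_l2 y" "G = abs_l2 (\<lambda>x. - y'' x + complex_of_real (q x) * y x)"
       "primitive_on UNIV y y'" "primitive_on UNIV y' y''" "L2 y" "L2 y'" "L2 (\<lambda>x. - y'' x + complex_of_real (q x) * y x)"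
    unfolding schroedinger_op_iff by (elim exE conjE)
  from A(2) obtain w w' w'' where
    w: "Y' = abs_l2 w" "G' = abs_l2 (\<lambda>x. - w'' x + complex_of_real (q x) * w x)"
       "primitive_on UNIV w w'" "primitive_on UNIV w' w''" "L2 w" "L2 w'" "L2 (\<lambda>x. - w'' x + complex_of_real (q x) * w x)"
    unfolding schroedinger_op_iff by (elim exE conjE)
  have e: "(\<lambda>x. (- y'' x + complex_of_real (q x) * y x) + (- w'' x + complex_of_real (q x) * w x)) =
      (\<lambda>x. - (y'' x + w'' x) + complex_of_real (q x) * (y x + w x))" by (simp add: algebra_simps)
  show "(Y + Y', G + G') \<in> schroedinger_op q"
    unfolding schroedinger_op_iff
  proof (rule exI[of _ "\<lambda>x. y x + w x"], rule exI[of _ "\<lambda>x. y' x + w' x"], rule exI[of _ "\<lambda>x. y'' x + w'' x"], intro conjI)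
    show "Y + Y' = abs_l2 (\<lambda>x. y x + w x)" unfolding y(1) w(1) by (rule abs_l2_ops(1)[OF y(5) w(5)])
    show "G + G' = abs_l2 (\<lambda>x. - (y'' x + w'' x) + complex_of_real (q x) * (y x + w x))"
      unfolding y(2) w(2) abs_l2_ops(1)[OF y(7) w(7)] e ..
    show "L2 (\<lambda>x. - (y'' x + w'' x) + complex_of_real (q x) * (y x + w x))"
      using sq_integrable_add[OF y(7) w(7)] unfolding e .
  qed (intro primitive_on_add sq_integrable_add y w)+
next
  fix r Y G assume "(Y, G) \<in> schroedinger_op q"
  then obtain y y' y'' where
    y: "Y = abs_l2 y" "G = abs_l2 (\<lambda>x. - y'' x + complex_of_real (q x) * y x)"
       "primitive_on UNIV y y'" "primitive_on UNIV y' y''" "L2 y" "L2 y'" "L2 (\<lambda>x. - y'' x + complex_of_real (q x) * y x)"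
    unfolding schroedinger_op_iff by (elim exE conjE)
  have e: "(\<lambda>x. r *\<^sub>R (- y'' x + complex_of_real (q x) * y x)) =
      (\<lambda>x. - (r *\<^sub>R y'' x) + complex_of_real (q x) * (r *\<^sub>R y x))" by (simp add: algebra_simps)
  show "(r *\<^sub>R Y, r *\<^sub>R G) \<in> schroedinger_op q"
    unfolding schroedinger_op_iff
  proof (rule exI[of _ "\<lambda>x. r *\<^sub>R y x"], rule exI[of _ "\<lambda>x. r *\<^sub>R y' x"], rule exI[of _ "\<lambda>x. r *\<^sub>R y'' x"], intro conjI)
    show "r *\<^sub>R Y = abs_l2 (\<lambda>x. r *\<^sub>R y x)" unfolding y(1) by (rule abs_l2_ops(4)[OF y(5) y(5)])
    show "r *\<^sub>R G = abs_l2 (\<lambda>x. - (r *\<^sub>R y'' x) + complex_of_real (q x) * (r *\<^sub>R y x))"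
      unfolding y(2) abs_l2_ops(4)[OF y(7) y(7)] e ..
    show "L2 (\<lambda>x. - (r *\<^sub>R y'' x) + complex_of_real (q x) * (r *\<^sub>R y x))"
      using sq_integrable_scaleR[OF y(7), of r] unfolding e .
  qed (intro primitive_on_linear[OF _ bounded_linear_scaleR_right] sq_integrable_scaleR y)+
qed

text \<open>
  The equation \<open>-y'' + q y - z y = f\<close> for the continuous representatives \<open>y\<close> and \<open>y'\<close>; the second
  derivative is eliminated.
\<close>

definition schroedinger_solution ::
  "(real \<Rightarrow> real) \<Rightarrow> complex \<Rightarrow> (real \<Rightarrow> complex) \<Rightarrow> (real \<Rightarrow> complex) \<Rightarrow> (real \<Rightarrow> complex) \<Rightarrow> bool" where
  "schroedinger_solution q z f y y' \<longleftrightarrow>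
     primitive_on UNIV y y' \<and> primitive_on UNIV y' (\<lambda>x. complex_of_real (q x) * y x - z * y x - f x) \<and> L2 y \<and> L2 y'"

lemma schroedinger_op_solution:
  assumes f: "L2 f"
  shows "(\<exists>G. (Y, G) \<in> schroedinger_op q \<and> G - scaleC_l2 z Y = abs_l2 f) \<longleftrightarrow>
    (\<exists>y y'. Y = abs_l2 y \<and> schroedinger_solution q z f y y')"
proof
  assume "\<exists>G. (Y, G) \<in> schroedinger_op q \<and> G - scaleC_l2 z Y = abs_l2 f"
  then obtain G y y' y'' where
    y: "Y = abs_l2 y" "G = abs_l2 (\<lambda>x. - y'' x + complex_of_real (q x) * y x)"
       "primitive_on UNIV y y'" "primitive_on UNIV y' y''" "L2 y" "L2 y'" "L2 (\<lambda>x. - y'' x + complex_of_real (q x) * y x)"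
    and G: "G - scaleC_l2 z Y = abs_l2 f"
    unfolding schroedinger_op_iff by (elim exE conjE)
  note Lz = sq_integrable_cmult[OF y(5), of z]
  have "abs_l2 (\<lambda>x. (- y'' x + complex_of_real (q x) * y x) - z * y x) = abs_l2 f"
    using G unfolding y(1,2) abs_l2_ops(3)[OF y(5) y(5)] abs_l2_ops(2)[OF y(7) Lz] .
  from abs_l2_eqD[OF sq_integrable_diff[OF y(7) Lz] f this]
  have ae: "AE x in lebesgue. x \<in> UNIV \<longrightarrow> complex_of_real (q x) * y x - z * y x - f x = y'' x"
    by (rule eventually_mono) (auto simp: algebra_simps)
  have "schroedinger_solution q z f y y'"
    unfolding schroedinger_solution_def using y primitive_on_cong[OF y(4) _ ae] by blast
  then show "\<exists>y y'. Y = abs_l2 y \<and> schroedinger_solution q z f y y'" using y(1) by blast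
next
  assume "\<exists>y y'. Y = abs_l2 y \<and> schroedinger_solution q z f y y'"
  then obtain y y' where y: "Y = abs_l2 y" "primitive_on UNIV y y'"
    "primitive_on UNIV y' (\<lambda>x. complex_of_real (q x) * y x - z * y x - f x)" "L2 y" "L2 y'"
    unfolding schroedinger_solution_def by blast
  have e: "(\<lambda>x. - (complex_of_real (q x) * y x - z * y x - f x) + complex_of_real (q x) * y x) = (\<lambda>x. z * y x + f x)"
    by (simp add: algebra_simps)
  note Lz = sq_integrable_cmult[OF y(4), of z]
  have "(Y, abs_l2 (\<lambda>x. z * y x + f x)) \<in> schroedinger_op q"
    unfolding schroedinger_op_iff using y sq_integrable_add[OF Lz f]
    by (intro exI[of _ y] exI[of _ y'] exI[of _ "\<lambda>x. complex_of_real (q x) * y x - z * y x - f x"] conjI) (simp_all only: e)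
  moreover have "abs_l2 (\<lambda>x. z * y x + f x) - scaleC_l2 z Y = abs_l2 f"
    unfolding y(1) abs_l2_ops(3)[OF y(4) y(4)] abs_l2_ops(2)[OF sq_integrable_add[OF Lz f] Lz] by simp
  ultimately show "\<exists>G. (Y, G) \<in> schroedinger_op q \<and> G - scaleC_l2 z Y = abs_l2 f" by blast
qed

lemma primitive_on_flux:
  fixes y y' y'' :: "real \<Rightarrow> complex"
  assumes "primitive_on I y y'" "primitive_on I y' y''"
  shows "primitive_on I (\<lambda>x. y' x * cnj (y x)) (\<lambda>x. y'' x * cnj (y x) + of_real ((cmod (y' x))\<^sup>2))"
  by (rule primitive_on_cong[OF primitive_on_mult[OF assms(2) primitive_on_linear[OF assms(1) bounded_linear_cnj]]])
     (simp_all add: complex_norm_square del: of_real_power)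

lemma primitive_on_of_real_Im:
  fixes h h' :: "real \<Rightarrow> complex"
  assumes "primitive_on I h h'"
  shows "primitive_on I (\<lambda>x. of_real (Im (h x)) :: complex) (\<lambda>x. of_real (Im (h' x)))"
  by (rule primitive_on_linear[OF primitive_on_linear[OF assms bounded_linear_Im] bounded_linear_of_real])

lemma schroedinger_solution_bound:
  assumes f: "L2 f" and y: "schroedinger_solution q z f y y'"
  shows "\<bar>Im z\<bar> * l2norm y \<le> l2norm f"
proof -
  have p: "primitive_on UNIV y y'" "primitive_on UNIV y' (\<lambda>x. complex_of_real (q x) * y x - z * y x - f x)" "L2 y" "L2 y'"
    using y unfolding schroedinger_solution_def by blast+
  show ?thesis
  proof (rule flux_bound[OF p(3,4) f primitive_on_of_real_Im[OF primitive_on_flux[OF p(1,2)]]])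
    show "AE x in lebesgue. complex_of_real (Im ((complex_of_real (q x) * y x - z * y x - f x) * cnj (y x) + complex_of_real ((cmod (y' x))\<^sup>2)))
      = complex_of_real (- (Im z * (cmod (y x))\<^sup>2) - Im (f x * cnj (y x)))"
      unfolding cmod_power2 by (intro AE_I2) (simp add: algebra_simps power2_eq_square)
  qed simp
qed

section \<open>Solvability for the potential supported in a short interval\<close>

text \<open>
  The boundary conditions say that \<open>w\<close> and \<open>w'\<close> fit the decaying exponentials on both sides.
\<close>

lemma exponential_extension:
  fixes w w' g :: "real \<Rightarrow> complex"
  assumes k: "Im k > 0" and s: "s > 0"
    and w: "primitive_on {-s..s} w w'" "primitive_on {-s..s} w' g"
    and bc: "w' (-s) = - \<i> * k * w (-s)" "w' s = \<i> * k * w s"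
  obtains W W' where "primitive_on UNIV W W'"
    "primitive_on UNIV W' (\<lambda>x. if x \<in> {-s..s} then g x else - (k * k) * W x)" "L2 W" "L2 W'"
    "\<And>x. x \<in> {-s..s} \<Longrightarrow> W x = w x"
proof -
  define tR tL where "tR C x = (if x \<ge> s then C * exp (\<i> * k * of_real (x - s)) else 0)"
    and "tL C x = (if - x \<ge> s then C * exp (\<i> * k * of_real (- x - s)) else 0)" for C and x :: real
  have LtR: "L2 (tR C)" for C unfolding tR_def[abs_def] by (rule exp_tail(1)[OF k])
  have LtL: "L2 (tL C)" for C unfolding tL_def[abs_def] by (rule L2_reflect[OF exp_tail(1)[OF k]])
  define mid where "mid h x = (if x \<in> {-s<..<s} then h x else 0)" for h :: "real \<Rightarrow> complex" and x
  have Lmid: "L2 (mid h)" if h: "continuous_on {-s..s} h" for h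
  proof -
    obtain B where B: "\<And>x. x \<in> {-s..s} \<Longrightarrow> cmod (h x) \<le> B" "B \<ge> 0"
    proof -
      have "bounded (h ` {-s..s})" by (rule compact_imp_bounded[OF compact_continuous_image[OF h compact_Icc]])
      then obtain B where "B > 0" "\<forall>x\<in>h ` {-s..s}. norm x \<le> B" unfolding bounded_pos by blast
      then show ?thesis using that[of B] by auto
    qed
    have "h \<in> borel_measurable (lebesgue_on {-s<..<s})"
      by (rule continuous_imp_measurable_on_sets_lebesgue[OF continuous_on_subset[OF h]]) auto
    then show ?thesis unfolding mid_def[abs_def]
      by (rule L2_indicator_bounded(1)[rotated, OF _ B(2)]) (use B(1) in auto)
  qed
  define W where "W x = tR (w s) x + tL (w (-s)) x + mid w x" for x
  define W' where "W' x = tR (\<i> * k * w s) x + tL (- \<i> * k * w (-s)) x + mid w' x" for x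
  have Wm: "W x = w x" "W' x = w' x" if x: "x \<in> {-s..s}" for x
  proof -
    consider "x = s" | "x = - s" | "x \<in> {-s<..<s}"
      using x by (cases "x = s"; cases "x = - s"; auto)
    then show "W x = w x" "W' x = w' x"
      using s bc by (cases; simp add: W_def W'_def tR_def tL_def mid_def)+
  qed
  have WR: "W x = w s * exp (\<i> * k * of_real (x - s))" "W' x = (\<i> * k) * (w s * exp (\<i> * k * of_real (x - s)))"
    if "x \<ge> s" for x
    using that s by (simp_all add: W_def W'_def tR_def tL_def mid_def)
  have WL: "W x = w (-s) * exp ((- \<i> * k) * of_real (x - (-s)))" "W' x = (- \<i> * k) * (w (-s) * exp ((- \<i> * k) * of_real (x - (-s))))"
    if x: "x \<le> - s" for x
  proof -
    have ex: "\<i> * k * of_real (- x - s) = (- \<i> * k) * of_real (x - (- s))" by (simp add: algebra_simps)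
    have "tL C x = C * exp ((- \<i> * k) * of_real (x - (- s)))" "tR C x = 0" "mid h x = 0" for C h
      unfolding tL_def ex using x s by (simp_all add: tR_def mid_def)
    then show "W x = w (-s) * exp ((- \<i> * k) * of_real (x - (-s)))" "W' x = (- \<i> * k) * (w (-s) * exp ((- \<i> * k) * of_real (x - (-s))))"
      by (simp_all only: W_def W'_def mult.assoc add_0 add_0_right)
  qed
  define g' where "g' x = (if x \<in> {-s..s} then g x else - (k * k) * W x)" for x
  have N: "AE x in lebesgue. x \<noteq> s \<and> x \<noteq> - s"
    using AE_not_in[of "{s, - s}" lebesgue] negligible_iff_null_sets[of "{s, - s}"] by simp
  have sets: "UNIV \<inter> {..s} \<inter> {..-s} = {..-s}" "UNIV \<inter> {..s} \<inter> {-s..} = {-s..s}" "UNIV \<inter> {s..} = {s..}"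
    using s by auto
  have "primitive_on UNIV W W'"
  proof (rule primitive_on_combine[where c = s], rule primitive_on_combine[where c = "- s"]; unfold sets)
    show "primitive_on {..- s} W W'"
      by (rule primitive_on_cong[OF primitive_on_exp[where C = "w (-s)" and c = "- \<i> * k" and s = "- s"]]) (auto simp: WL intro!: AE_I2)
    show "primitive_on {- s..s} W W'"
      by (rule primitive_on_cong[OF w(1)]) (auto simp: Wm intro!: AE_I2)
    show "primitive_on {s..} W W'"
      by (rule primitive_on_cong[OF primitive_on_exp[where C = "w s" and c = "\<i> * k" and s = s]]) (auto simp: WR intro!: AE_I2)
  qed
  moreover have "primitive_on UNIV W' g'"
  proof (rule primitive_on_combine[where c = s], rule primitive_on_combine[where c = "- s"]; unfold sets)
    show "primitive_on {..- s} W' g'"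
      by (rule primitive_on_cong[OF primitive_on_cmult[where c = "- \<i> * k", OF primitive_on_exp[where C = "w (-s)" and c = "- \<i> * k" and s = "- s"]]])
         (simp add: WL, rule eventually_mono[OF N], use s in \<open>auto simp: WL g'_def algebra_simps\<close>)
    show "primitive_on {- s..s} W' g'"
      by (rule primitive_on_cong[OF w(2)]) (auto simp: Wm g'_def intro!: AE_I2)
    show "primitive_on {s..} W' g'"
      by (rule primitive_on_cong[OF primitive_on_cmult[where c = "\<i> * k", OF primitive_on_exp[where C = "w s" and c = "\<i> * k" and s = s]]])
         (simp add: WR, rule eventually_mono[OF N], use s in \<open>auto simp: WR g'_def algebra_simps\<close>)
  qed
  moreover have "L2 W" unfolding W_def[abs_def]
    by (intro sq_integrable_add LtR LtL Lmid primitive_on_continuous_Icc[OF w(1) order_refl])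
  moreover have "L2 W'" unfolding W'_def[abs_def]
    by (intro sq_integrable_add LtR LtL Lmid primitive_on_continuous_Icc[OF w(2) order_refl])
  ultimately show ?thesis using that[of W W'] Wm(1) unfolding g'_def by blast
qed

text \<open>
  The ansatz is \<open>y = v + w\<close> with the free solution \<open>v\<close>. Then \<open>w\<close> has the source \<open>- q v\<close>, which is supported
  in \<open>[-s,s]\<close>, and has to be a decaying exponential on both sides. The particular solution \<open>P\<close> and the
  homogeneous solution \<open>N\<close> fit at \<open>-s\<close>; the condition at \<open>s\<close> determines the coefficient of \<open>N\<close>.
\<close>

lemma schroedinger_solution_exists:
  assumes k: "k * k = z" "Im k > 0" and z: "z \<notin> \<real>" and s: "s > 0"
    and q: "(\<lambda>x. complex_of_real (q x)) absolutely_integrable_on {-s..s}" "\<And>x. x \<notin> {-s..s} \<Longrightarrow> q x = 0" and f: "L2 f"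
  shows "\<exists>y y'. schroedinger_solution q z f y y'"
proof -
  have le: "- s \<le> s" using s by simp
  have Imz: "\<bar>Im z\<bar> > 0" using z by (simp add: complex_is_Real_iff)
  obtain v v' where v: "L2 v" "L2 v'" "primitive_on UNIV v v'" "primitive_on UNIV v' (\<lambda>x. - (k * k) * v x - f x)"
    by (rule free_resolvent_exists[OF k(2) f])
  define Q where "Q x = complex_of_real (q x) - z" for x
  have Q: "Q absolutely_integrable_on {-s..s}" unfolding Q_def
    by (rule set_integral_diff(1)[OF q(1) absolutely_integrable_continuous_real[OF continuous_on_const]])
  have qv: "(\<lambda>x. complex_of_real (q x) * v x) absolutely_integrable_on {-s..s}"
    by (rule absolutely_integrable_mult_continuous(1)[OF q(1) primitive_on_continuous_Icc[OF v(3) subset_UNIV]])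
  obtain N N' where N: "primitive_on {-s..s} N N'" "primitive_on {-s..s} N' (\<lambda>x. Q x * N x + 0)" "N (-s) = 1" "N' (-s) = - \<i> * k"
    by (rule ivp_exists[OF le Q absolutely_integrable_zero])
  obtain P P' where P: "primitive_on {-s..s} P P'" "primitive_on {-s..s} P' (\<lambda>x. Q x * P x + complex_of_real (q x) * v x)" "P (-s) = 0" "P' (-s) = 0"
    by (rule ivp_exists[OF le Q qv])
  \<comment> \<open>Otherwise \<open>N\<close> would continue to an eigenfunction with the non-real eigenvalue \<open>z\<close>.\<close>
  have ne: "N' s - \<i> * k * N s \<noteq> 0"
  proof
    assume "N' s - \<i> * k * N s = 0"
    then have bc: "N' (-s) = - \<i> * k * N (-s)" "N' s = \<i> * k * N s" using N by simp_all
    obtain W W' where W: "primitive_on UNIV W W'"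
      "primitive_on UNIV W' (\<lambda>x. if x \<in> {-s..s} then Q x * N x + 0 else - (k * k) * W x)" "L2 W" "L2 W'"
      "\<And>x. x \<in> {-s..s} \<Longrightarrow> W x = N x"
      by (rule exponential_extension[OF k(2) s N(1,2) bc]) blast
    have "primitive_on UNIV W' (\<lambda>x. complex_of_real (q x) * W x - z * W x - 0)"
      by (rule primitive_on_cong[OF W(2)]) (auto simp: Q_def W(5) q(2) k(1) algebra_simps intro!: AE_I2)
    then have "schroedinger_solution q z (\<lambda>x. 0) W W'" unfolding schroedinger_solution_def using W by blast
    from schroedinger_solution_bound[OF sq_integrable_zero this] have "\<bar>Im z\<bar> * l2norm W \<le> 0" by (simp add: l2norm_def)
    then have "l2norm W = 0" using Imz l2norm_nonneg[of W] by (simp add: mult_le_0_iff)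
    then have "norm (abs_l2 W) = 0" using norm_abs_l2_eq[OF W(3)] by simp
    then have "abs_l2 W = abs_l2 (\<lambda>x. 0)" by (simp add: zero_l2_def)
    from abs_l2_eqD[OF W(3) sq_integrable_zero this] have "AE x in lebesgue. x \<in> UNIV \<longrightarrow> W x = 0" by simp
    from AE_eq_continuous_imp_eq[OF open_UNIV primitive_on_continuous_open[OF W(1) open_UNIV] continuous_on_const this, of "- s"]
    show False using W(5)[of "- s"] N(3) s by simp
  qed
  define c where "c = - (P' s - \<i> * k * P s) / (N' s - \<i> * k * N s)"
  define w w' where "w x = P x + c * N x" and "w' x = P' x + c * N' x" for x
  have w: "primitive_on {-s..s} w w'" unfolding w_def w'_def
    by (rule primitive_on_add[OF P(1) primitive_on_cmult[OF N(1)]])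
  have w': "primitive_on {-s..s} w' (\<lambda>x. Q x * w x + complex_of_real (q x) * v x)" unfolding w'_def
    by (rule primitive_on_cong[OF primitive_on_add[OF P(2) primitive_on_cmult[OF N(2), of c]]])
       (auto simp: w_def algebra_simps intro!: AE_I2)
  have bc1: "w' (-s) = - \<i> * k * w (-s)" unfolding w_def w'_def using N P by simp
  have "w' s - \<i> * k * w s = (P' s - \<i> * k * P s) + c * (N' s - \<i> * k * N s)"
    unfolding w_def w'_def by (simp add: algebra_simps)
  also have "\<dots> = 0" unfolding c_def using ne by simp
  finally have bc2: "w' s = \<i> * k * w s" by simp
  obtain W W' where W: "primitive_on UNIV W W'"
      "primitive_on UNIV W' (\<lambda>x. if x \<in> {-s..s} then Q x * w x + complex_of_real (q x) * v x else - (k * k) * W x)" "L2 W" "L2 W'"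
      "\<And>x. x \<in> {-s..s} \<Longrightarrow> W x = w x"
      by (rule exponential_extension[OF k(2) s w w' bc1 bc2]) blast
  have "schroedinger_solution q z f (\<lambda>x. v x + W x) (\<lambda>x. v' x + W' x)"
    unfolding schroedinger_solution_def
  proof (intro conjI)
    show "primitive_on UNIV (\<lambda>x. v' x + W' x) (\<lambda>x. complex_of_real (q x) * (v x + W x) - z * (v x + W x) - f x)"
      by (rule primitive_on_cong[OF primitive_on_add[OF v(4) W(2)]])
         (auto simp: Q_def W(5) q(2) k(1) algebra_simps intro!: AE_I2)
  qed (intro primitive_on_add sq_integrable_add v W)+
  then show ?thesis by blast
qed

section \<open>The point interaction\<close>

text \<open>
  Since \<open>f\<close> is integrable up to the end point, a primitive on the closed half-line exists, and the
  limit \<open>l\<close> identifies it.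
\<close>

lemma primitive_on_closure_right:
  fixes F f :: "real \<Rightarrow> complex"
  assumes F: "primitive_on {c<..} F f" and f: "f absolutely_integrable_on {c..c+1}" and l: "(F \<longlongrightarrow> l) (at_right c)"
  shows "primitive_on {c..} (F(c := l)) f"
proof -
  have fi: "f absolutely_integrable_on {s..t}" if "{s..t} \<subseteq> {c..}" for s t
  proof (cases "s \<le> t")
    case True
    have "f absolutely_integrable_on {c+1..max t (c+1)}" by (rule primitive_onD(1)[OF F]) auto
    then have "f absolutely_integrable_on {c..max t (c+1)}"
      by (rule absolutely_integrable_on_combine[OF f]) auto
    then show ?thesis by (rule absolutely_integrable_on_subinterval) (use that True in auto)
  qed simp
  obtain G where G: "primitive_on {c..} G f" "G c = l"
    by (rule primitive_on_exists[of "{c..}" c f l]) (use fi in \<open>auto simp: is_interval_ci\<close>)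
  have const: "F x - G x = F (c+1) - G (c+1)" if "x > c" for x
  proof (cases "x \<le> c + 1")
    case True
    have "{x..c+1} \<subseteq> {c<..}" "{x..c+1} \<subseteq> {c..}" using that by auto
    then have "F (c+1) - F x = G (c+1) - G x"
      by (rule trans[OF sym[OF primitive_on_integral[OF F True]] primitive_on_integral[OF G(1) True]])
    then show ?thesis by (simp add: algebra_simps)
  next
    case False
    then have le: "c + 1 \<le> x" by simp
    have sub: "{c+1..x} \<subseteq> {c<..}" "{c+1..x} \<subseteq> {c..}" by auto
    have "F x - F (c+1) = G x - G (c+1)"
      using primitive_on_integral[OF F le sub(1)] primitive_on_integral[OF G(1) le sub(2)] by (rule trans[OF sym])
    then show ?thesis by (simp add: algebra_simps)
  qed
  have "continuous_on {c..c+1} G" by (rule primitive_on_continuous_Icc[OF G(1)]) auto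
  then have "(G \<longlongrightarrow> l) (at_right c)"
    using G(2) continuous_on_Icc_at_rightD[of c "c+1" G] by simp
  then have "((\<lambda>x. F x - G x) \<longlongrightarrow> l - l) (at_right c)" by (intro tendsto_diff l)
  moreover have "\<forall>\<^sub>F x in at_right c. F x - G x = F (c+1) - G (c+1)"
    by (rule eventually_mono[OF eventually_at_right_less const])
  then have "((\<lambda>x. F x - G x) \<longlongrightarrow> F (c+1) - G (c+1)) (at_right c)"
    by (rule tendsto_eventually)
  ultimately have "F (c+1) - G (c+1) = l - l"
    using tendsto_unique[OF trivial_limit_at_right_real] by metis
  then have "F (c+1) - G (c+1) = 0" by simp
  then have "F x = G x" if "x > c" for x using const[OF that] by simp
  then show ?thesis using G(2) by (intro primitive_on_cong[OF G(1)]) auto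
qed

lemma primitive_on_closure_left:
  fixes F f :: "real \<Rightarrow> complex"
  assumes F: "primitive_on {..<c} F f" and f: "f absolutely_integrable_on {c-1..c}" and l: "(F \<longlongrightarrow> l) (at_left c)"
  shows "primitive_on {..c} (F(c := l)) f"
proof -
  have 1: "primitive_on {- c<..} (\<lambda>x. F (- x)) (\<lambda>x. - f (- x))"
    by (rule primitive_on_reflect'[OF F]) simp
  have "(\<lambda>x. f (- x)) absolutely_integrable_on {- c..- c + 1}"
    using absolutely_integrable_reflect_real[where f = f and a = "c - 1" and b = c] f by simp
  then have 2: "(\<lambda>x. - f (- x)) absolutely_integrable_on {- c..- c + 1}"
    using absolutely_integrable_linear[OF _ bounded_linear_minus[OF bounded_linear_ident], where f = "\<lambda>x. f (- x)" and s = "{- c..- c + 1}"]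
    by (simp add: o_def)
  have 3: "((\<lambda>x. F (- x)) \<longlongrightarrow> l) (at_right (- c))" using l by (simp add: filterlim_at_left_to_right)
  have "primitive_on {..c} (\<lambda>x. ((\<lambda>x. F (- x))(- c := l)) (- x)) (\<lambda>x. - (- f (- (- x))))"
    by (rule primitive_on_reflect'[OF primitive_on_closure_right[OF 1 2 3]]) simp
  then show ?thesis by (rule primitive_on_cong) auto
qed

lemma primitive_on_remove_point:
  fixes F f :: "real \<Rightarrow> complex"
  assumes F: "primitive_on (- {0}) F f" and f: "f absolutely_integrable_on {-1..0}" "f absolutely_integrable_on {0..1}"
    and l: "(F \<longlongrightarrow> l) (at_left 0)" "(F \<longlongrightarrow> l) (at_right 0)"
  shows "primitive_on UNIV (F(0 := l)) f"
proof (rule primitive_on_combine[where c = 0])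
  have L: "primitive_on {..<0} F f" and R: "primitive_on {0<..} F f"
    by (rule primitive_on_subset[OF F], simp add: subset_Compl_singleton)+
  have f': "f absolutely_integrable_on {0 - 1..0}" "f absolutely_integrable_on {0..0 + 1}"
    using f by simp_all
  show "primitive_on (UNIV \<inter> {..0}) (F(0 := l)) f"
    unfolding Int_UNIV_left by (rule primitive_on_closure_left[OF L f'(1) l(1)])
  show "primitive_on (UNIV \<inter> {0..}) (F(0 := l)) f"
    unfolding Int_UNIV_left by (rule primitive_on_closure_right[OF R f'(2) l(2)])
qed

lemma primitive_on_punctured:
  assumes "primitive_on {0<..} F f" "primitive_on {..<0} F f"
  shows "primitive_on (- {0::real}) F f"
  unfolding primitive_on_def
proof (intro allI impI)
  fix s t :: real assume st: "s \<le> t" "{s..t} \<subseteq> - {0}"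
  have "0 \<notin> {s..t}" using subsetD[OF st(2), of 0] by (metis ComplD singletonI)
  then have "0 < s \<or> t < 0" by (simp only: atLeastAtMost_iff) linarith
  then have "{s..t} \<subseteq> {0<..} \<or> {s..t} \<subseteq> {..<0}" by auto
  then show "f absolutely_integrable_on {s..t} \<and> (f has_integral F t - F s) {s..t}"
    using primitive_onD[OF assms(1) st(1)] primitive_onD[OF assms(2) st(1)] by blast
qed

text \<open>The interface conditions, with \<open>a = y(0-)\<close> and \<open>b = y'(0+)\<close>.\<close>

definition interface :: "complex \<Rightarrow> (real \<Rightarrow> complex) \<Rightarrow> (real \<Rightarrow> complex) \<Rightarrow> complex \<Rightarrow> complex \<Rightarrow> bool" where
  "interface \<theta> y y' a b \<longleftrightarrow>
     (y \<longlongrightarrow> a) (at_left 0) \<and> (y \<longlongrightarrow> \<theta> * a) (at_right 0) \<and>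
     (y' \<longlongrightarrow> b) (at_right 0) \<and> (y' \<longlongrightarrow> \<theta> * b) (at_left 0)"

lemma S_theta_iff:
  "(Y, G) \<in> S_theta \<theta> \<longleftrightarrow>
    (\<exists>y y' y'' a b. Y = abs_l2 y \<and> G = abs_l2 (\<lambda>x. - y'' x) \<and>
       primitive_on (- {0}) y y' \<and> primitive_on (- {0}) y' y'' \<and> L2 y \<and> L2 y' \<and> L2 y'' \<and> interface \<theta> y y' a b)"
    (is "?L = ?R")
proof
  assume ?L
  then obtain y y' y'' a b where y: "Y = abs_l2 y" "G = abs_l2 (\<lambda>x. - y'' x)" "sobolev_W22 (- {0}) y y' y''"
    "continuous_on (- {0}) y" "continuous_on (- {0}) y'" "interface \<theta> y y' a b"
    unfolding S_theta_def interface_def by blast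
  have w: "weak_deriv_on (- {0}) y y'" "weak_deriv_on (- {0}) y' y''" and L: "L2 y" "L2 y'" "L2 y''"
    using y(3) unfolding sobolev_W22_def L2_punctured by blast+
  have pr: "primitive_on (- {0}) h h'" if h: "weak_deriv_on (- {0}) h h'" "continuous_on (- {0}) h" for h h'
  proof (rule primitive_on_punctured)
    show "primitive_on {0<..} h h'"
      by (rule weak_deriv_on_imp_primitive_on_continuous[of "{0<..}" 1 2 "- {0}"])
         (use h in \<open>auto simp: is_interval_oi intro: continuous_on_subset\<close>)
    show "primitive_on {..<0} h h'"
      by (rule weak_deriv_on_imp_primitive_on_continuous[of "{..<0}" "-2" "-1" "- {0}"])
         (use h in \<open>auto simp: is_interval_io intro: continuous_on_subset\<close>)
  qed
  show ?R using y(1,2,6) L pr[OF w(1) y(4)] pr[OF w(2) y(5)] by blast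
next
  assume ?R
  then obtain y y' y'' a b where y: "Y = abs_l2 y" "G = abs_l2 (\<lambda>x. - y'' x)"
    "primitive_on (- {0}) y y'" "primitive_on (- {0}) y' y''" "L2 y" "L2 y'" "L2 y''" "interface \<theta> y y' a b" by blast
  have op: "open (- {0::real})" by (rule open_Compl) simp
  have "sobolev_W22 (- {0}) y y' y''"
    unfolding sobolev_W22_def L2_punctured
    using y primitive_on_imp_weak_deriv_on[OF two_interval_exhaustible_punctured] by blast
  then show ?L
    unfolding S_theta_def using y primitive_on_continuous_open[OF y(3) op] primitive_on_continuous_open[OF y(4) op]
    unfolding interface_def by blast
qed

lemma linear_graph_S_theta: "linear_graph (S_theta \<theta>)"
  unfolding linear_graph_def
proof (intro conjI allI impI)
  fix Y G Y' G' assume A: "(Y, G) \<in> S_theta \<theta>" "(Y', G') \<in> S_theta \<theta>"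
  from A(1) obtain y y' y'' a b where
    y: "Y = abs_l2 y" "G = abs_l2 (\<lambda>x. - y'' x)" "primitive_on (- {0}) y y'" "primitive_on (- {0}) y' y''"
       "L2 y" "L2 y'" "L2 y''" "interface \<theta> y y' a b"
    unfolding S_theta_iff by (elim exE conjE)
  from A(2) obtain w w' w'' c d where
    w: "Y' = abs_l2 w" "G' = abs_l2 (\<lambda>x. - w'' x)" "primitive_on (- {0}) w w'" "primitive_on (- {0}) w' w''"
       "L2 w" "L2 w'" "L2 w''" "interface \<theta> w w' c d"
    unfolding S_theta_iff by (elim exE conjE)
  show "(Y + Y', G + G') \<in> S_theta \<theta>"
    unfolding S_theta_iff
  proof (rule exI[of _ "\<lambda>x. y x + w x"], rule exI[of _ "\<lambda>x. y' x + w' x"], rule exI[of _ "\<lambda>x. y'' x + w'' x"],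
      rule exI[of _ "a + c"], rule exI[of _ "b + d"], intro conjI)
    show "Y + Y' = abs_l2 (\<lambda>x. y x + w x)" unfolding y(1) w(1) by (rule abs_l2_ops(1)[OF y(5) w(5)])
    have "G + G' = abs_l2 (\<lambda>x. - y'' x + - w'' x)"
      unfolding y(2) w(2) by (rule abs_l2_ops(1)[OF sq_integrable_uminus[OF y(7)] sq_integrable_uminus[OF w(7)]])
    then show "G + G' = abs_l2 (\<lambda>x. - (y'' x + w'' x))" by (simp add: add.commute)
    show "interface \<theta> (\<lambda>x. y x + w x) (\<lambda>x. y' x + w' x) (a + c) (b + d)"
      using y(8) w(8) unfolding interface_def distrib_left by (intro conjI tendsto_add) (elim conjE; assumption)+
  qed (intro primitive_on_add sq_integrable_add y w)+
next
  fix r Y G assume "(Y, G) \<in> S_theta \<theta>"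
  then obtain y y' y'' a b where
    y: "Y = abs_l2 y" "G = abs_l2 (\<lambda>x. - y'' x)" "primitive_on (- {0}) y y'" "primitive_on (- {0}) y' y''"
       "L2 y" "L2 y'" "L2 y''" "interface \<theta> y y' a b"
    unfolding S_theta_iff by (elim exE conjE)
  have m: "r *\<^sub>R (\<theta> * c) = \<theta> * (r *\<^sub>R c)" for c by simp
  show "(r *\<^sub>R Y, r *\<^sub>R G) \<in> S_theta \<theta>"
    unfolding S_theta_iff
  proof (rule exI[of _ "\<lambda>x. r *\<^sub>R y x"], rule exI[of _ "\<lambda>x. r *\<^sub>R y' x"], rule exI[of _ "\<lambda>x. r *\<^sub>R y'' x"],
      rule exI[of _ "r *\<^sub>R a"], rule exI[of _ "r *\<^sub>R b"], intro conjI)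
    show "r *\<^sub>R Y = abs_l2 (\<lambda>x. r *\<^sub>R y x)" unfolding y(1) by (rule abs_l2_ops(4)[OF y(5) y(5)])
    have "r *\<^sub>R G = abs_l2 (\<lambda>x. r *\<^sub>R - y'' x)"
      unfolding y(2) by (rule abs_l2_ops(4)[OF sq_integrable_uminus[OF y(7)] sq_integrable_uminus[OF y(7)]])
    then show "r *\<^sub>R G = abs_l2 (\<lambda>x. - (r *\<^sub>R y'' x))" by (simp only: scaleR_minus_right)
    show "interface \<theta> (\<lambda>x. r *\<^sub>R y x) (\<lambda>x. r *\<^sub>R y' x) (r *\<^sub>R a) (r *\<^sub>R b)"
      using y(8) unfolding interface_def m[symmetric] by (intro conjI tendsto_scaleR tendsto_const) (elim conjE; assumption)+
  qed (intro primitive_on_linear[OF _ bounded_linear_scaleR_right] sq_integrable_scaleR y)+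
qed

definition interaction_solution ::
  "complex \<Rightarrow> complex \<Rightarrow> (real \<Rightarrow> complex) \<Rightarrow> (real \<Rightarrow> complex) \<Rightarrow> (real \<Rightarrow> complex) \<Rightarrow> complex \<Rightarrow> complex \<Rightarrow> bool" where
  "interaction_solution \<theta> z f y y' a b \<longleftrightarrow>
     primitive_on (- {0}) y y' \<and> primitive_on (- {0}) y' (\<lambda>x. - z * y x - f x) \<and> L2 y \<and> L2 y' \<and> interface \<theta> y y' a b"

lemma interaction_solutionD:
  assumes "interaction_solution \<theta> z f y y' a b"
  shows "primitive_on (- {0}) y y'" "primitive_on (- {0}) y' (\<lambda>x. - z * y x - f x)" "L2 y" "L2 y'" "interface \<theta> y y' a b"
  using assms unfolding interaction_solution_def by blast+

lemma S_theta_solution: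
  assumes f: "L2 f"
  shows "(\<exists>G. (Y, G) \<in> S_theta \<theta> \<and> G - scaleC_l2 z Y = abs_l2 f) \<longleftrightarrow>
    (\<exists>y y' a b. Y = abs_l2 y \<and> interaction_solution \<theta> z f y y' a b)"
proof
  assume "\<exists>G. (Y, G) \<in> S_theta \<theta> \<and> G - scaleC_l2 z Y = abs_l2 f"
  then obtain G where G0: "(Y, G) \<in> S_theta \<theta>" and G: "G - scaleC_l2 z Y = abs_l2 f" by blast
  from G0 obtain y y' y'' a b where
    y: "Y = abs_l2 y" "G = abs_l2 (\<lambda>x. - y'' x)" "primitive_on (- {0}) y y'" "primitive_on (- {0}) y' y''"
       "L2 y" "L2 y'" "L2 y''" "interface \<theta> y y' a b"
    unfolding S_theta_iff by (elim exE conjE)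
  note Lz = sq_integrable_cmult[OF y(5), of z] and Ly'' = sq_integrable_uminus[OF y(7)]
  have "abs_l2 (\<lambda>x. - y'' x - z * y x) = abs_l2 f"
    using G unfolding y(1,2) abs_l2_ops(3)[OF y(5) y(5)] abs_l2_ops(2)[OF Ly'' Lz] .
  from abs_l2_eqD[OF sq_integrable_diff[OF Ly'' Lz] f this]
  have ae: "AE x in lebesgue. x \<in> - {0} \<longrightarrow> - z * y x - f x = y'' x"
  proof (rule eventually_mono)
    fix x assume "- y'' x - z * y x = f x"
    then have "f x = - y'' x - z * y x" by (rule sym)
    then show "x \<in> - {0} \<longrightarrow> - z * y x - f x = y'' x" by (simp only:) simp
  qed
  have "interaction_solution \<theta> z f y y' a b"
    unfolding interaction_solution_def using y primitive_on_cong[OF y(4) _ ae] by blast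
  then show "\<exists>y y' a b. Y = abs_l2 y \<and> interaction_solution \<theta> z f y y' a b" using y(1) by blast
next
  assume "\<exists>y y' a b. Y = abs_l2 y \<and> interaction_solution \<theta> z f y y' a b"
  then obtain y y' a b where Y: "Y = abs_l2 y" and s: "interaction_solution \<theta> z f y y' a b" by blast
  note y = interaction_solutionD[OF s]
  have Ly'': "L2 (\<lambda>x. - z * y x - f x)" by (rule sq_integrable_diff[OF sq_integrable_cmult[OF y(3)] f])
  note Lz = sq_integrable_cmult[OF y(3), of z]
  have "(Y, abs_l2 (\<lambda>x. - (- z * y x - f x))) \<in> S_theta \<theta>"
    unfolding S_theta_iff
    by (rule exI[of _ y], rule exI[of _ y'], rule exI[of _ "\<lambda>x. - z * y x - f x"], rule exI[of _ a], rule exI[of _ b],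
        intro conjI refl Y y Ly'')
  moreover have "abs_l2 (\<lambda>x. - (- z * y x - f x)) - scaleC_l2 z Y = abs_l2 f"
    unfolding Y abs_l2_ops(3)[OF y(3) y(3)] abs_l2_ops(2)[OF sq_integrable_uminus[OF Ly''] Lz] by simp
  ultimately show "\<exists>G. (Y, G) \<in> S_theta \<theta> \<and> G - scaleC_l2 z Y = abs_l2 f" by blast
qed

lemma integrable_imp_absolutely_integrable_on_Icc:
  fixes g :: "real \<Rightarrow> complex"
  assumes "integrable lebesgue g" shows "g absolutely_integrable_on {a..b}"
  by (rule set_integrable_subset[of _ UNIV]) (use assms in \<open>simp_all add: set_integrable_def\<close>)

text \<open>
  For real \<open>\<theta>\<close> the one-sided limits of \<open>y' cnj y\<close> at the origin agree, so that the energy identities acquire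
  no boundary term there.
\<close>

lemma interaction_flux:
  assumes f: "L2 f" and s: "interaction_solution \<theta> z f y y' a b" and \<theta>: "cnj \<theta> = \<theta>"
  shows "primitive_on UNIV ((\<lambda>x. y' x * cnj (y x))(0 := \<theta> * b * cnj a))
    (\<lambda>x. (- z * y x - f x) * cnj (y x) + of_real ((cmod (y' x))\<^sup>2))"
proof -
  note y = interaction_solutionD[OF s]
  have Ly'': "L2 (\<lambda>x. - z * y x - f x)" by (rule sq_integrable_diff[OF sq_integrable_cmult[OF y(3)] f])
  have int: "integrable lebesgue (\<lambda>x. (- z * y x - f x) * cnj (y x) + complex_of_real ((cmod (y' x))\<^sup>2))"
    by (rule Bochner_Integration.integrable_add[OF L2_mult_integrable(1)[OF Ly'' L2_cnj(1)[OF y(3)]] integrable_of_real[OF L2D(2)[OF y(4)]]])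
  have lim: "(y \<longlongrightarrow> a) (at_left 0)" "(y \<longlongrightarrow> \<theta> * a) (at_right 0)" "(y' \<longlongrightarrow> b) (at_right 0)" "(y' \<longlongrightarrow> \<theta> * b) (at_left 0)"
    using y(5) unfolding interface_def by blast+
  show ?thesis
  proof (rule primitive_on_remove_point[OF primitive_on_flux[OF y(1,2)]])
    show "((\<lambda>x. y' x * cnj (y x)) \<longlongrightarrow> \<theta> * b * cnj a) (at_left 0)"
      by (rule tendsto_mult[OF lim(4) tendsto_cnj[OF lim(1)]])
    have "((\<lambda>x. y' x * cnj (y x)) \<longlongrightarrow> b * cnj (\<theta> * a)) (at_right 0)"
      by (rule tendsto_mult[OF lim(3) tendsto_cnj[OF lim(2)]])
    then show "((\<lambda>x. y' x * cnj (y x)) \<longlongrightarrow> \<theta> * b * cnj a) (at_right 0)"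
      by (simp add: \<theta> mult.assoc mult.left_commute)
  qed (rule integrable_imp_absolutely_integrable_on_Icc[OF int])+
qed

lemma AE_nonzero: "AE x in lebesgue. x \<noteq> (0::real)"
  using AE_not_in[of "{0}" lebesgue] negligible_iff_null_sets[of "{0::real}"] by simp

lemma interaction_solution_bound:
  assumes f: "L2 f" and s: "interaction_solution \<theta> z f y y' a b" and \<theta>: "cnj \<theta> = \<theta>"
  shows "\<bar>Im z\<bar> * l2norm y \<le> l2norm f"
    and "(l2norm y')\<^sup>2 \<le> l2norm (\<lambda>x. - z * y x - f x) * l2norm y"
proof -
  note y = interaction_solutionD[OF s]
  have Ly'': "L2 (\<lambda>x. - z * y x - f x)" by (rule sq_integrable_diff[OF sq_integrable_cmult[OF y(3)] f])
  note h = interaction_flux[OF assms]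
  show "\<bar>Im z\<bar> * l2norm y \<le> l2norm f"
  proof (rule flux_bound[OF y(3,4) f primitive_on_of_real_Im[OF h]])
    show "AE x in lebesgue. complex_of_real (Im (((\<lambda>x. y' x * cnj (y x))(0 := \<theta> * b * cnj a)) x)) = complex_of_real (Im (y' x * cnj (y x)))"
      by (rule eventually_mono[OF AE_nonzero]) simp
    show "AE x in lebesgue. complex_of_real (Im ((- z * y x - f x) * cnj (y x) + complex_of_real ((cmod (y' x))\<^sup>2)))
      = complex_of_real (- (Im z * (cmod (y x))\<^sup>2) - Im (f x * cnj (y x)))"
      unfolding cmod_power2 by (intro AE_I2) (simp add: algebra_simps power2_eq_square)
  qed
  show "(l2norm y')\<^sup>2 \<le> l2norm (\<lambda>x. - z * y x - f x) * l2norm y"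
    by (rule gradient_bound[OF y(3,4) Ly'' h eventually_mono[OF AE_nonzero] AE_I2]) simp_all
qed

text \<open>
  The solution is the free one plus decaying exponentials on both half-lines. The interface conditions
  are a linear system for their coefficients \<open>c\<close> and \<open>d\<close>, whose determinant is proportional to
  \<open>1 + \<theta>\<^sup>2\<close>.
\<close>

lemma interaction_solution_exists:
  assumes k: "k * k = z" "Im k > 0" and f: "L2 f" and \<theta>: "1 + \<theta> * \<theta> \<noteq> 0"
  shows "\<exists>y y' a b. interaction_solution \<theta> z f y y' a b"
proof -
  have k0: "k \<noteq> 0" using k by auto
  obtain v v' where v: "L2 v" "L2 v'" "primitive_on UNIV v v'" "primitive_on UNIV v' (\<lambda>x. - (k * k) * v x - f x)"
    by (rule free_resolvent_exists[OF k(2) f])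
  define A B where "A = (\<theta> - 1) * v 0" and "B = (1 - \<theta>) * v' 0 / (\<i> * k)"
  define c d where "c = (A + \<theta> * B) / (1 + \<theta> * \<theta>)" and "d = (B - \<theta> * A) / (1 + \<theta> * \<theta>)"
  have "c - \<theta> * d = A * (1 + \<theta> * \<theta>) / (1 + \<theta> * \<theta>)"
    unfolding c_def d_def times_divide_eq_right diff_divide_distrib[symmetric] by (simp add: algebra_simps)
  then have cA: "c - \<theta> * d = A" using \<theta> by simp
  have "\<theta> * c + d = B * (1 + \<theta> * \<theta>) / (1 + \<theta> * \<theta>)"
    unfolding c_def d_def times_divide_eq_right add_divide_distrib[symmetric] by (simp add: algebra_simps)
  then have "\<theta> * c + d = B" using \<theta> by simp
  then have cB: "\<i> * k * (\<theta> * c + d) = (1 - \<theta>) * v' 0" using k0 by (simp add: B_def)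
  define w where "w x = (if x > 0 then c * exp ((\<i> * k) * of_real (x - 0)) else d * exp ((- \<i> * k) * of_real (x - 0)))" for x :: real
  define w' where "w' x = (if x > 0 then (\<i> * k) * (c * exp ((\<i> * k) * of_real (x - 0))) else (- \<i> * k) * (d * exp ((- \<i> * k) * of_real (x - 0))))" for x :: real
  define tR tL where "tR C x = (if x \<ge> 0 then C * exp (\<i> * k * of_real (x - 0)) else 0)"
    and "tL C x = (if - x \<ge> 0 then C * exp (\<i> * k * of_real (- x - 0)) else 0)" for C and x :: real
  have LtR: "L2 (tR C)" for C unfolding tR_def[abs_def] by (rule exp_tail(1)[OF k(2)])
  have LtL: "L2 (tL C)" for C unfolding tL_def[abs_def] by (rule L2_reflect[OF exp_tail(1)[OF k(2)]])
  have ex: "\<i> * k * of_real (- x - 0) = (- \<i> * k) * of_real (x - 0)" for x by simp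
  have Lw: "L2 w"
    by (rule sq_integrable_AE[OF sq_integrable_add[OF LtR[of c] LtL[of d]] eventually_mono[OF AE_nonzero]])
       (simp add: w_def tR_def tL_def)
  have Lw': "L2 w'"
    by (rule sq_integrable_AE[OF sq_integrable_add[OF LtR[of "\<i> * k * c"] LtL[of "- \<i> * k * d"]] eventually_mono[OF AE_nonzero]])
       (simp add: w'_def tR_def tL_def)
  have w: "primitive_on (- {0}) w w'"
  proof (rule primitive_on_punctured)
    show "primitive_on {0<..} w w'"
      by (rule primitive_on_cong[OF primitive_on_exp[where C = c and c = "\<i> * k" and s = 0]]) (auto simp: w_def w'_def intro!: AE_I2)
    show "primitive_on {..<0} w w'"
      by (rule primitive_on_cong[OF primitive_on_exp[where C = d and c = "- \<i> * k" and s = 0]]) (auto simp: w_def w'_def intro!: AE_I2)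
  qed
  have w': "primitive_on (- {0}) w' (\<lambda>x. - (k * k) * w x)"
  proof (rule primitive_on_punctured)
    show "primitive_on {0<..} w' (\<lambda>x. - (k * k) * w x)"
      by (rule primitive_on_cong[OF primitive_on_cmult[where c = "\<i> * k", OF primitive_on_exp[where C = c and c = "\<i> * k" and s = 0]]])
         (auto simp: w_def w'_def algebra_simps intro!: AE_I2)
    show "primitive_on {..<0} w' (\<lambda>x. - (k * k) * w x)"
      by (rule primitive_on_cong[OF primitive_on_cmult[where c = "- \<i> * k", OF primitive_on_exp[where C = d and c = "- \<i> * k" and s = 0]]])
         (auto simp: w_def w'_def algebra_simps intro!: AE_I2)
  qed
  have e_lim: "((\<lambda>x. C * exp (l * complex_of_real (x - 0))) \<longlongrightarrow> C) (at 0 within S)" for C l :: complex and S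
  proof -
    have "((\<lambda>x. C * exp (l * complex_of_real (x - 0))) \<longlongrightarrow> C * exp (l * complex_of_real (0 - 0))) (at 0 within S)"
      by (intro tendsto_intros)
    then show ?thesis by simp
  qed
  have evR: "\<forall>\<^sub>F x in at_right (0::real). x > 0" by (rule eventually_at_right_less)
  have evL: "\<forall>\<^sub>F x in at_left (0::real). x < 0" by (simp add: eventually_at_filter)
  have wR: "(w \<longlongrightarrow> c) (at_right 0)"
    by (rule Lim_transform_eventually[OF e_lim[of c "\<i> * k"] eventually_mono[OF evR]]) (simp add: w_def)
  have wL: "(w \<longlongrightarrow> d) (at_left 0)"
    by (rule Lim_transform_eventually[OF e_lim[of d "- \<i> * k"] eventually_mono[OF evL]]) (simp add: w_def)
  have w'R: "(w' \<longlongrightarrow> \<i> * k * c) (at_right 0)"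
    by (rule Lim_transform_eventually[OF e_lim[of "\<i> * k * c" "\<i> * k"] eventually_mono[OF evR]]) (simp add: w'_def)
  have w'L: "(w' \<longlongrightarrow> - \<i> * k * d) (at_left 0)"
    by (rule Lim_transform_eventually[OF e_lim[of "- \<i> * k * d" "- \<i> * k"] eventually_mono[OF evL]]) (simp add: w'_def)
  have vc: "(h \<longlongrightarrow> h 0) (at 0 within S)" if "primitive_on UNIV h h'" for h h' :: "real \<Rightarrow> complex" and S
    using primitive_on_continuous_open[OF that open_UNIV] continuous_on_subset[of UNIV h]
    by (metis UNIV_I continuous_on_def tendsto_within_subset subset_UNIV)
  define a b where "a = v 0 + d" and "b = v' 0 + \<i> * k * c"
  have "\<theta> * a = v 0 + (A + \<theta> * d)" by (simp add: a_def A_def algebra_simps)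
  then have ta: "\<theta> * a = v 0 + c" using cA by (simp add: algebra_simps)
  have "\<theta> * b = v' 0 + (\<i> * k * (\<theta> * c + d) - (1 - \<theta>) * v' 0) + (- \<i> * k * d)" by (simp add: b_def algebra_simps)
  then have tb: "\<theta> * b = v' 0 + (- \<i> * k * d)" using cB by simp
  have "interaction_solution \<theta> z f (\<lambda>x. v x + w x) (\<lambda>x. v' x + w' x) a b"
    unfolding interaction_solution_def interface_def ta tb unfolding a_def b_def
  proof (intro conjI)
    show "primitive_on (- {0}) (\<lambda>x. v x + w x) (\<lambda>x. v' x + w' x)"
      by (rule primitive_on_add[OF primitive_on_subset[OF v(3) subset_UNIV] w])
    show "primitive_on (- {0}) (\<lambda>x. v' x + w' x) (\<lambda>x. - z * (v x + w x) - f x)"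
      by (rule primitive_on_cong[OF primitive_on_add[OF primitive_on_subset[OF v(4) subset_UNIV] w']])
         (auto simp: k(1) algebra_simps intro!: AE_I2)
  qed (intro sq_integrable_add v Lw Lw' tendsto_add vc[OF v(3)] vc[OF v(4)] wR wL w'R w'L)+
  then show ?thesis by blast
qed

text \<open>
  The increment is the integral of \<open>f\<close> over an interval of length \<open>\<epsilon>\<close>, so the Cauchy-Schwarz inequality
  applies.
\<close>

lemma one_sided_limit_bound:
  fixes F f :: "real \<Rightarrow> complex"
  assumes F: "primitive_on (- {0}) F f" and f: "L2 f" and \<epsilon>: "\<epsilon> > 0"
  shows "(F \<longlongrightarrow> l) (at_right 0) \<Longrightarrow> cmod (F \<epsilon> - l) \<le> sqrt \<epsilon> * l2norm f"
    and "(F \<longlongrightarrow> l) (at_left 0) \<Longrightarrow> cmod (F (- \<epsilon>) - l) \<le> sqrt \<epsilon> * l2norm f"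
proof -
  assume l: "(F \<longlongrightarrow> l) (at_right 0)"
  have "primitive_on {0<..} F f" by (rule primitive_on_subset[OF F]) (simp add: subset_Compl_singleton)
  from primitive_on_closure_right[OF this L2_absolutely_integrable_Icc[OF f] l]
  have "integral {0..\<epsilon>} f = F \<epsilon> - l"
    using primitive_on_integral[of "{0..}" "F(0 := l)" f 0 \<epsilon>] \<epsilon> by auto
  then show "cmod (F \<epsilon> - l) \<le> sqrt \<epsilon> * l2norm f"
    using L2_integral_bound[OF f, of 0 \<epsilon>] \<epsilon> by simp
next
  assume l: "(F \<longlongrightarrow> l) (at_left 0)"
  have "primitive_on {..<0} F f" by (rule primitive_on_subset[OF F]) (simp add: subset_Compl_singleton)
  from primitive_on_closure_left[OF this L2_absolutely_integrable_Icc[OF f] l]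
  have "integral {-\<epsilon>..0} f = l - F (- \<epsilon>)"
    using primitive_on_integral[of "{..0}" "F(0 := l)" f "- \<epsilon>" 0] \<epsilon> by auto
  then show "cmod (F (- \<epsilon>) - l) \<le> sqrt \<epsilon> * l2norm f"
    using L2_integral_bound[OF f, of "- \<epsilon>" 0] \<epsilon> by (simp add: norm_minus_commute)
qed

text \<open>
  The interface conditions, which hold at \<open>0\<plusminus>\<close>, persist at \<open>\<plusminus>\<epsilon>\<close> up to \<open>O(\<surd>\<epsilon>)\<close>.
\<close>

lemma interaction_estimates:
  assumes f: "L2 f" and s: "interaction_solution \<theta> z f y y' a b" and \<epsilon>: "\<epsilon> > 0"
  defines "y'' \<equiv> \<lambda>x. - z * y x - f x"
  shows "cmod (y \<epsilon> - \<theta> * y (- \<epsilon>)) \<le> (1 + cmod \<theta>) * (sqrt \<epsilon> * l2norm y')"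
    and "cmod (\<theta> * y' \<epsilon> - y' (- \<epsilon>)) \<le> (1 + cmod \<theta>) * (sqrt \<epsilon> * l2norm y'')"
    and "x \<noteq> 0 \<Longrightarrow> cmod (y x) \<le> l2norm y + l2norm y'"
    and "x \<noteq> 0 \<Longrightarrow> cmod (y' x) \<le> l2norm y' + l2norm y''"
proof -
  note y = interaction_solutionD[OF s, folded y''_def]
  have Ly'': "L2 y''" unfolding y''_def by (rule sq_integrable_diff[OF sq_integrable_cmult[OF y(3)] f])
  have lim: "(y \<longlongrightarrow> a) (at_left 0)" "(y \<longlongrightarrow> \<theta> * a) (at_right 0)" "(y' \<longlongrightarrow> b) (at_right 0)" "(y' \<longlongrightarrow> \<theta> * b) (at_left 0)"
    using y(5) unfolding interface_def by blast+
  have comb: "cmod (p - \<theta> * q) \<le> (1 + cmod \<theta>) * B" if "cmod p \<le> B" "cmod q \<le> B" for p q B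
  proof -
    have "cmod (p - \<theta> * q) \<le> cmod p + cmod \<theta> * cmod q" using norm_triangle_ineq4[of p "\<theta> * q"] by (simp add: norm_mult)
    also have "\<dots> \<le> B + cmod \<theta> * B" by (intro add_mono that mult_left_mono) auto
    finally show ?thesis by (simp add: algebra_simps)
  qed
  have eq: "y \<epsilon> - \<theta> * y (- \<epsilon>) = (y \<epsilon> - \<theta> * a) - \<theta> * (y (- \<epsilon>) - a)" by (simp add: algebra_simps)
  show "cmod (y \<epsilon> - \<theta> * y (- \<epsilon>)) \<le> (1 + cmod \<theta>) * (sqrt \<epsilon> * l2norm y')"
    unfolding eq by (rule comb[OF one_sided_limit_bound(1)[OF y(1,4) \<epsilon> lim(2)] one_sided_limit_bound(2)[OF y(1,4) \<epsilon> lim(1)]])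
  have eq': "\<theta> * y' \<epsilon> - y' (- \<epsilon>) = - ((y' (- \<epsilon>) - \<theta> * b) - \<theta> * (y' \<epsilon> - b))" by (simp add: algebra_simps)
  show "cmod (\<theta> * y' \<epsilon> - y' (- \<epsilon>)) \<le> (1 + cmod \<theta>) * (sqrt \<epsilon> * l2norm y'')"
    unfolding eq' norm_minus_cancel
    by (rule comb[OF one_sided_limit_bound(2)[OF y(2) Ly'' \<epsilon> lim(4)] one_sided_limit_bound(1)[OF y(2) Ly'' \<epsilon> lim(3)]])
  have sup: "cmod (h x) \<le> l2norm h + l2norm h'" if h: "primitive_on (- {0}) h h'" "L2 h" "L2 h'" and x: "x \<noteq> 0" for h h'
  proof (cases "x > 0")
    case True
    have "primitive_on {x..x+1} h h'" by (rule primitive_on_subset[OF h(1)]) (use True in \<open>simp add: subset_Compl_singleton\<close>)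
    then show ?thesis by (rule sup_bound_right[OF _ h(2,3)])
  next
    case False
    have "primitive_on {x-1..x} h h'" by (rule primitive_on_subset[OF h(1)]) (use False x in \<open>simp add: subset_Compl_singleton\<close>)
    then show ?thesis by (rule sup_bound_left[OF _ h(2,3)])
  qed
  show "cmod (y x) \<le> l2norm y + l2norm y'" if "x \<noteq> 0" by (rule sup[OF y(1,3,4) that])
  show "cmod (y' x) \<le> l2norm y' + l2norm y''" if "x \<noteq> 0" by (rule sup[OF y(2,4) Ly'' that])
qed

section \<open>The zero energy solutions on the support of the potential\<close>

lemma primitive_on_closed_interval:
  fixes F f :: "real \<Rightarrow> complex"
  assumes ab: "a < b" and F: "primitive_on {a<..<b} F f" and c: "continuous_on {a..b} F" and f: "f absolutely_integrable_on {a..b}"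
  shows "primitive_on {a..b} F f"
proof -
  define m where "m = (a + b) / 2"
  have m: "m \<in> {a<..<b}" using ab by (simp add: m_def)
  obtain G where G: "primitive_on {a..b} G f" "G m = F m"
    by (rule primitive_on_exists[of "{a..b}" m f "F m"])
       (use m absolutely_integrable_on_subinterval[OF f] in \<open>auto simp: is_interval_cc\<close>)
  have "F x - G x = 0" if x: "x \<in> {a<..<b}" for x
  proof (cases "x \<le> m")
    case True
    have "{x..m} \<subseteq> {a<..<b}" "{x..m} \<subseteq> {a..b}" using m x by auto
    then have "F m - F x = G m - G x"
      by (rule trans[OF sym[OF primitive_on_integral[OF F True]] primitive_on_integral[OF G(1) True]])
    then show ?thesis using G(2) by simp
  next
    case False
    then have le: "m \<le> x" by simp
    have "{m..x} \<subseteq> {a<..<b}" "{m..x} \<subseteq> {a..b}" using m x by auto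
    then have "F x - F m = G x - G m"
      by (rule trans[OF sym[OF primitive_on_integral[OF F le]] primitive_on_integral[OF G(1) le]])
    then show ?thesis using G(2) by simp
  qed
  moreover have cl: "closure {a<..<b} = {a..b}" using ab by simp
  moreover have "continuous_on (closure {a<..<b}) (\<lambda>x. F x - G x)"
    unfolding cl by (intro continuous_on_diff c primitive_on_continuous_Icc[OF G(1) order_refl])
  ultimately have "F x - G x = 0" if "x \<in> {a..b}" for x
    using continuous_constant_on_closure[of "{a<..<b}" "\<lambda>x. F x - G x" 0 x] that by simp
  then show ?thesis by (intro primitive_on_cong[OF G(1)]) auto
qed

text \<open>
  An eigenfunction cannot vanish at \<open>-1\<close>, where its derivative is zero, so it can be normalized to \<open>u1\<close>
  with \<open>u1 (-1) = 1\<close>. As \<open>V\<close> is real, \<open>u1\<close> and its conjugate have the same data at \<open>-1\<close>; hence \<open>u1\<close>,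
  and with it \<open>\<theta> = u1 1\<close>, is real. The identity \<open>\<theta> * u2' 1 = 1\<close> is the constancy of the Wronskian
  of \<open>u1\<close> and \<open>u2\<close>.
\<close>

lemma neumann_solutions:
  fixes V :: "real \<Rightarrow> real" and u :: "real \<Rightarrow> complex"
  assumes V: "(\<lambda>x. complex_of_real (V x)) absolutely_integrable_on {-1..1}" and u: "neumann_eigenfunction V 0 u"
    and \<theta>: "\<theta> = u 1 / u (-1)"
  obtains u1 u1' u2 u2' where
    "primitive_on {-1..1} u1 u1'" "primitive_on {-1..1} u1' (\<lambda>x. complex_of_real (V x) * u1 x)"
    "u1 (-1) = 1" "u1' (-1) = 0" "u1 1 = \<theta>" "u1' 1 = 0"
    "primitive_on {-1..1} u2 u2'" "primitive_on {-1..1} u2' (\<lambda>x. complex_of_real (V x) * u2 x)"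
    "u2 (-1) = 0" "u2' (-1) = 1" "\<theta> * u2' 1 = 1" "cnj \<theta> = \<theta>"
proof -
  let ?V = "\<lambda>x. complex_of_real (V x)"
  from u obtain u' u'' x0 where c: "continuous_on {-1..1} u" "continuous_on {-1..1} u'"
    and w: "weak_deriv_on {-1<..<1} u u'" "weak_deriv_on {-1<..<1} u' u''"
    and bc: "u' (-1) = 0" "u' 1 = 0"
    and ae: "AE x\<in>{-1<..<1} in lebesgue. 0 * u x = - u'' x + complex_of_real (V x) * u x"
    and x0: "x0 \<in> {-1..1}" "u x0 \<noteq> 0"
    unfolding neumann_eigenfunction_def neumann_op_def by blast
  have pr: "primitive_on {-1<..<1} h h'" if "weak_deriv_on {-1<..<1} h h'" "continuous_on {-1..1} h" for h h'
  proof (rule weak_deriv_on_imp_primitive_on_continuous[of "{-1<..<1}" 0 "1/2" "{-1<..<1}"])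
    show "continuous_on {-1<..<1} h" by (rule continuous_on_subset[OF that(2)]) auto
  qed (use that in \<open>auto simp: is_interval_oo\<close>)
  have Vu: "(\<lambda>x. ?V x * u x) absolutely_integrable_on {-1..1}"
    by (rule absolutely_integrable_mult_continuous(1)[OF V c(1)])
  have u1: "primitive_on {-1..1} u u'"
    by (rule primitive_on_closed_interval[OF _ pr[OF w(1) c(1)] c(1) absolutely_integrable_continuous_real[OF c(2)]]) simp
  have ae': "AE x in lebesgue. x \<in> {-1<..<1} \<longrightarrow> ?V x * u x = u'' x"
    by (rule eventually_mono[OF ae]) auto
  have "primitive_on {-1<..<1} u' (\<lambda>x. ?V x * u x)"
    by (rule primitive_on_cong[OF pr[OF w(2) c(2)] refl ae'])
  then have u2: "primitive_on {-1..1} u' (\<lambda>x. ?V x * u x)"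
    by (rule primitive_on_closed_interval[OF _ _ c(2) Vu, rotated]) simp
  have ne: "u (-1) \<noteq> 0"
    using solution_zero_data[OF V u1 u2, of "-1" x0] bc x0 by auto
  define c0 where "c0 = 1 / u (-1)"
  define w1 w1' where "w1 x = c0 * u x" and "w1' x = c0 * u' x" for x
  have W1: "primitive_on {-1..1} w1 w1'" unfolding w1_def w1'_def by (rule primitive_on_cmult[OF u1])
  have W1': "primitive_on {-1..1} w1' (\<lambda>x. ?V x * w1 x)"
    unfolding w1_def w1'_def by (rule primitive_on_cong[OF primitive_on_cmult[OF u2, of c0]]) (auto simp: algebra_simps)
  have d1: "w1 (-1) = 1" "w1' (-1) = 0" "w1 1 = \<theta>" "w1' 1 = 0"
    using ne bc by (simp_all add: w1_def w1'_def c0_def \<theta>)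
  obtain w2 w2' where W2: "primitive_on {-1..1} w2 w2'" "primitive_on {-1..1} w2' (\<lambda>x. ?V x * w2 x + 0)" "w2 (-1) = 0" "w2' (-1) = 1"
    by (rule ivp_exists[OF _ V absolutely_integrable_zero]) simp_all
  have W2': "primitive_on {-1..1} w2' (\<lambda>x. ?V x * w2 x)" using W2(2) by simp
  have wr: "\<theta> * w2' 1 = 1"
    using wronskian_const[OF W1 W1' W2(1) W2', of 1 "-1"] d1 W2(3,4) by simp
  have C1: "primitive_on {-1..1} (\<lambda>x. w1 x - cnj (w1 x)) (\<lambda>x. w1' x - cnj (w1' x))"
    by (rule primitive_on_diff[OF W1 primitive_on_linear[OF W1 bounded_linear_cnj]])
  have C2: "primitive_on {-1..1} (\<lambda>x. w1' x - cnj (w1' x)) (\<lambda>x. ?V x * (w1 x - cnj (w1 x)))"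
    by (rule primitive_on_cong[OF primitive_on_diff[OF W1' primitive_on_linear[OF W1' bounded_linear_cnj]]]) (auto simp: algebra_simps)
  have "w1 1 - cnj (w1 1) = 0"
    by (rule solution_zero_data[OF V C1 C2, of "-1"]) (use d1 in simp_all)
  then have "cnj \<theta> = \<theta>" using d1(3) by simp
  then show ?thesis using that[OF W1 W1' d1 W2(1) W2' W2(3,4) wr] by blast
qed

section \<open>Crossing the support of the potential\<close>

lemma scaled_potential:
  fixes V :: "real \<Rightarrow> real"
  assumes V: "(\<lambda>x. complex_of_real (V x)) absolutely_integrable_on {-1..1}" and \<epsilon>: "\<epsilon> > 0"
  shows "(\<lambda>x. complex_of_real ((1 / \<epsilon>\<^sup>2) * V (x / \<epsilon>))) absolutely_integrable_on {-\<epsilon>..\<epsilon>}"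
proof -
  obtain G where G: "primitive_on {-1..1} G (\<lambda>x. complex_of_real (V x))" "G 0 = 0"
    by (rule primitive_on_exists[of "{-1..1}" 0 "\<lambda>x. complex_of_real (V x)" 0])
       (use absolutely_integrable_on_subinterval[OF V] in \<open>auto simp: is_interval_cc\<close>)
  have sub: "{-\<epsilon>..\<epsilon>} \<subseteq> {\<epsilon> * -1..\<epsilon> * 1}" and le: "-\<epsilon> \<le> \<epsilon>" using \<epsilon> by simp_all
  have "(\<lambda>x. complex_of_real (V (x / \<epsilon>)) / complex_of_real \<epsilon>) absolutely_integrable_on {-\<epsilon>..\<epsilon>}"
    by (rule primitive_onD(1)[OF primitive_on_scale[OF G(1) \<epsilon>] le sub])
  then have "(\<lambda>x. complex_of_real (1 / \<epsilon>) * (complex_of_real (V (x / \<epsilon>)) / complex_of_real \<epsilon>)) absolutely_integrable_on {-\<epsilon>..\<epsilon>}"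
    using absolutely_integrable_linear[OF _ bounded_linear_mult_right] unfolding o_def by blast
  moreover have "(\<lambda>x. complex_of_real (1 / \<epsilon>) * (complex_of_real (V (x / \<epsilon>)) / complex_of_real \<epsilon>)) =
      (\<lambda>x. complex_of_real ((1 / \<epsilon>\<^sup>2) * V (x / \<epsilon>)))"
    by (simp add: fun_eq_iff power2_eq_square)
  ultimately show ?thesis by metis
qed

text \<open>
  Lagrange's identity between \<open>y\<close> and a rescaled zero energy solution: the bracket of the two is
  constant on \<open>[-\<epsilon>,\<epsilon>]\<close> up to an error of order \<open>\<surd>\<epsilon>\<close>.
\<close>

lemma rescaled_lagrange:
  fixes u u' y y' r :: "real \<Rightarrow> complex"
  assumes \<epsilon>: "\<epsilon> > 0"
    and u: "primitive_on {-1..1} u u'" "primitive_on {-1..1} u' (\<lambda>x. complex_of_real (V x) * u x)"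
    and M: "\<And>x. x \<in> {-1..1} \<Longrightarrow> cmod (u x) \<le> M"
    and y: "primitive_on {-\<epsilon>..\<epsilon>} y y'" "primitive_on {-\<epsilon>..\<epsilon>} y' (\<lambda>x. complex_of_real ((1 / \<epsilon>\<^sup>2) * V (x / \<epsilon>)) * y x + r x)"
    and r: "L2 r" and x: "x \<in> {-\<epsilon>..\<epsilon>}"
  shows "cmod ((u (x / \<epsilon>) * y' x - u' (x / \<epsilon>) / \<epsilon> * y x) - (u (-1) * y' (-\<epsilon>) - u' (-1) / \<epsilon> * y (-\<epsilon>)))
      \<le> M * sqrt (2 * \<epsilon>) * l2norm r"
proof -
  have M0: "M \<ge> 0" by (rule order_trans[OF norm_ge_zero M[of 0]]) simp
  have I: "{\<epsilon> * -1..\<epsilon> * 1} = {-\<epsilon>..\<epsilon>}" by simp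
  define U U' where "U x = u (x / \<epsilon>)" and "U' x = u' (x / \<epsilon>) / complex_of_real \<epsilon>" for x
  have U: "primitive_on {-\<epsilon>..\<epsilon>} U U'"
    using primitive_on_scale[OF u(1) \<epsilon>] unfolding I U_def[abs_def] U'_def[abs_def] .
  have U': "primitive_on {-\<epsilon>..\<epsilon>} U' (\<lambda>x. complex_of_real ((1 / \<epsilon>\<^sup>2) * V (x / \<epsilon>)) * U x)"
    by (rule primitive_on_cong[OF primitive_on_cmult[OF primitive_on_scale[OF u(2) \<epsilon>, unfolded I], of "1 / complex_of_real \<epsilon>"]])
       (auto simp: U_def U'_def power2_eq_square intro!: AE_I2)
  have ux: "-\<epsilon> \<le> x" "{-\<epsilon>..x} \<subseteq> {-\<epsilon>..\<epsilon>}" using x by auto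
  have cU: "continuous_on {-\<epsilon>..x} U" by (rule primitive_on_continuous_Icc[OF U ux(2)])
  have bU: "cmod (U s) \<le> M" if "s \<in> {-\<epsilon>..x}" for s
  proof -
    have "- \<epsilon> \<le> s" "s \<le> \<epsilon>" using that x by auto
    then have "s / \<epsilon> \<in> {-1..1}" using \<epsilon> by (simp add: pos_le_divide_eq pos_divide_le_eq)
    then show ?thesis unfolding U_def by (rule M)
  qed
  have "integral {-\<epsilon>..x} (\<lambda>x. U x * r x) = (U x * y' x - U' x * y x) - (U (-\<epsilon>) * y' (-\<epsilon>) - U' (-\<epsilon>) * y (-\<epsilon>))"
    by (rule primitive_on_integral[OF lagrange_identity[OF U U' y] ux])
  moreover have "cmod (integral {-\<epsilon>..x} (\<lambda>x. U x * r x)) \<le> M * sqrt (x - - \<epsilon>) * l2norm r"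
    by (rule L2_local_integral(2)[OF r cU M0 bU ux(1)])
  moreover have "M * sqrt (x - - \<epsilon>) * l2norm r \<le> M * sqrt (2 * \<epsilon>) * l2norm r"
    using x M0 l2norm_nonneg by (intro mult_right_mono mult_left_mono real_sqrt_le_mono) auto
  moreover have "- \<epsilon> / \<epsilon> = - 1" using \<epsilon> by simp
  ultimately show ?thesis unfolding U_def U'_def by (simp only:) 
qed

text \<open>
  The transfer conditions across the short interval. At \<open>x = \<epsilon>\<close> the two brackets are the interface
  conditions up to \<open>O(\<surd>\<epsilon>)\<close>; at a general point they determine \<open>y\<close> by Cramer's rule, because the
  Wronskian of \<open>u1\<close> and \<open>u2\<close> is one.
\<close>

lemma transfer_estimates:
  fixes y y' r u1 u1' u2 u2' :: "real \<Rightarrow> complex"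
  assumes \<epsilon>: "\<epsilon> > 0"
    and u1: "primitive_on {-1..1} u1 u1'" "primitive_on {-1..1} u1' (\<lambda>x. complex_of_real (V x) * u1 x)"
      "u1 (-1) = 1" "u1' (-1) = 0" "u1 1 = \<theta>" "u1' 1 = 0"
    and u2: "primitive_on {-1..1} u2 u2'" "primitive_on {-1..1} u2' (\<lambda>x. complex_of_real (V x) * u2 x)"
      "u2 (-1) = 0" "u2' (-1) = 1" "\<theta> * u2' 1 = 1"
    and bound: "\<forall>x\<in>{-1..1}. cmod (u1 x) \<le> M" "\<forall>x\<in>{-1..1}. cmod (u2 x) \<le> M"
    and y: "primitive_on {-\<epsilon>..\<epsilon>} y y'" "primitive_on {-\<epsilon>..\<epsilon>} y' (\<lambda>x. complex_of_real ((1 / \<epsilon>\<^sup>2) * V (x / \<epsilon>)) * y x + r x)"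
    and r: "L2 r" and \<rho>: "M * sqrt (2 * \<epsilon>) * l2norm r \<le> \<rho>"
  shows "cmod (\<theta> * y' \<epsilon> - y' (-\<epsilon>)) \<le> \<rho>"
    and "cmod (y \<epsilon> - \<theta> * y (-\<epsilon>)) \<le> \<epsilon> * (cmod \<theta> * (M * cmod (y' \<epsilon>) + \<rho>))"
    and "\<And>x. x \<in> {-\<epsilon>..\<epsilon>} \<Longrightarrow> cmod (y x) \<le> \<epsilon> * (M * (cmod (y' (-\<epsilon>)) + \<rho>)) + M * (cmod (y (-\<epsilon>)) + \<epsilon> * \<rho>)"
proof -
  have M: "\<And>x. x \<in> {-1..1} \<Longrightarrow> cmod (u1 x) \<le> M" "\<And>x. x \<in> {-1..1} \<Longrightarrow> cmod (u2 x) \<le> M"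
    using bound by blast+
  define A where "A x = u1 (x / \<epsilon>) * y' x - u1' (x / \<epsilon>) / \<epsilon> * y x" for x
  define B where "B x = u2 (x / \<epsilon>) * y' x - u2' (x / \<epsilon>) / \<epsilon> * y x" for x
  have M0: "M \<ge> 0" by (rule order_trans[OF norm_ge_zero M(1)[of 0]]) simp
  have A: "cmod (A x - y' (-\<epsilon>)) \<le> \<rho>" if "x \<in> {-\<epsilon>..\<epsilon>}" for x
    using order_trans[OF rescaled_lagrange[OF \<epsilon> u1(1,2) M(1) y r that] \<rho>] by (simp add: A_def u1(3,4))
  have B: "cmod (B x - (- (y (-\<epsilon>) / \<epsilon>))) \<le> \<rho>" if "x \<in> {-\<epsilon>..\<epsilon>}" for x
    using order_trans[OF rescaled_lagrange[OF \<epsilon> u2(1,2) M(2) y r that] \<rho>] by (simp add: B_def u2(3,4))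
  have e: "\<epsilon> \<in> {-\<epsilon>..\<epsilon>}" "\<epsilon> / \<epsilon> = 1" "complex_of_real \<epsilon> \<noteq> 0" using \<epsilon> by simp_all
  show "cmod (\<theta> * y' \<epsilon> - y' (-\<epsilon>)) \<le> \<rho>"
    using A[OF e(1)] unfolding A_def e(2) u1(5,6) by simp
  have "y \<epsilon> - \<theta> * y (-\<epsilon>) = complex_of_real \<epsilon> * (\<theta> * (u2 1 * y' \<epsilon> - (B \<epsilon> - (- (y (-\<epsilon>) / \<epsilon>)))))"
  proof -
    have "complex_of_real \<epsilon> * (\<theta> * (u2 1 * y' \<epsilon> - (B \<epsilon> - (- (y (-\<epsilon>) / \<epsilon>))))) = (\<theta> * u2' 1) * y \<epsilon> - \<theta> * y (-\<epsilon>)"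
      unfolding B_def e(2) using e(3) by (simp add: field_simps)
    then show ?thesis unfolding u2(5) by simp
  qed
  then have "cmod (y \<epsilon> - \<theta> * y (-\<epsilon>)) = \<epsilon> * (cmod \<theta> * cmod (u2 1 * y' \<epsilon> - (B \<epsilon> - (- (y (-\<epsilon>) / \<epsilon>)))))"
    using \<epsilon> by (simp only: norm_mult norm_of_real abs_of_pos)
  also have "\<dots> \<le> \<epsilon> * (cmod \<theta> * (M * cmod (y' \<epsilon>) + \<rho>))"
  proof (intro mult_left_mono)
    have "cmod (u2 1 * y' \<epsilon>) \<le> M * cmod (y' \<epsilon>)"
      unfolding norm_mult by (rule mult_right_mono) (use M(2)[of 1] in auto)
    then show "cmod (u2 1 * y' \<epsilon> - (B \<epsilon> - (- (y (-\<epsilon>) / \<epsilon>)))) \<le> M * cmod (y' \<epsilon>) + \<rho>"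
      by (rule order_trans[OF norm_triangle_ineq4 add_mono[OF _ B[OF e(1)]]])
  qed (use \<epsilon> in auto)
  finally show "cmod (y \<epsilon> - \<theta> * y (-\<epsilon>)) \<le> \<epsilon> * (cmod \<theta> * (M * cmod (y' \<epsilon>) + \<rho>))" .
  fix x assume x: "x \<in> {-\<epsilon>..\<epsilon>}"
  then have x1: "x / \<epsilon> \<in> {-1..1}" using \<epsilon> by (simp add: pos_le_divide_eq pos_divide_le_eq)
  have "u1 (x / \<epsilon>) * u2' (x / \<epsilon>) - u1' (x / \<epsilon>) * u2 (x / \<epsilon>) = 1"
    using wronskian_const[OF u1(1,2) u2(1,2) x1, of "-1"] u1(3,4) u2(3,4) by simp
  then have "y x = (u1 (x / \<epsilon>) * u2' (x / \<epsilon>) - u1' (x / \<epsilon>) * u2 (x / \<epsilon>)) * y x" by simp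
  also have "\<dots> = complex_of_real \<epsilon> * (u2 (x / \<epsilon>) * A x) - u1 (x / \<epsilon>) * (complex_of_real \<epsilon> * B x)"
    unfolding A_def B_def using e(3) by (simp add: field_simps)
  finally have "cmod (y x) \<le> \<epsilon> * (cmod (u2 (x / \<epsilon>)) * cmod (A x)) + cmod (u1 (x / \<epsilon>)) * (\<epsilon> * cmod (B x))"
    using norm_triangle_ineq4[of "complex_of_real \<epsilon> * (u2 (x / \<epsilon>) * A x)" "u1 (x / \<epsilon>) * (complex_of_real \<epsilon> * B x)"] \<epsilon>
    by (simp add: norm_mult)
  also have "\<dots> \<le> \<epsilon> * (M * (cmod (y' (-\<epsilon>)) + \<rho>)) + M * (cmod (y (-\<epsilon>)) + \<epsilon> * \<rho>)"
  proof (intro add_mono mult_left_mono mult_mono M x1)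
    have "cmod (A x) \<le> cmod (y' (-\<epsilon>)) + cmod (A x - y' (-\<epsilon>))" by (rule norm_triangle_sub)
    then show "cmod (A x) \<le> cmod (y' (-\<epsilon>)) + \<rho>" using A[OF x] by simp
    have "cmod (B x) \<le> cmod (- (y (-\<epsilon>) / \<epsilon>)) + cmod (B x - (- (y (-\<epsilon>) / \<epsilon>)))" by (rule norm_triangle_sub)
    also have "\<dots> \<le> cmod (y (-\<epsilon>)) / \<epsilon> + \<rho>" using B[OF x] \<epsilon> by (simp add: norm_divide)
    finally have "\<epsilon> * cmod (B x) \<le> \<epsilon> * (cmod (y (-\<epsilon>)) / \<epsilon> + \<rho>)" using \<epsilon> by simp
    then show "\<epsilon> * cmod (B x) \<le> cmod (y (-\<epsilon>)) + \<epsilon> * \<rho>" using \<epsilon> by (simp add: distrib_left)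
  qed (use \<epsilon> M0 in auto)
  finally show "cmod (y x) \<le> \<epsilon> * (M * (cmod (y' (-\<epsilon>)) + \<rho>)) + M * (cmod (y (-\<epsilon>)) + \<epsilon> * \<rho>)" .
qed

text \<open>
  The squares of the tails are explicitly integrable, and the middle part is supported in a set of measure
  \<open>2 \<epsilon>\<close>. The origin is exempt from the bound \<open>C\<close>, because the limit problem prescribes no value
  there.
\<close>

lemma l2norm_exponential_tails:
  fixes d :: "real \<Rightarrow> complex"
  assumes k: "Im k > 0" and \<epsilon>: "\<epsilon> > 0" and d: "L2 d"
    and R: "\<And>x. x \<ge> \<epsilon> \<Longrightarrow> d x = d \<epsilon> * exp (\<i> * k * of_real (x - \<epsilon>))"
    and L: "\<And>x. x \<le> - \<epsilon> \<Longrightarrow> d x = d (- \<epsilon>) * exp (\<i> * k * of_real (- \<epsilon> - x))"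
    and C: "C \<ge> 0" "\<And>x. x \<in> {-\<epsilon>..\<epsilon>} \<Longrightarrow> x \<noteq> 0 \<Longrightarrow> cmod (d x) \<le> C"
  shows "l2norm d \<le> (cmod (d \<epsilon>) + cmod (d (- \<epsilon>))) / sqrt (2 * Im k) + C * sqrt (2 * \<epsilon>)"
proof -
  define tR where "tR x = (if x \<ge> \<epsilon> then d \<epsilon> * exp (\<i> * k * of_real (x - \<epsilon>)) else 0)" for x
  define tL0 where "tL0 x = (if x \<ge> \<epsilon> then d (- \<epsilon>) * exp (\<i> * k * of_real (x - \<epsilon>)) else 0)" for x
  define tL where "tL x = tL0 (- x)" for x
  define S where "S = {-\<epsilon><..<\<epsilon>} - {0}"
  define mid where "mid x = (if x \<in> S then d x else 0)" for x
  have root: "l2norm g = c / sqrt (2 * Im k)" if "(l2norm g)\<^sup>2 = c\<^sup>2 / (2 * Im k)" "c \<ge> 0" for g and c :: real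
    using real_sqrt_unique[OF that(1) l2norm_nonneg] that(2) by (simp add: real_sqrt_divide)
  have tR: "L2 tR" "l2norm tR = cmod (d \<epsilon>) / sqrt (2 * Im k)"
    unfolding tR_def[abs_def] by (rule exp_tail(1)[OF k], rule root[OF exp_tail(2)[OF k] norm_ge_zero])
  have tL0: "L2 tL0" "l2norm tL0 = cmod (d (- \<epsilon>)) / sqrt (2 * Im k)"
    unfolding tL0_def[abs_def] by (rule exp_tail(1)[OF k], rule root[OF exp_tail(2)[OF k] norm_ge_zero])
  have tL: "L2 tL" "l2norm tL = cmod (d (- \<epsilon>)) / sqrt (2 * Im k)"
    unfolding tL_def[abs_def] using L2_reflect[OF tL0(1)] l2norm_reflect[OF tL0(1)] tL0(2) by simp_all
  have Sm: "S \<in> lmeasurable" "measure lebesgue S \<le> 2 * \<epsilon>"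
  proof -
    show S: "S \<in> lmeasurable" unfolding S_def
      by (rule fmeasurable_Diff) (simp_all add: lmeasurable_box[of "-\<epsilon>" \<epsilon>, unfolded box_real])
    have "measure lebesgue S \<le> measure lebesgue {-\<epsilon>..\<epsilon>}"
      by (rule measure_mono_fmeasurable) (use S in \<open>auto simp: S_def\<close>)
    then show "measure lebesgue S \<le> 2 * \<epsilon>" using \<epsilon> by simp
  qed
  have dm: "d \<in> borel_measurable (lebesgue_on S)"
    using L2D(1)[OF d] by (rule measurable_restrict_space1)
  have bC: "cmod (d x) \<le> C" if "x \<in> S" for x using that by (intro C(2)) (auto simp: S_def)
  have mid: "L2 mid" "l2norm mid \<le> C * sqrt (measure lebesgue S)"
    unfolding mid_def[abs_def] by (rule L2_indicator_bounded[OF Sm(1) dm C(1) bC], assumption)+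
  have mid2: "l2norm mid \<le> C * sqrt (2 * \<epsilon>)"
    by (rule order_trans[OF mid(2) mult_left_mono[OF real_sqrt_le_mono[OF Sm(2)] C(1)]])
  have ae: "AE x in lebesgue. d x = (tR x + tL x) + mid x"
  proof (rule eventually_mono[OF AE_nonzero])
    fix x :: real assume "x \<noteq> 0"
    consider "x \<ge> \<epsilon>" | "x \<le> - \<epsilon>" | "x \<in> {-\<epsilon><..<\<epsilon>}" by fastforce
    then show "d x = (tR x + tL x) + mid x"
    proof cases
      case 1
      then have "tL x = 0" "mid x = 0" using \<epsilon> by (simp_all add: tL_def tL0_def mid_def S_def)
      moreover have "tR x = d x" unfolding tR_def using 1 R[OF 1] by (simp only: if_True)
      ultimately show ?thesis by simp
    next
      case 2
      then have z: "tR x = 0" "mid x = 0" using \<epsilon> by (simp_all add: tR_def mid_def S_def)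
      have "- x - \<epsilon> = - \<epsilon> - x" "- x \<ge> \<epsilon>" using 2 by simp_all
      then have "tL x = d x" unfolding tL_def tL0_def using L[OF 2] by (simp only: if_True)
      with z show ?thesis by simp
    next
      case 3
      then show ?thesis using \<open>x \<noteq> 0\<close> by (simp add: tR_def tL_def tL0_def mid_def S_def)
    qed
  qed
  have "l2norm d = l2norm (\<lambda>x. (tR x + tL x) + mid x)" by (rule l2norm_cong_AE[OF d ae])
  also have "\<dots> \<le> l2norm (\<lambda>x. tR x + tL x) + l2norm mid"
    by (rule l2norm_add[OF sq_integrable_add[OF tR(1) tL(1)] mid(1)])
  also have "\<dots> \<le> (l2norm tR + l2norm tL) + C * sqrt (2 * \<epsilon>)"
    by (rule add_mono[OF l2norm_add[OF tR(1) tL(1)] mid2])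
  finally show ?thesis by (simp add: tR tL add_divide_distrib)
qed

section \<open>Norm resolvent convergence\<close>

text \<open>
  The difference \<open>d\<close> satisfies both interface conditions at \<open>\<plusminus>\<epsilon>\<close> up to \<open>O(\<surd>\<epsilon>)\<close> and is a decaying
  exponential beyond these points. This makes \<open>\<theta> d(\<epsilon>) + d(-\<epsilon>)\<close> and \<open>d(\<epsilon>) - \<theta> d(-\<epsilon>)\<close> small,
  and \<open>1 + \<theta>\<^sup>2 \<ge> 1\<close> allows solving for \<open>d(\<plusminus>\<epsilon>)\<close>. The energy identities control all norms by that of
  \<open>f\<close>, with constants that depend on \<open>z\<close> alone; \<open>V\<close> enters only through \<open>\<theta>\<close> and the bound \<open>M\<close>.
\<close>

lemma resolvent_difference_estimate:
  fixes V :: "real \<Rightarrow> real" and u1 u1' u2 u2' :: "real \<Rightarrow> complex"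
  assumes k: "k * k = z" "Im k > 0" and z: "z \<notin> \<real>" and V: "\<And>x. x \<notin> {-1..1} \<Longrightarrow> V x = 0"
    and u1: "primitive_on {-1..1} u1 u1'" "primitive_on {-1..1} u1' (\<lambda>x. complex_of_real (V x) * u1 x)"
      "u1 (-1) = 1" "u1' (-1) = 0" "u1 1 = \<theta>" "u1' 1 = 0"
    and u2: "primitive_on {-1..1} u2 u2'" "primitive_on {-1..1} u2' (\<lambda>x. complex_of_real (V x) * u2 x)"
      "u2 (-1) = 0" "u2' (-1) = 1" "\<theta> * u2' 1 = 1"
    and \<theta>: "cnj \<theta> = \<theta>"
  shows "\<exists>K\<ge>0. \<forall>\<epsilon> f y y' y0 y0' a b. 0 < \<epsilon> \<longrightarrow> \<epsilon> \<le> 1 \<longrightarrow> L2 f \<longrightarrow>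
       schroedinger_solution (\<lambda>x. (1 / \<epsilon>\<^sup>2) * V (x / \<epsilon>)) z f y y' \<longrightarrow> interaction_solution \<theta> z f y0 y0' a b \<longrightarrow>
       l2norm (\<lambda>x. y x - y0 x) \<le> K * sqrt \<epsilon> * l2norm f"
proof -
  have Imz: "\<bar>Im z\<bar> > 0" using z by (simp add: complex_is_Real_iff)
  have k0: "cmod k > 0" using k(2) by auto
  have "compact (u1 ` {-1..1} \<union> u2 ` {-1..1})"
    by (intro compact_Un compact_continuous_image primitive_on_continuous_Icc[OF u1(1) order_refl]
        primitive_on_continuous_Icc[OF u2(1) order_refl] compact_Icc)
  then obtain M where M0: "M > 0" and "\<forall>w \<in> u1 ` {-1..1} \<union> u2 ` {-1..1}. cmod w \<le> M"
    using compact_imp_bounded bounded_pos by metis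
  then have M: "\<forall>x\<in>{-1..1}. cmod (u1 x) \<le> M" "\<forall>x\<in>{-1..1}. cmod (u2 x) \<le> M" by blast+
  \<comment> \<open>In units of \<open>\<parallel>f\<parallel>\<close>, \<open>c1\<close> to \<open>c3\<close> bound the norms of the solutions, of their second derivatives (up to the potential) and of \<open>y0'\<close>; \<open>c4\<close> bounds \<open>d(\<plusminus>\<epsilon>)\<close>, \<open>c5\<close> and \<open>c6\<close> bound \<open>y(\<plusminus>\<epsilon>)\<close> and \<open>y'(\<plusminus>\<epsilon>)\<close>.\<close>
  define T where "T = 1 + cmod \<theta>"
  define c1 where "c1 = 1 / \<bar>Im z\<bar>"
  define c2 where "c2 = cmod z * c1 + 1"
  define c3 where "c3 = sqrt (c2 * c1)"
  define c4 where "c4 = sqrt (2 * Im k) * (2 * c1)"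
  define c5 where "c5 = c1 + c3 + c4"
  define c6 where "c6 = c3 + c2 + cmod k * c4"
  \<comment> \<open>The constant \<open>c9\<close> bounds \<open>y\<close> on \<open>[-\<epsilon>,\<epsilon>]\<close>; the others are for quantities that also carry a factor \<open>\<surd>\<epsilon>\<close>: the errors in the transfer conditions, in the two combinations of \<open>d(\<plusminus>\<epsilon>)\<close>, and \<open>d(\<plusminus>\<epsilon>)\<close> themselves.\<close>
  define c7 where "c7 = M * sqrt 2 * c2"
  define c8 where "c8 = cmod \<theta> * (M * c6 + c7)"
  define c9 where "c9 = M * (c6 + c7) + M * (c5 + c7)"
  define c10 where "c10 = (c7 + T * c2) / cmod k"
  define c11 where "c11 = c8 + T * c3"
  define c12 where "c12 = T * (c10 + c11)"
  define K where "K = 2 * c12 / sqrt (2 * Im k) + (c9 + (c1 + c3)) * sqrt 2"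
  have pos: "c1 \<ge> 0" "c2 \<ge> 0" "c3 \<ge> 0" "c4 \<ge> 0" "T \<ge> 1"
    using Imz k(2) by (simp_all add: c1_def c2_def c3_def c4_def T_def)
  have pos': "c5 \<ge> 0" "c6 \<ge> 0" "c7 \<ge> 0" using pos M0 by (simp_all add: c5_def c6_def c7_def)
  have pos'': "c8 \<ge> 0" "c9 \<ge> 0" "c10 \<ge> 0" using pos pos' M0 by (simp_all add: c8_def c9_def c10_def)
  have pos3: "c11 \<ge> 0" using pos pos'' by (simp add: c11_def)
  have pos4: "c12 \<ge> 0" using pos pos'' pos3 by (simp add: c12_def)
  have K0: "K \<ge> 0" using pos pos'' pos4 k(2) by (simp add: K_def)
  have est: "l2norm (\<lambda>x. y x - y0 x) \<le> K * sqrt \<epsilon> * l2norm f"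
    if \<epsilon>: "0 < \<epsilon>" "\<epsilon> \<le> 1" and f: "L2 f"
      and sy: "schroedinger_solution (\<lambda>x. (1 / \<epsilon>\<^sup>2) * V (x / \<epsilon>)) z f y y'" and s0: "interaction_solution \<theta> z f y0 y0' a b"
    for \<epsilon> f y y' y0 y0' a b
  proof -
    define F where "F = l2norm f"
    define e where "e = sqrt \<epsilon>"
    have F0: "F \<ge> 0" unfolding F_def by (rule l2norm_nonneg)
    have e0: "e > 0" "e \<le> 1" "\<epsilon> = e * e" using \<epsilon> by (simp_all add: e_def)
    have \<epsilon>e: "\<epsilon> \<le> e" unfolding e0(3) using e0(1,2) by (simp add: mult_left_le)
    have scale: "x \<le> c * e * F \<Longrightarrow> x \<le> c * F" if "c \<ge> 0" for x c
    proof -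
      assume "x \<le> c * e * F"
      also have "c * e * F \<le> c * 1 * F" using that F0 e0 by (intro mult_right_mono mult_left_mono) auto
      finally show "x \<le> c * F" by simp
    qed
    have y: "primitive_on UNIV y y'" "primitive_on UNIV y' (\<lambda>x. complex_of_real ((1 / \<epsilon>\<^sup>2) * V (x / \<epsilon>)) * y x - z * y x - f x)"
      "L2 y" "L2 y'" using sy unfolding schroedinger_solution_def by blast+
    note y0 = interaction_solutionD[OF s0]
    define r r0 where "r x = - z * y x - f x" and "r0 x = - z * y0 x - f x" for x
    have Lr: "L2 r" "L2 r0"
      unfolding r_def[abs_def] r0_def[abs_def] by (intro sq_integrable_diff sq_integrable_cmult y(3) y0(3) f)+
    have div: "l2norm w \<le> c1 * F" if "\<bar>Im z\<bar> * l2norm w \<le> l2norm f" for w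
      using that Imz by (simp add: c1_def F_def field_simps)
    have ny: "l2norm y \<le> c1 * F" by (rule div[OF schroedinger_solution_bound[OF f sy]])
    have ny0: "l2norm y0 \<le> c1 * F" by (rule div[OF interaction_solution_bound(1)[OF f s0 \<theta>]])
    have nres: "l2norm (\<lambda>x. - z * w x - f x) \<le> c2 * F" if "L2 w" "l2norm w \<le> c1 * F" for w
    proof -
      have "l2norm (\<lambda>x. - z * w x - f x) \<le> cmod (- z) * l2norm w + F"
        using l2norm_diff[OF sq_integrable_cmult[OF that(1)] f, of "- z"] unfolding l2norm_cmult F_def .
      also have "\<dots> \<le> cmod z * (c1 * F) + F" using that(2) by (simp add: mult_left_mono)
      finally show ?thesis by (simp add: c2_def algebra_simps)
    qed
    have nr: "l2norm r \<le> c2 * F" "l2norm r0 \<le> c2 * F"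
      unfolding r_def[abs_def] r0_def[abs_def] by (rule nres[OF y(3) ny], rule nres[OF y0(3) ny0])
    have ny0': "l2norm y0' \<le> c3 * F"
    proof (rule power2_le_imp_le)
      have "(l2norm y0')\<^sup>2 \<le> l2norm r0 * l2norm y0"
        using interaction_solution_bound(2)[OF f s0 \<theta>] unfolding r0_def[abs_def] .
      also have "\<dots> \<le> (c2 * F) * (c1 * F)" using nr(2) ny0 pos F0 by (intro mult_mono l2norm_nonneg) auto
      also have "\<dots> = (c3 * F)\<^sup>2" using pos by (simp add: c3_def power_mult_distrib power2_eq_square)
      finally show "(l2norm y0')\<^sup>2 \<le> (c3 * F)\<^sup>2" .
    qed (use pos F0 in simp)
    note ie = interaction_estimates[OF f s0 \<epsilon>(1)]
    have sup0: "cmod (y0 x) \<le> (c1 + c3) * F" if "x \<noteq> 0" for x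
      using order_trans[OF ie(3)[OF that] add_mono[OF ny0 ny0']] by (simp add: distrib_right)
    have sup0': "cmod (y0' x) \<le> (c3 + c2) * F" if "x \<noteq> 0" for x
      using order_trans[OF ie(4)[OF that] add_mono[OF ny0' nr(2)[unfolded r0_def[abs_def]]]] by (simp add: distrib_right)
    define d d' where "d x = y x - y0 x" and "d' x = y' x - y0' x" for x
    have Ld: "L2 d" "L2 d'" unfolding d_def[abs_def] d'_def[abs_def] by (intro sq_integrable_diff y(3,4) y0(3,4))+
    have nd: "l2norm d \<le> 2 * c1 * F"
      using order_trans[OF l2norm_diff[OF y(3) y0(3)] add_mono[OF ny ny0]] by (simp add: d_def[abs_def] mult_ac)
    have Voff: "V (x / \<epsilon>) = 0" if "x > \<epsilon> \<or> x < - \<epsilon>" for x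
      using that \<epsilon>(1) by (intro V) (auto simp: pos_le_divide_eq pos_divide_le_eq)
    have N: "AE x in lebesgue. x \<noteq> \<epsilon> \<and> x \<noteq> - \<epsilon>"
      using AE_not_in[of "{\<epsilon>, - \<epsilon>}" lebesgue] negligible_iff_null_sets[of "{\<epsilon>, - \<epsilon>}"] by simp
    have pd: "primitive_on (- {0}) d d'" unfolding d_def[abs_def] d'_def[abs_def]
      by (rule primitive_on_diff[OF primitive_on_subset[OF y(1) subset_UNIV] y0(1)])
    have pd': "primitive_on (- {0}) d' (\<lambda>x. complex_of_real ((1 / \<epsilon>\<^sup>2) * V (x / \<epsilon>)) * y x - z * d x)"
      unfolding d'_def[abs_def]
      by (rule primitive_on_cong[OF primitive_on_diff[OF primitive_on_subset[OF y(2) subset_UNIV] y0(2)]])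
         (auto simp: d_def algebra_simps intro!: AE_I2)
    have subs: "{\<epsilon>..} \<subseteq> - {0}" "{..- \<epsilon>} \<subseteq> - {0}" using \<epsilon>(1) by (simp_all add: subset_Compl_singleton)
    have pR: "primitive_on {\<epsilon>..} d' (\<lambda>x. - (k * k) * d x)"
      by (rule primitive_on_cong[OF primitive_on_subset[OF pd' subs(1)] refl eventually_mono[OF N]])
         (auto simp: k(1) Voff)
    have pL: "primitive_on {..- \<epsilon>} d' (\<lambda>x. - (k * k) * d x)"
      by (rule primitive_on_cong[OF primitive_on_subset[OF pd' subs(2)] refl eventually_mono[OF N]])
         (auto simp: k(1) Voff)
    \<comment> \<open>Square integrability gives \<open>d'(\<plusminus>\<epsilon>) = \<plusminus>\<i> k d(\<plusminus>\<epsilon>)\<close> and a first bound on \<open>d(\<plusminus>\<epsilon>)\<close>, not yet small.\<close>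
    note DR = decaying_solution_right[OF k(2) primitive_on_subset[OF pd subs(1)] pR Ld]
    note DL = decaying_solution_left[OF k(2) primitive_on_subset[OF pd subs(2)] pL Ld]
    have Dsq: "cmod w \<le> c4 * F" if "(cmod w)\<^sup>2 \<le> 2 * Im k * (l2norm d)\<^sup>2" for w
    proof (rule power2_le_imp_le)
      have "(l2norm d)\<^sup>2 \<le> (2 * c1 * F)\<^sup>2" by (intro power_mono nd l2norm_nonneg)
      then have "2 * Im k * (l2norm d)\<^sup>2 \<le> 2 * Im k * (2 * c1 * F)\<^sup>2" using k(2) by simp
      then have "(cmod w)\<^sup>2 \<le> 2 * Im k * (2 * c1 * F)\<^sup>2" using that by linarith
      also have "\<dots> = (c4 * F)\<^sup>2" using k(2) by (simp add: c4_def power_mult_distrib)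
      finally show "(cmod w)\<^sup>2 \<le> (c4 * F)\<^sup>2" .
    qed (use pos F0 in simp)
    note D = Dsq[OF DR(3)] Dsq[OF DL(3)]
    have d'_bd: "cmod (d' \<epsilon>) = cmod k * cmod (d \<epsilon>)" "cmod (d' (- \<epsilon>)) = cmod k * cmod (d (- \<epsilon>))"
      unfolding DR(1) DL(1) by (simp_all add: norm_mult)
    have nz: "\<epsilon> \<noteq> 0" "- \<epsilon> \<noteq> 0" using \<epsilon> by simp_all
    have ybd: "cmod (y x) \<le> c5 * F" if "x \<noteq> 0" "cmod (d x) \<le> c4 * F" for x
    proof -
      have "cmod (y x) \<le> cmod (y0 x) + cmod (d x)" unfolding d_def by (rule norm_triangle_sub)
      then show ?thesis using sup0[OF that(1)] that(2) by (simp add: c5_def distrib_right)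
    qed
    have y'bd: "cmod (y' x) \<le> c6 * F" if "x \<noteq> 0" "cmod (d' x) \<le> cmod k * (c4 * F)" for x
    proof -
      have "cmod (y' x) \<le> cmod (y0' x) + cmod (d' x)" unfolding d'_def by (rule norm_triangle_sub)
      then show ?thesis using sup0'[OF that(1)] that(2) by (simp add: c6_def distrib_right mult.assoc)
    qed
    have d'4: "cmod (d' \<epsilon>) \<le> cmod k * (c4 * F)" "cmod (d' (- \<epsilon>)) \<le> cmod k * (c4 * F)"
      unfolding d'_bd using D k0 by (simp_all add: mult_left_mono)
    note Y = ybd[OF nz(1) D(1)] ybd[OF nz(2) D(2)] y'bd[OF nz(1) d'4(1)] y'bd[OF nz(2) d'4(2)]
    have yI: "primitive_on {-\<epsilon>..\<epsilon>} y' (\<lambda>x. complex_of_real ((1 / \<epsilon>\<^sup>2) * V (x / \<epsilon>)) * y x + r x)"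
      by (rule primitive_on_cong[OF primitive_on_subset[OF y(2) subset_UNIV]]) (auto simp: r_def intro!: AE_I2)
    have \<rho>: "M * sqrt (2 * \<epsilon>) * l2norm r \<le> c7 * e * F"
    proof -
      have "M * sqrt (2 * \<epsilon>) * l2norm r \<le> M * sqrt (2 * \<epsilon>) * (c2 * F)"
        using nr(1) M0 \<epsilon> by (intro mult_left_mono) auto
      then show ?thesis by (simp add: c7_def e_def real_sqrt_mult algebra_simps)
    qed
    note te = transfer_estimates[OF \<epsilon>(1) u1 u2 M primitive_on_subset[OF y(1) subset_UNIV] yI Lr(1) \<rho>]
    have s7: "c7 * e * F \<le> c7 * F" "0 \<le> c7 * e * F" using scale[OF pos'(3) order_refl] pos' e0 F0 by simp_all
    have t2: "cmod (y \<epsilon> - \<theta> * y (-\<epsilon>)) \<le> c8 * e * F"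
    proof -
      have a: "M * cmod (y' \<epsilon>) + c7 * e * F \<le> M * (c6 * F) + c7 * F"
        by (rule add_mono[OF mult_left_mono[OF Y(3)] s7(1)]) (use M0 in simp)
      have "\<epsilon> * (cmod \<theta> * (M * cmod (y' \<epsilon>) + c7 * e * F)) \<le> e * (cmod \<theta> * (M * (c6 * F) + c7 * F))"
        by (rule mult_mono[OF \<epsilon>e mult_left_mono[OF a norm_ge_zero]]) (use e0 M0 s7(2) in simp_all)
      also have "\<dots> = c8 * e * F" by (simp add: c8_def algebra_simps)
      finally show ?thesis by (rule order_trans[OF te(2)])
    qed
    have t3: "cmod (y x) \<le> c9 * F" if "x \<in> {-\<epsilon>..\<epsilon>}" for x
    proof -
      have e1: "\<epsilon> * (M * (cmod (y' (-\<epsilon>)) + c7 * e * F)) \<le> 1 * (M * (c6 * F + c7 * F))"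
        by (rule mult_mono[OF \<epsilon>(2) mult_left_mono[OF add_mono[OF Y(4) s7(1)]]]) (use M0 s7(2) in simp_all)
      have "\<epsilon> * (c7 * e * F) \<le> 1 * (c7 * F)"
        by (rule mult_mono[OF \<epsilon>(2) s7(1)]) (use s7(2) in simp_all)
      then have e2: "M * (cmod (y (-\<epsilon>)) + \<epsilon> * (c7 * e * F)) \<le> M * (c5 * F + 1 * (c7 * F))"
        by (rule mult_left_mono[OF add_mono[OF Y(2)]]) (use M0 in simp)
      have "cmod (y x) \<le> 1 * (M * (c6 * F + c7 * F)) + M * (c5 * F + 1 * (c7 * F))"
        by (rule order_trans[OF te(3)[OF that] add_mono[OF e1 e2]])
      also have "\<dots> = c9 * F" by (simp add: c9_def algebra_simps)
      finally show ?thesis .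
    qed
    have i1: "cmod (y0 \<epsilon> - \<theta> * y0 (- \<epsilon>)) \<le> T * c3 * e * F"
    proof -
      have "(1 + cmod \<theta>) * (sqrt \<epsilon> * l2norm y0') \<le> T * (e * (c3 * F))"
        unfolding T_def e_def by (intro mult_left_mono ny0') (use \<epsilon> in simp_all)
      also have "\<dots> = T * c3 * e * F" by simp
      finally show ?thesis by (rule order_trans[OF ie(1)])
    qed
    have i2: "cmod (\<theta> * y0' \<epsilon> - y0' (- \<epsilon>)) \<le> T * c2 * e * F"
    proof -
      have "(1 + cmod \<theta>) * (sqrt \<epsilon> * l2norm r0) \<le> T * (e * (c2 * F))"
        unfolding T_def e_def by (intro mult_left_mono nr(2)) (use \<epsilon> in simp_all)
      also have "\<dots> = T * c2 * e * F" by simp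
      finally show ?thesis by (rule order_trans[OF ie(2)[folded r0_def[abs_def]]])
    qed
    define P Q where "P = \<theta> * d \<epsilon> + d (- \<epsilon>)" and "Q = d \<epsilon> - \<theta> * d (- \<epsilon>)"
    have Pb: "cmod P \<le> c10 * e * F"
    proof -
      have "\<i> * k * P = (\<theta> * y' \<epsilon> - y' (- \<epsilon>)) - (\<theta> * y0' \<epsilon> - y0' (- \<epsilon>))"
        using DR(1) DL(1) unfolding P_def d'_def by (simp add: algebra_simps)
      then have "cmod k * cmod P \<le> cmod (\<theta> * y' \<epsilon> - y' (- \<epsilon>)) + cmod (\<theta> * y0' \<epsilon> - y0' (- \<epsilon>))"
        using norm_triangle_ineq4[of "\<theta> * y' \<epsilon> - y' (- \<epsilon>)" "\<theta> * y0' \<epsilon> - y0' (- \<epsilon>)"]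
        by (metis norm_mult norm_ii mult_1)
      also have "\<dots> \<le> c7 * e * F + T * c2 * e * F" by (rule add_mono[OF te(1) i2])
      finally show ?thesis using k0 by (simp add: c10_def field_simps)
    qed
    have Qb: "cmod Q \<le> c11 * e * F"
    proof -
      have "Q = (y \<epsilon> - \<theta> * y (- \<epsilon>)) - (y0 \<epsilon> - \<theta> * y0 (- \<epsilon>))" by (simp add: Q_def d_def algebra_simps)
      then have "cmod Q \<le> cmod (y \<epsilon> - \<theta> * y (- \<epsilon>)) + cmod (y0 \<epsilon> - \<theta> * y0 (- \<epsilon>))"
        by (simp only: norm_triangle_ineq4)
      also have "\<dots> \<le> c8 * e * F + T * c3 * e * F" by (rule add_mono[OF t2 i1])
      finally show ?thesis by (simp add: c11_def algebra_simps)
    qed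
    have det: "1 \<le> cmod (1 + \<theta> * \<theta>)"
    proof -
      have "\<theta> = complex_of_real (Re \<theta>)" using \<theta> by (metis Reals_cnj_iff of_real_Re)
      then have "1 + \<theta> * \<theta> = complex_of_real (1 + Re \<theta> * Re \<theta>)" by (metis of_real_1 of_real_add of_real_mult)
      then show ?thesis by (simp only: norm_of_real) simp
    qed
    have bound12: "cmod w \<le> c12 * e * F" if "cmod ((1 + \<theta> * \<theta>) * w) \<le> T * (cmod P + cmod Q)" for w
    proof -
      have "1 * cmod w \<le> cmod (1 + \<theta> * \<theta>) * cmod w" by (rule mult_right_mono[OF det norm_ge_zero])
      also have "\<dots> \<le> T * (cmod P + cmod Q)" using that by (simp add: norm_mult)
      also have "\<dots> \<le> T * (c10 * e * F + c11 * e * F)" using pos by (intro mult_left_mono add_mono Pb Qb) auto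
      finally show ?thesis by (simp add: c12_def algebra_simps)
    qed
    have "(1 + \<theta> * \<theta>) * d \<epsilon> = \<theta> * P + Q" by (simp add: P_def Q_def algebra_simps)
    then have "cmod ((1 + \<theta> * \<theta>) * d \<epsilon>) \<le> cmod \<theta> * cmod P + cmod Q"
      using norm_triangle_ineq[of "\<theta> * P" Q] by (simp add: norm_mult)
    also have "\<dots> \<le> T * (cmod P + cmod Q)" by (simp add: T_def algebra_simps)
    finally have dR: "cmod (d \<epsilon>) \<le> c12 * e * F" by (rule bound12)
    have "(1 + \<theta> * \<theta>) * d (- \<epsilon>) = P - \<theta> * Q" by (simp add: P_def Q_def algebra_simps)
    then have "cmod ((1 + \<theta> * \<theta>) * d (- \<epsilon>)) \<le> cmod P + cmod \<theta> * cmod Q"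
      using norm_triangle_ineq4[of P "\<theta> * Q"] by (simp add: norm_mult)
    also have "\<dots> \<le> T * (cmod P + cmod Q)" by (simp add: T_def algebra_simps)
    finally have dL: "cmod (d (- \<epsilon>)) \<le> c12 * e * F" by (rule bound12)
    have inner: "cmod (d x) \<le> (c9 + (c1 + c3)) * F" if "x \<in> {-\<epsilon>..\<epsilon>}" "x \<noteq> 0" for x
    proof -
      have "cmod (d x) \<le> cmod (y x) + cmod (y0 x)" unfolding d_def by (rule norm_triangle_ineq4)
      then show ?thesis using t3[OF that(1)] sup0[OF that(2)] by (simp add: algebra_simps)
    qed
    have "l2norm d \<le> (cmod (d \<epsilon>) + cmod (d (- \<epsilon>))) / sqrt (2 * Im k) + ((c9 + (c1 + c3)) * F) * sqrt (2 * \<epsilon>)"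
      by (rule l2norm_exponential_tails[OF k(2) \<epsilon>(1) Ld(1) DR(2) DL(2) _ inner]) (use pos pos'' F0 in simp_all)
    also have "\<dots> \<le> (c12 * e * F + c12 * e * F) / sqrt (2 * Im k) + ((c9 + (c1 + c3)) * F) * sqrt (2 * \<epsilon>)"
      using dR dL k(2) by (intro add_mono divide_right_mono) auto
    also have "\<dots> = K * e * F"
      unfolding K_def real_sqrt_mult e_def[symmetric] by (simp add: field_simps)
    finally show ?thesis unfolding d_def[abs_def] e_def F_def .
  qed
  show ?thesis by (rule exI[of _ K], intro conjI allI impI K0, rule est)
qed

theorem theorem2p2:
  fixes V :: "real \<Rightarrow> real" and u :: "real \<Rightarrow> complex" and \<theta> :: complex
  assumes "integrable lebesgue V"
    and "compact (closure {x. V x \<noteq> 0})" and "closure {x. V x \<noteq> 0} \<subseteq> {-1..1}"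
    and "neumann_eigenfunction V 0 u"
    and "\<theta> = u 1 / u (-1)"
  shows "norm_resolvent_convergent (S_eps V) (S_theta \<theta>)"
proof -
  have V0: "V x = 0" if "x \<notin> {-1..1}" for x
    using assms(3) closure_subset[of "{x. V x \<noteq> 0}"] that by blast
  have Vi: "(\<lambda>x. complex_of_real (V x)) absolutely_integrable_on {-1..1}"
    by (rule integrable_imp_absolutely_integrable_on_Icc[OF integrable_of_real[OF assms(1)]])
  obtain u1 u1' u2 u2' where u1:
      "primitive_on {-1..1} u1 u1'" "primitive_on {-1..1} u1' (\<lambda>x. complex_of_real (V x) * u1 x)"
      "u1 (-1) = 1" "u1' (-1) = 0" "u1 1 = \<theta>" "u1' 1 = 0"
    and u2: "primitive_on {-1..1} u2 u2'" "primitive_on {-1..1} u2' (\<lambda>x. complex_of_real (V x) * u2 x)"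
      "u2 (-1) = 0" "u2' (-1) = 1" "\<theta> * u2' 1 = 1" and \<theta>: "cnj \<theta> = \<theta>"
    by (rule neumann_solutions[OF Vi assms(4,5)])
  have det: "1 + \<theta> * \<theta> \<noteq> 0"
  proof -
    have "\<theta> = complex_of_real (Re \<theta>)" using \<theta> by (metis Reals_cnj_iff of_real_Re)
    then have e: "1 + \<theta> * \<theta> = complex_of_real (1 + Re \<theta> * Re \<theta>)" by (metis of_real_1 of_real_add of_real_mult)
    have "1 + Re \<theta> * Re \<theta> > 0" by (simp add: add_pos_nonneg)
    then show ?thesis unfolding e by (simp only: of_real_eq_0_iff)
  qed
  show ?thesis
    unfolding norm_resolvent_convergent_def
  proof (intro allI impI)
    fix z :: complex assume z: "z \<notin> \<real>"
    have Imz: "\<bar>Im z\<bar> > 0" using z by (simp add: complex_is_Real_iff)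
    obtain k where k: "k * k = z" "Im k > 0" by (rule complex_sqrt_upper[OF z])
    have R0: "\<exists>R. has_resolvent (S_theta \<theta>) z R"
    proof (rule has_resolvent_exists[OF linear_graph_S_theta, where z = z and C = "1 / \<bar>Im z\<bar>"])
      show "\<exists>Y G. (Y, G) \<in> S_theta \<theta> \<and> G - scaleC_l2 z Y = f" for f
      proof (cases f rule: l2_cases)
        fix g assume g: "f = abs_l2 g" "L2 g"
        show ?thesis unfolding g(1) using interaction_solution_exists[OF k g(2) det] S_theta_solution[OF g(2)] by blast
      qed
      show "norm Y \<le> 1 / \<bar>Im z\<bar> * norm (G - scaleC_l2 z Y)" if A: "(Y, G) \<in> S_theta \<theta>" for Y G
      proof (cases "G - scaleC_l2 z Y" rule: l2_cases)
        fix g assume g: "G - scaleC_l2 z Y = abs_l2 g" "L2 g"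
        then obtain y y' a b where y: "Y = abs_l2 y" "interaction_solution \<theta> z g y y' a b"
          using A S_theta_solution[OF g(2)] by blast
        have "\<bar>Im z\<bar> * l2norm y \<le> l2norm g" by (rule interaction_solution_bound(1)[OF g(2) y(2) \<theta>])
        then show ?thesis
          unfolding g(1) unfolding y(1) norm_abs_l2_eq[OF g(2)] norm_abs_l2_eq[OF interaction_solutionD(3)[OF y(2)]]
          using Imz by (simp add: field_simps)
      qed
    qed blast
    have R\<epsilon>: "\<exists>R. has_resolvent (S_eps V \<epsilon>) z R" if \<epsilon>: "\<epsilon> > 0" for \<epsilon>
      unfolding S_eps_def
    proof (rule has_resolvent_exists[OF linear_graph_schroedinger_op, where z = z and C = "1 / \<bar>Im z\<bar>"])
      let ?q = "\<lambda>x. (1 / \<epsilon>\<^sup>2) * V (x / \<epsilon>)"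
      have q0: "?q x = 0" if "x \<notin> {-\<epsilon>..\<epsilon>}" for x
        using that \<epsilon> V0[of "x / \<epsilon>"] by (auto simp: pos_le_divide_eq pos_divide_le_eq)
      show "\<exists>Y G. (Y, G) \<in> schroedinger_op ?q \<and> G - scaleC_l2 z Y = f" for f
      proof (cases f rule: l2_cases)
        fix g assume g: "f = abs_l2 g" "L2 g"
        show ?thesis unfolding g(1)
          using schroedinger_solution_exists[OF k z \<epsilon> scaled_potential[OF Vi \<epsilon>] q0 g(2)] schroedinger_op_solution[OF g(2)] by blast
      qed
      show "norm Y \<le> 1 / \<bar>Im z\<bar> * norm (G - scaleC_l2 z Y)" if A: "(Y, G) \<in> schroedinger_op ?q" for Y G
      proof (cases "G - scaleC_l2 z Y" rule: l2_cases)
        fix g assume g: "G - scaleC_l2 z Y = abs_l2 g" "L2 g"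
        then obtain y y' where y: "Y = abs_l2 y" "schroedinger_solution ?q z g y y'"
          using A schroedinger_op_solution[OF g(2)] by blast
        have Ly: "L2 y" using y(2) unfolding schroedinger_solution_def by blast
        have "\<bar>Im z\<bar> * l2norm y \<le> l2norm g" by (rule schroedinger_solution_bound[OF g(2) y(2)])
        then show ?thesis
          unfolding g(1) unfolding y(1) norm_abs_l2_eq[OF g(2)] norm_abs_l2_eq[OF Ly]
          using Imz by (simp add: field_simps)
      qed
    qed blast
    obtain K where K: "K \<ge> 0"
      "\<forall>\<epsilon> f y y' y0 y0' a b. 0 < \<epsilon> \<longrightarrow> \<epsilon> \<le> 1 \<longrightarrow> L2 f \<longrightarrow>
       schroedinger_solution (\<lambda>x. (1 / \<epsilon>\<^sup>2) * V (x / \<epsilon>)) z f y y' \<longrightarrow> interaction_solution \<theta> z f y0 y0' a b \<longrightarrow>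
       l2norm (\<lambda>x. y x - y0 x) \<le> K * sqrt \<epsilon> * l2norm f"
    proof -
      have "\<exists>K\<ge>0. \<forall>\<epsilon> f y y' y0 y0' a b. 0 < \<epsilon> \<longrightarrow> \<epsilon> \<le> 1 \<longrightarrow> L2 f \<longrightarrow>
         schroedinger_solution (\<lambda>x. (1 / \<epsilon>\<^sup>2) * V (x / \<epsilon>)) z f y y' \<longrightarrow> interaction_solution \<theta> z f y0 y0' a b \<longrightarrow>
         l2norm (\<lambda>x. y x - y0 x) \<le> K * sqrt \<epsilon> * l2norm f"
        by (rule resolvent_difference_estimate[OF k z V0 u1 u2 \<theta>])
      then show ?thesis using that by (elim exE conjE)
    qed
    have le: "norm (resolvent (S_eps V \<epsilon>) z - resolvent (S_theta \<theta>) z) \<le> K * sqrt \<epsilon>" if \<epsilon>: "0 < \<epsilon>" "\<epsilon> \<le> 1" for \<epsilon>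
    proof -
      obtain R1 R2 where R: "has_resolvent (S_eps V \<epsilon>) z R1" "has_resolvent (S_theta \<theta>) z R2"
        using R\<epsilon>[OF \<epsilon>(1)] R0 by blast
      show ?thesis
      proof (rule norm_resolvent_diff_le[OF R])
        fix f Y G Y' G'
        assume A: "(Y, G) \<in> S_eps V \<epsilon>" "G - scaleC_l2 z Y = f" "(Y', G') \<in> S_theta \<theta>" "G' - scaleC_l2 z Y' = f"
        obtain g where g: "f = abs_l2 g" "L2 g" by (rule l2_cases)
        obtain y y' where y: "Y = abs_l2 y" "schroedinger_solution (\<lambda>x. (1 / \<epsilon>\<^sup>2) * V (x / \<epsilon>)) z g y y'"
          using A(1,2) schroedinger_op_solution[OF g(2)] unfolding S_eps_def g(1) by blast
        obtain y0 y0' a b where y0: "Y' = abs_l2 y0" "interaction_solution \<theta> z g y0 y0' a b"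
          using A(3,4) S_theta_solution[OF g(2)] unfolding g(1) by blast
        have L: "L2 y" "L2 y0"
          using y(2) interaction_solutionD(3)[OF y0(2)] unfolding schroedinger_solution_def by blast+
        show "norm (Y - Y') \<le> K * sqrt \<epsilon> * norm f"
          unfolding y(1) y0(1) g(1) abs_l2_ops(2)[OF L] norm_abs_l2_eq[OF g(2)] norm_abs_l2_eq[OF sq_integrable_diff[OF L]]
          by (rule K(2)[rule_format, OF \<epsilon> g(2) y(2) y0(2)])
      qed (use K(1) \<epsilon> in simp)
    qed
    have "((\<lambda>\<epsilon>. norm (resolvent (S_eps V \<epsilon>) z - resolvent (S_theta \<theta>) z)) \<longlongrightarrow> 0) (at_right 0)"
    proof (rule tendsto_sandwich[of "\<lambda>_. 0"])
      have "((\<lambda>\<epsilon>. K * sqrt \<epsilon>) \<longlongrightarrow> K * sqrt 0) (at_right 0)" by (intro tendsto_intros)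
      then show "((\<lambda>\<epsilon>. K * sqrt \<epsilon>) \<longlongrightarrow> 0) (at_right 0)" by simp
      show "\<forall>\<^sub>F \<epsilon> in at_right 0. norm (resolvent (S_eps V \<epsilon>) z - resolvent (S_theta \<theta>) z) \<le> K * sqrt \<epsilon>"
        by (rule eventually_mono[OF eventually_at_right_real[of 0 1]]) (auto intro: le)
    qed auto
    then show "z \<in> resolvent_set (S_theta \<theta>) \<and> (\<forall>\<epsilon>>0. z \<in> resolvent_set (S_eps V \<epsilon>)) \<and>
        ((\<lambda>\<epsilon>. norm (resolvent (S_eps V \<epsilon>) z - resolvent (S_theta \<theta>) z)) \<longlongrightarrow> 0) (at_right 0)"
      using R0 R\<epsilon> unfolding resolvent_set_def by blast
  qed
qed

end
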